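(* Suppose that a real $6$-dimensional nilpotent Lie algebra $\mathfrak g$ possesses an open respectful decomposition $(H,V)$ with $\dim H=3$. Then the following conditions hold: (1) $\mathfrak g$ does not have a codimension one Abelian ideal, (2) the center $Z(\mathfrak g)$ of $\mathfrak g$ has dimension $\le 2$, (3) the vector space sum $[\mathfrak g,\mathfrak g]+Z(\mathfrak g)$ has dimension $\le 3$, (4) if $\dim Z(\mathfrak g)=1$ and $\dim[\mathfrak g,\mathfrak g]=3$, then $[\mathfrak g,[\mathfrak g,[\mathfrak g,\mathfrak g]]]\neq 0$. Up to isomorphism, there are exactly $14$ real nilpotent Lie algebras of dimension $6$ satisfying the four conditions (1)--(4). Conversely, each of these $14$ algebras possesses an open respectful decomposition $(H,V)$ with $\dim H=3$.
   Context: All Lie algebras are real and finite dimensional. For vector subspaces $A,B$ of a Lie algebra, $[A,B]$ denotes the linear span of all brackets $[a,b]$, $a\in A$, $b\in B$. An ordered pair $(H,V)$ of complementary vector subspaces of a Lie algebra $\mathfrak g$ (so $\mathfrak g=H\oplus V$ as a vector space) is a respectful decomposition of $\mathfrak g$ if $[V,H]\subseteq H$. It is open if neither $H$ nor $V$ is a Lie subalgebra of $\mathfrak g$. *)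

theory Defs
  imports "HOL-Analysis.Analysis"
begin

text \<open>
  A real Lie algebra is a bracket on a real vector space that is the whole type \<open>'a\<close>.
  As \<open>dim\<close> is \<open>0\<close> on spaces without a finite basis, \<open>dim (UNIV :: 'a set) = 6\<close> includes
  finite dimensionality.
\<close>

locale lie_algebra =
  fixes br :: "'a::real_vector \<Rightarrow> 'a \<Rightarrow> 'a"
  assumes bilinear_br: "bilinear br"
    and br_self: "br x x = 0"
    and jacobi: "br x (br y z) + br y (br z x) + br z (br x y) = 0"

definition bracket_span :: "('a::real_vector \<Rightarrow> 'a \<Rightarrow> 'a) \<Rightarrow> 'a set \<Rightarrow> 'a set \<Rightarrow> 'a set" where
  "bracket_span br A B = span {br a b | a b. a \<in> A \<and> b \<in> B}"

text \<open>Indexing: \<open>lower_central br 0\<close> is the whole algebra and \<open>lower_central br 1\<close> is the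
  derived algebra.\<close>

primrec lower_central :: "('a::real_vector \<Rightarrow> 'a \<Rightarrow> 'a) \<Rightarrow> nat \<Rightarrow> 'a set" where
  "lower_central br 0 = UNIV"
| "lower_central br (Suc n) = bracket_span br UNIV (lower_central br n)"

definition nilpotent_lie :: "('a::real_vector \<Rightarrow> 'a \<Rightarrow> 'a) \<Rightarrow> bool" where
  "nilpotent_lie br \<longleftrightarrow> (\<exists>n. lower_central br n = {0})"

definition derived_algebra :: "('a::real_vector \<Rightarrow> 'a \<Rightarrow> 'a) \<Rightarrow> 'a set" where
  "derived_algebra br = bracket_span br UNIV UNIV"

definition lie_center :: "('a::real_vector \<Rightarrow> 'a \<Rightarrow> 'a) \<Rightarrow> 'a set" where
  "lie_center br = {z. \<forall>x. br z x = 0}"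

definition lie_subalgebra :: "('a::real_vector \<Rightarrow> 'a \<Rightarrow> 'a) \<Rightarrow> 'a set \<Rightarrow> bool" where
  "lie_subalgebra br A \<longleftrightarrow> subspace A \<and> bracket_span br A A \<subseteq> A"

definition lie_ideal :: "('a::real_vector \<Rightarrow> 'a \<Rightarrow> 'a) \<Rightarrow> 'a set \<Rightarrow> bool" where
  "lie_ideal br I \<longleftrightarrow> subspace I \<and> bracket_span br UNIV I \<subseteq> I"

definition abelian_on :: "('a::real_vector \<Rightarrow> 'a \<Rightarrow> 'a) \<Rightarrow> 'a set \<Rightarrow> bool" where
  "abelian_on br A \<longleftrightarrow> (\<forall>x\<in>A. \<forall>y\<in>A. br x y = 0)"

definition lie_isomorphic ::
    "('a::real_vector \<Rightarrow> 'a \<Rightarrow> 'a) \<Rightarrow> ('b::real_vector \<Rightarrow> 'b \<Rightarrow> 'b) \<Rightarrow> bool" where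
  "lie_isomorphic br br' \<longleftrightarrow>
     (\<exists>f. linear f \<and> bij f \<and> (\<forall>x y. f (br x y) = br' (f x) (f y)))"

definition respectful_decomposition ::
    "('a::real_vector \<Rightarrow> 'a \<Rightarrow> 'a) \<Rightarrow> 'a set \<Rightarrow> 'a set \<Rightarrow> bool" where
  "respectful_decomposition br H V \<longleftrightarrow>
     subspace H \<and> subspace V \<and> H \<inter> V = {0} \<and> {h + v | h v. h \<in> H \<and> v \<in> V} = UNIV \<and>
     bracket_span br V H \<subseteq> H"

definition open_respectful_decomposition ::
    "('a::real_vector \<Rightarrow> 'a \<Rightarrow> 'a) \<Rightarrow> 'a set \<Rightarrow> 'a set \<Rightarrow> bool" where
  "open_respectful_decomposition br H V \<longleftrightarrow>
     respectful_decomposition br H V \<and> \<not> lie_subalgebra br H \<and> \<not> lie_subalgebra br V"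

definition nilpotent_lie_algebra_6 :: "('a::real_vector \<Rightarrow> 'a \<Rightarrow> 'a) \<Rightarrow> bool" where
  "nilpotent_lie_algebra_6 br \<longleftrightarrow>
     lie_algebra br \<and> nilpotent_lie br \<and> dim (UNIV :: 'a set) = 6"

definition four_conditions :: "('a::real_vector \<Rightarrow> 'a \<Rightarrow> 'a) \<Rightarrow> bool" where
  "four_conditions br \<longleftrightarrow>
     \<not> (\<exists>I. lie_ideal br I \<and> abelian_on br I \<and> dim I + 1 = dim (UNIV :: 'a set)) \<and>
     dim (lie_center br) \<le> 2 \<and>
     dim {x + z | x z. x \<in> derived_algebra br \<and> z \<in> lie_center br} \<le> 3 \<and>
     (dim (lie_center br) = 1 \<and> dim (derived_algebra br) = 3 \<longrightarrow>
        bracket_span br UNIV (bracket_span br UNIV (derived_algebra br)) \<noteq> {0})"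

end

theory Submission
  imports Defs
begin

text \<open>
  Let \<open>(H, V)\<close> be an open respectful decomposition. The \<open>H\<close>-component of a bracket of two elements
  of \<open>V\<close> lies in \<open>K = {x \<in> H. [x, H] \<subseteq> H}\<close>, and openness together with \<open>dim H = 3\<close> forces \<open>K\<close> to be a
  line. Nilpotency then makes \<open>V\<close> centralize \<open>K\<close>, and an Engel argument on \<open>H/K\<close> brings all brackets
  into triangular form, from which the four conditions can be read off.

  Conversely, condition (3) gives \<open>dim [g, g] \<le> 3\<close>. Depending on \<open>dim [g, g]\<close>, \<open>dim Z(g)\<close> and the
  position of \<open>[g, g]\<close> relative to \<open>Z(g)\<close>, an adapted basis identifies the algebra with a Heisenberg
  algebra plus a line or puts it into one of six families with real parameters; these reduce to
  fourteen algebras. They are told apart by the dimensions of the derived algebra, of the center, of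
  the span of all \<open>x\<close> with \<open>ad x\<close> of rank at most one, and of the centralizer of the derived algebra.
  Each of them has an explicit open respectful decomposition along coordinate vectors, so the four
  conditions hold by the first part.
\<close>

subsection \<open>Brackets and their spans\<close>

text \<open>\<open>K\<close> is the radical of the alternating map from \<open>H\<close> x
  \<open>H\<close> to g/\<open>H\<close> induced by the bracket. Openness of \<open>H\<close> makes
  this map nonzero, so its radical has codimension at least two in \<open>H\<close>; openness of
  \<open>V\<close> puts a nonzero vector into it. For \<open>dim H = 3\<close> the two bounds meet.
  Nilpotency mostly enters through one principle: on an invariant quotient, \<open>ad x\<close> has
  no nonzero eigenvalue.

  In the converse half, comparing two maps of the form \<open>ad x\<close> yields a pencil whose
  discriminant matters only up to a positive factor. Its sign gives three algebras in each of the
  two families \<open>alg_pencil\<close> and \<open>alg_twist\<close>; over the complex numbers the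
  signs -1 and 1 would merge. This is why elements of rank at most one serve as an invariant: being
  one involves an equation a^2 = D b^2 in the coordinates, whose real solutions are the origin, one
  line or two lines for D = -1, 0, 1.\<close>

lemma bracket_spanI: "a \<in> A \<Longrightarrow> b \<in> B \<Longrightarrow> br a b \<in> bracket_span br A B"
  unfolding bracket_span_def by (rule span_base) auto

lemma subspace_bracket_span [simp]: "subspace (bracket_span br A B)"
  by (simp add: bracket_span_def)

lemma bracket_span_least:
  "subspace S \<Longrightarrow> (\<And>a b. a \<in> A \<Longrightarrow> b \<in> B \<Longrightarrow> br a b \<in> S) \<Longrightarrow> bracket_span br A B \<subseteq> S"
  unfolding bracket_span_def by (rule span_minimal) auto

lemma bracket_span_mono:
  "A \<subseteq> A' \<Longrightarrow> B \<subseteq> B' \<Longrightarrow> bracket_span br A B \<subseteq> bracket_span br A' B'"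
  unfolding bracket_span_def by (rule span_mono) auto

lemma subspace_lower_central [simp]: "subspace (lower_central br n)"
  by (cases n) auto

lemma derived_algebra_br: "br x y \<in> derived_algebra br"
  by (simp add: derived_algebra_def bracket_spanI)

lemma subspace_derived_algebra [simp]: "subspace (derived_algebra br)"
  by (simp add: derived_algebra_def)

context lie_algebra
begin

lemmas br_linear [simp] =
  bilinear_ladd[OF bilinear_br] bilinear_radd[OF bilinear_br]
  bilinear_lmul[OF bilinear_br] bilinear_rmul[OF bilinear_br]
  bilinear_lneg[OF bilinear_br] bilinear_rneg[OF bilinear_br]
  bilinear_lzero[OF bilinear_br] bilinear_rzero[OF bilinear_br]
  bilinear_lsub[OF bilinear_br] bilinear_rsub[OF bilinear_br]

declare br_self [simp]

lemma br_anti: "br x y = - br y x"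
proof -
  have "br (x + y) (x + y) = br x x + br x y + (br y x + br y y)"
    by (simp del: br_self add: algebra_simps)
  then have "br x y + br y x = 0"
    by simp
  then show ?thesis
    by (simp add: eq_neg_iff_add_eq_0)
qed

lemma br_swap_0: "br x y = 0 \<Longrightarrow> br y x = 0"
  by (subst br_anti) simp

text \<open>The Jacobi identity as \<open>ad [x, y] = [ad x, ad y]\<close>: a subspace preserved by
  \<open>ad x\<close> and \<open>ad y\<close> is preserved by \<open>ad (br x y)\<close>.\<close>

lemma br_br_left: "br (br x y) z = br x (br y z) - br y (br x z)"
proof -
  have "br x (br y z) + br y (- br x z) - br (br x y) z = 0"
    using jacobi[of x y z] br_anti[of z "br x y"] br_anti[of z x] by simp
  then show ?thesis
    by (simp add: algebra_simps)
qed

lemma linear_br_left: "linear (\<lambda>y. br x y)"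
  using bilinear_br by (simp add: bilinear_def)

lemma linear_br_right: "linear (\<lambda>x. br x y)"
  using bilinear_br by (simp add: bilinear_def)

lemma subspace_lie_center [simp]: "subspace (lie_center br)"
  by (auto simp: subspace_def lie_center_def)

lemma lie_center_br: "z \<in> lie_center br \<Longrightarrow> br z x = 0" "z \<in> lie_center br \<Longrightarrow> br x z = 0"
  by (auto simp: lie_center_def intro: br_swap_0)

end

subsection \<open>Invariance under isomorphism\<close>

lemma linear_inv_bij:
  assumes "linear f" "bij f"
  shows "linear (inv f)"
proof (rule linearI)
  have *: "inv f y = x \<longleftrightarrow> y = f x" for x y
    using assms(2) by (metis bij_inv_eq_iff)
  have **: "f (inv f y) = y" for y
    using assms(2) by (simp add: bij_is_surj surj_f_inv_f)
  show "inv f (x + y) = inv f x + inv f y" for x y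
    by (simp add: * ** linear_add[OF assms(1)])
  show "inv f (c *\<^sub>R x) = c *\<^sub>R inv f x" for c x
    by (simp add: * ** linear_cmul[OF assms(1)])
qed

text \<open>A basis goes to a basis of the same cardinality; if it is infinite, both sides are the
  default value 0.\<close>

lemma dim_image_inj:
  fixes f :: "'a::real_vector \<Rightarrow> 'b::real_vector"
  assumes "linear f" "inj f"
  shows "dim (f ` S) = dim S"
proof -
  obtain B where B: "B \<subseteq> S" "independent B" "S \<subseteq> span B" "card B = dim S"
    using basis_exists by blast
  have "independent (f ` B)"
    using B(2) assms by (intro linear_independent_injective_image) (auto intro: inj_on_subset)
  moreover have "f ` S \<subseteq> span (f ` B)"
    using B(3) linear_span_image[OF assms(1)] by auto
  moreover have "card (f ` B) = dim S"
    using B(4) assms(2) by (metis card_image inj_on_subset subset_UNIV)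
  ultimately show ?thesis
    using B(1) by (intro dim_unique[of "f ` B"]) auto
qed

locale lie_isomorphism =
  fixes br :: "'a::real_vector \<Rightarrow> 'a \<Rightarrow> 'a" and br' :: "'b::real_vector \<Rightarrow> 'b \<Rightarrow> 'b"
    and f :: "'a \<Rightarrow> 'b"
  assumes linear: "linear f" and bij: "bij f" and hom: "f (br x y) = br' (f x) (f y)"
begin

lemma dim_image: "dim (f ` S) = dim S"
  using linear bij by (simp add: dim_image_inj bij_is_inj)

lemma image_UNIV: "f ` UNIV = UNIV"
  using bij by (simp add: bij_is_surj)

lemma image_eq_zero: "f ` S = {0} \<longleftrightarrow> S = {0}"
  using bij_is_inj[OF bij] linear_0[OF linear]
  by (metis image_empty image_insert inj_image_eq_iff)

lemma all_image: "(\<forall>y. P y) \<longleftrightarrow> (\<forall>x. P (f x))"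
  using bij by (metis bij_pointE)

lemma eq_zero: "f x = 0 \<longleftrightarrow> x = 0"
  using bij_is_inj[OF bij] linear_0[OF linear] by (metis injD)

lemma image_sums: "f ` {x + y |x y. x \<in> A \<and> y \<in> B} = {x + y |x y. x \<in> f ` A \<and> y \<in> f ` B}"
proof -
  have "f (x + y) = f x + f y" for x y
    by (rule linear_add[OF linear])
  then show ?thesis
    by (fastforce simp: image_iff)
qed

lemma image_bracket_span: "f ` bracket_span br A B = bracket_span br' (f ` A) (f ` B)"
proof -
  have "f ` {br a b |a b. a \<in> A \<and> b \<in> B} = {br' a b |a b. a \<in> f ` A \<and> b \<in> f ` B}"
    by (fastforce simp: image_iff hom)
  then show ?thesis
    by (simp add: bracket_span_def linear_span_image[OF linear, symmetric])
qed

lemma image_lower_central: "f ` lower_central br n = lower_central br' n"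
  by (induction n) (simp_all add: image_bracket_span image_UNIV)

lemma image_derived_algebra: "f ` derived_algebra br = derived_algebra br'"
  by (simp add: derived_algebra_def image_bracket_span image_UNIV)

lemma image_eqI:
  assumes "\<And>x. f x \<in> B \<longleftrightarrow> x \<in> A"
  shows "f ` A = B"
proof (rule set_eqI)
  fix y
  obtain x where "y = f x"
    using bij by (metis bij_pointE)
  then show "y \<in> f ` A \<longleftrightarrow> y \<in> B"
    using assms bij_is_inj[OF bij] by (simp add: inj_image_mem_iff)
qed

lemma image_lie_center: "f ` lie_center br = lie_center br'"
  by (rule image_eqI) (simp add: lie_center_def all_image hom[symmetric] eq_zero)

lemma nilpotent_lie_image: "nilpotent_lie br \<longleftrightarrow> nilpotent_lie br'"
  by (simp add: nilpotent_lie_def image_lower_central[symmetric] image_eq_zero)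

lemma lie_algebra_image:
  assumes "lie_algebra br"
  shows "lie_algebra br'"
proof -
  interpret lie_algebra br
    by (rule assms)
  define g where "g = inv f"
  have g: "linear g" "\<And>y. f (g y) = y"
    using linear bij by (simp_all add: g_def linear_inv_bij bij_is_surj surj_f_inv_f)
  have br': "br' = (\<lambda>x y. f (br (g x) (g y)))"
    by (simp add: hom g fun_eq_iff)
  have "bilinear br'"
    unfolding br' bilinear_def using linear g(1) linear_br_left linear_br_right
    by (auto intro!: linear_compose[unfolded o_def, of _ f] linear_compose[unfolded o_def, of g])
  moreover have "br' x x = 0" for x
    by (simp add: br' linear_0[OF linear])
  moreover have "br' x (br' y z) + br' y (br' z x) + br' z (br' x y) = 0" for x y z
  proof -
    have "f (br (g x) (br (g y) (g z)) + br (g y) (br (g z) (g x)) + br (g z) (br (g x) (g y))) = 0"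
      by (simp add: jacobi linear_0[OF linear])
    then show ?thesis
      by (simp add: hom linear_add[OF linear] g(2))
  qed
  ultimately show ?thesis
    by unfold_locales
qed

lemma nilpotent_lie_algebra_6_image: "nilpotent_lie_algebra_6 br \<Longrightarrow> nilpotent_lie_algebra_6 br'"
  using nilpotent_lie_image lie_algebra_image dim_image[of UNIV]
  by (simp add: nilpotent_lie_algebra_6_def image_UNIV)

lemma lie_subalgebra_image: "subspace A \<Longrightarrow> lie_subalgebra br A \<longleftrightarrow> lie_subalgebra br' (f ` A)"
  using bij_is_inj[OF bij] linear_subspace_image[OF linear]
  by (simp add: lie_subalgebra_def image_bracket_span[symmetric] inj_image_subset_iff)

lemma open_respectful_decomposition_image:
  assumes "open_respectful_decomposition br H V"
  shows "open_respectful_decomposition br' (f ` H) (f ` V)"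
proof -
  note ass = assms[unfolded open_respectful_decomposition_def respectful_decomposition_def]
  have "f ` H \<inter> f ` V = f ` {0}"
    using ass bij_is_inj[OF bij] by (metis image_Int)
  moreover have "{h + v |h v. h \<in> f ` H \<and> v \<in> f ` V} = f ` {h + v |h v. h \<in> H \<and> v \<in> V}"
    by (rule image_sums[symmetric])
  moreover have "bracket_span br' (f ` V) (f ` H) \<subseteq> f ` H"
    using ass by (simp add: image_bracket_span[symmetric] image_mono)
  ultimately show ?thesis
    unfolding open_respectful_decomposition_def respectful_decomposition_def
    using ass lie_subalgebra_image linear_subspace_image[OF linear] linear_0[OF linear]
    by (auto simp: image_UNIV)
qed

text \<open>Condition (1) is a non-existence statement: an ideal of \<open>br\<close> is pushed
  forward and refuted in \<open>br'\<close>. Hence the direction from \<open>br'\<close> back to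
  \<open>br\<close>.\<close>

lemma four_conditions_image:
  assumes "four_conditions br'"
  shows "four_conditions br"
proof -
  have "\<not> (\<exists>I. lie_ideal br I \<and> abelian_on br I \<and> dim I + 1 = dim (UNIV :: 'a set))"
  proof
    assume "\<exists>I. lie_ideal br I \<and> abelian_on br I \<and> dim I + 1 = dim (UNIV :: 'a set)"
    then obtain I where I: "subspace I" "bracket_span br UNIV I \<subseteq> I" "abelian_on br I"
      "dim I + 1 = dim (UNIV :: 'a set)"
      by (auto simp: lie_ideal_def)
    have "bracket_span br' UNIV (f ` I) \<subseteq> f ` I"
      using image_mono[OF I(2), of f] by (simp add: image_bracket_span image_UNIV)
    then have "lie_ideal br' (f ` I)"
      using linear_subspace_image[OF linear I(1)] by (simp add: lie_ideal_def)
    moreover have "abelian_on br' (f ` I)"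
      using I(3) by (simp add: abelian_on_def hom[symmetric] linear_0[OF linear])
    moreover have "dim (f ` I) + 1 = dim (UNIV :: 'b set)"
      using I(4) dim_image image_UNIV by metis
    ultimately show False
      using assms unfolding four_conditions_def by blast
  qed
  moreover have "dim (lie_center br) = dim (lie_center br')"
    "dim (derived_algebra br) = dim (derived_algebra br')"
    by (metis dim_image image_lie_center) (metis dim_image image_derived_algebra)
  moreover have "{x + z |x z. x \<in> derived_algebra br' \<and> z \<in> lie_center br'}
      = f ` {x + z |x z. x \<in> derived_algebra br \<and> z \<in> lie_center br}"
    unfolding image_lie_center[symmetric] image_derived_algebra[symmetric] by (rule image_sums[symmetric])
  then have "dim {x + z |x z. x \<in> derived_algebra br \<and> z \<in> lie_center br}
      = dim {x + z |x z. x \<in> derived_algebra br' \<and> z \<in> lie_center br'}"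
    by (simp add: dim_image)
  moreover have "bracket_span br UNIV (bracket_span br UNIV (derived_algebra br)) = {0} \<longleftrightarrow>
      bracket_span br' UNIV (bracket_span br' UNIV (derived_algebra br')) = {0}"
    by (metis image_bracket_span image_derived_algebra image_UNIV image_eq_zero)
  ultimately show ?thesis
    using assms unfolding four_conditions_def by simp
qed

end

lemma lie_isomorphic_iff: "lie_isomorphic br br' \<longleftrightarrow> (\<exists>f. lie_isomorphism br br' f)"
  by (auto simp: lie_isomorphic_def lie_isomorphism_def)

lemma lie_isomorphism_inv:
  assumes "lie_isomorphism br br' f"
  shows "lie_isomorphism br' br (inv f)"
proof -
  interpret lie_isomorphism br br' f
    by (rule assms)
  have right: "f (inv f y) = y" for y
    using bij by (simp add: bij_is_surj surj_f_inv_f)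
  have left: "inv f (f x) = x" for x
    using bij by (simp add: bij_is_inj)
  show ?thesis
    unfolding lie_isomorphism_def
  proof (intro conjI allI)
    show "linear (inv f)" "bij (inv f)"
      using linear bij by (simp_all add: linear_inv_bij bij_imp_bij_inv)
    show "inv f (br' x y) = br (inv f x) (inv f y)" for x y
      using left[of "br (inv f x) (inv f y)"] by (simp add: hom right)
  qed
qed

lemma lie_isomorphic_sym: "lie_isomorphic br br' \<Longrightarrow> lie_isomorphic br' br"
  using lie_isomorphism_inv lie_isomorphic_iff by metis

lemma lie_isomorphic_trans:
  "lie_isomorphic br br' \<Longrightarrow> lie_isomorphic br' br'' \<Longrightarrow> lie_isomorphic br br''"
  unfolding lie_isomorphic_def by (metis bij_comp comp_apply linear_compose)

text \<open>Gives access to the dimension theory of Euclidean spaces, which \<open>real_vector\<close> lacks.\<close>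

lemma lie_isomorphic_real6:
  fixes br :: "'a::real_vector \<Rightarrow> 'a \<Rightarrow> 'a"
  assumes "dim (UNIV :: 'a set) = 6"
  obtains br' :: "real^6 \<Rightarrow> real^6 \<Rightarrow> real^6" where "lie_isomorphic br br'"
proof -
  obtain B :: "'a set" where B: "independent B" "UNIV \<subseteq> span B" "card B = 6"
    using basis_exists[of "UNIV :: 'a set"] assms by auto
  have fin: "finite B"
    using B(3) by (metis card.infinite zero_neq_numeral)
  have "card (Basis :: (real^6) set) = card B"
    using B(3) by simp
  then obtain h where h: "bij_betw h (Basis :: (real^6) set) B"
    using finite_same_card_bij[OF finite_Basis fin] by metis
  obtain g where g: "linear g" "\<And>x. x \<in> Basis \<Longrightarrow> g x = h x"
    using linear_independent_extend[OF independent_Basis, of h] by metis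
  have gB: "g ` Basis = B" and inj: "inj_on g Basis"
    using g(2) h inj_on_cong[of Basis g h] by (auto simp: bij_betw_def)
  have "surj g"
    using B(2) linear_span_image[OF g(1), of Basis] gB by auto
  moreover have "inj g"
    using linear_inj_on_span_independent_image[OF g(1), of Basis] gB B(1) inj by simp
  ultimately have "bij g"
    by (simp add: bij_def)
  have "lie_isomorphism (\<lambda>x y. inv g (br (g x) (g y))) br g"
    using g(1) \<open>bij g\<close> by (simp add: lie_isomorphism_def bij_is_surj surj_f_inv_f)
  then show ?thesis
    using that lie_isomorphic_sym lie_isomorphic_iff by metis
qed

subsection \<open>Small spanning sets\<close>

lemma in_span_2: "v \<in> span {x, y} \<longleftrightarrow> (\<exists>a b. v = a *\<^sub>R x + b *\<^sub>R y)"
  unfolding span_breakdown_eq span_empty by (simp add: algebra_simps)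

lemma in_span_3: "v \<in> span {x, y, z} \<longleftrightarrow> (\<exists>a b c. v = a *\<^sub>R x + b *\<^sub>R y + c *\<^sub>R z)"
  unfolding span_breakdown_eq span_empty by (simp add: algebra_simps)

lemma dim_3_combination:
  fixes x y z :: "'a::euclidean_space"
  assumes "subspace S" "dim S = 3" "x \<in> S" "y \<in> S" "z \<in> S"
    and ind: "\<And>a b c. a *\<^sub>R x + b *\<^sub>R y + c *\<^sub>R z = 0 \<Longrightarrow> a = 0 \<and> b = 0 \<and> c = 0"
  shows "span {x, y, z} = S"
proof (rule subspace_dim_equal)
  have "x \<notin> span {y, z}"
  proof
    assume "x \<in> span {y, z}"
    then obtain b c where "x = b *\<^sub>R y + c *\<^sub>R z"
      by (auto simp: in_span_2)
    then show False
      using ind[of 1 "-b" "-c"] by simp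
  qed
  moreover have "y \<notin> span {z}"
  proof
    assume "y \<in> span {z}"
    then obtain c where "y = c *\<^sub>R z"
      by (auto simp: span_singleton)
    then show False
      using ind[of 0 1 "-c"] by simp
  qed
  moreover have "z \<noteq> 0"
    using ind[of 0 0 1] by auto
  ultimately have "dim {x, y, z} = 3"
    by (simp add: dim_insert)
  then show "dim S \<le> dim (span {x, y, z})"
    using assms(2) by simp
  show "span {x, y, z} \<subseteq> S"
    using assms by (intro span_minimal) auto
qed (use assms in auto)

lemma codim_1_complement:
  fixes I :: "'a::euclidean_space set"
  assumes "subspace I" "dim I + 1 = DIM('a)" "x \<notin> I"
  obtains t where "y - t *\<^sub>R x \<in> I"
proof -
  have "span I = I"
    using assms(1) by (simp add: span_eq_iff)
  then have "x \<notin> span I"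
    using assms(3) by metis
  then have "dim (insert x I) = DIM('a)"
    using assms(2) by (simp add: dim_insert)
  then have "y \<in> span (insert x I)"
    by (metis UNIV_I dim_eq_full)
  then show ?thesis
    using that \<open>span I = I\<close> by (auto simp: span_breakdown_eq)
qed

subsection \<open>Consequences of nilpotency\<close>

locale nilpotent_lie_algebra = lie_algebra br for br :: "'a::real_vector \<Rightarrow> 'a \<Rightarrow> 'a" +
  assumes nilpotent: "nilpotent_lie br"
begin

text \<open>Iterating \<open>step\<close> writes each element of \<open>S\<close> as an arbitrarily
  long iterated bracket plus an element of \<open>N\<close>; long brackets vanish.\<close>

lemma nilpotent_descent:
  assumes "subspace N"
    and step: "\<And>s. s \<in> S \<Longrightarrow> \<exists>x\<in>X. \<exists>s'\<in>S. \<exists>n\<in>N. s = br x s' + n"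
    and stable: "\<And>x n. x \<in> X \<Longrightarrow> n \<in> N \<Longrightarrow> br x n \<in> N"
  shows "S \<subseteq> N"
proof -
  have *: "\<exists>l\<in>lower_central br j. \<exists>n\<in>N. s = l + n" if "s \<in> S" for s j
    using that
  proof (induction j arbitrary: s)
    case 0
    then show ?case
      using subspace_0[OF assms(1)] by (metis UNIV_I add.right_neutral lower_central.simps(1))
  next
    case (Suc j)
    obtain x s' n where s: "x \<in> X" "s' \<in> S" "n \<in> N" "s = br x s' + n"
      using step[OF Suc.prems] by blast
    obtain l m where l: "l \<in> lower_central br j" "m \<in> N" "s' = l + m"
      using Suc.IH[OF s(2)] by blast
    have "br x l \<in> lower_central br (Suc j)"
      using l(1) by (simp add: bracket_spanI)
    moreover have "br x m + n \<in> N"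
      using stable s l assms(1) by (simp add: subspace_add)
    moreover have "s = br x l + (br x m + n)"
      by (simp add: s l)
    ultimately show ?case
      by blast
  qed
  obtain j where "lower_central br j = {0}"
    using nilpotent by (auto simp: nilpotent_lie_def)
  then show ?thesis
    using *[of _ j] by fastforce
qed

text \<open>For nonzero \<open>c\<close>, the vector \<open>y\<close> is \<open>br x (y / c)\<close>
  modulo \<open>N\<close>, so the line of \<open>y\<close> reproduces itself under
  \<open>ad x\<close> and the descent pushes it into \<open>N\<close>.\<close>

lemma eigenvalue_mod:
  assumes "subspace N" "br x y - c *\<^sub>R y \<in> N" "\<And>n. n \<in> N \<Longrightarrow> br x n \<in> N" "y \<notin> N"
  shows "c = 0"
proof (rule ccontr)
  assume c: "c \<noteq> 0"
  have "span {y} \<subseteq> N"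
  proof (rule nilpotent_descent[where X = "{x}"])
    fix s assume "s \<in> span {y}"
    then obtain t where t: "s = t *\<^sub>R y"
      by (auto simp: span_singleton)
    have "s = br x ((t / c) *\<^sub>R y) + - (t / c) *\<^sub>R (br x y - c *\<^sub>R y)"
      using c by (simp add: t algebra_simps)
    moreover have "(t / c) *\<^sub>R y \<in> span {y}"
      by (simp add: span_base span_scale)
    moreover have "- (t / c) *\<^sub>R (br x y - c *\<^sub>R y) \<in> N"
      using assms(1,2) subspace_scale by blast
    ultimately show "\<exists>x\<in>{x}. \<exists>s'\<in>span {y}. \<exists>n\<in>N. s = br x s' + n"
      by blast
  qed (use assms in auto)
  then show False
    using assms(4) span_base by blast
qed

lemma eigenvalue:
  assumes "br x y = c *\<^sub>R y" "y \<noteq> 0"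
  shows "c = 0"
  using eigenvalue_mod[of "{0}" x y c] assms by simp

text \<open>The matrix of \<open>br x\<close> on the plane of \<open>h\<close> and \<open>u\<close> modulo \<open>N\<close> is a companion matrix;
  its determinant \<open>d\<close> vanishes.\<close>

lemma companion_det_mod:
  assumes "subspace N" "br x u + d *\<^sub>R h - s *\<^sub>R u \<in> N" "br x h = u"
    "\<And>n. n \<in> N \<Longrightarrow> br x n \<in> N" "h \<notin> N"
  shows "d = 0"
proof (rule ccontr)
  assume d: "d \<noteq> 0"
  define n where "n = br x u + d *\<^sub>R h - s *\<^sub>R u"
  have "span {h, u} \<subseteq> N"
  proof (rule nilpotent_descent[where X = "{x}"])
    fix v assume "v \<in> span {h, u}"
    then obtain a b where v: "v = a *\<^sub>R h + b *\<^sub>R u"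
      by (auto simp: in_span_2)
    \<comment> \<open>The solution of \<open>v = br x (p *\<^sub>R h + q *\<^sub>R u)\<close> modulo
      \<open>N\<close>, which exists because \<open>d\<close> is nonzero.\<close>
    define q p where "q = - a / d" and "p = b - q * s"
    have "v = br x (p *\<^sub>R h + q *\<^sub>R u) + - q *\<^sub>R n"
      using d by (simp add: v assms(3) n_def p_def q_def algebra_simps)
    moreover have "p *\<^sub>R h + q *\<^sub>R u \<in> span {h, u}"
      by (auto simp: in_span_2)
    moreover have "- q *\<^sub>R n \<in> N"
      using assms(1,2) subspace_scale n_def by blast
    ultimately show "\<exists>x\<in>{x}. \<exists>s'\<in>span {h, u}. \<exists>n\<in>N. v = br x s' + n"
      by blast
  qed (use assms in auto)
  then show False
    using assms(5) span_base by blast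
qed

text \<open>Otherwise each vector of \<open>H - K\<close> is moved by some \<open>m\<close> to
  another one, which gives vectors outside \<open>K\<close> in every lower central term, although
  the last of these terms is 0 and 0 lies in \<open>K\<close>.\<close>

lemma engel_vector:
  assumes "h \<in> H - K" "0 \<in> K" "\<And>m h. m \<in> M \<Longrightarrow> h \<in> H \<Longrightarrow> br m h \<in> H"
  obtains h' where "h' \<in> H - K" "\<And>m. m \<in> M \<Longrightarrow> br m h' \<in> K"
proof -
  have False if moved: "\<And>h. h \<in> H - K \<Longrightarrow> \<exists>m\<in>M. br m h \<notin> K"
  proof -
    have "\<exists>h\<in>H - K. h \<in> lower_central br j" for j
    proof (induction j)
      case 0
      then show ?case
        using assms(1) by auto
    next
      case (Suc j)
      then obtain h where h: "h \<in> H - K" "h \<in> lower_central br j"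
        by blast
      obtain m where "m \<in> M" "br m h \<notin> K"
        using moved[OF h(1)] by blast
      moreover have "br m h \<in> lower_central br (Suc j)"
        using h(2) by (simp add: bracket_spanI)
      ultimately show ?case
        using h(1) assms(3) by blast
    qed
    moreover obtain j where "lower_central br j = {0}"
      using nilpotent by (auto simp: nilpotent_lie_def)
    ultimately show False
      using assms(2) by (metis DiffE singletonD)
  qed
  then show ?thesis
    using that by blast
qed

end

subsection \<open>The structure of an open respectful decomposition\<close>

locale open_decomposition = nilpotent_lie_algebra br
  for br :: "'a::euclidean_space \<Rightarrow> 'a \<Rightarrow> 'a" +
  fixes H V :: "'a set"
  assumes decomposition: "open_respectful_decomposition br H V"
    and dim_H: "dim H = 3" and dim_6: "DIM('a) = 6"
begin

lemma subspace_H: "subspace H" and subspace_V: "subspace V"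
  using decomposition
  by (auto simp: open_respectful_decomposition_def respectful_decomposition_def)

lemmas H_closed = subspace_add[OF subspace_H] subspace_diff[OF subspace_H]
  subspace_neg[OF subspace_H] subspace_0[OF subspace_H] subspace_scale[OF subspace_H]

lemmas V_closed = subspace_add[OF subspace_V] subspace_diff[OF subspace_V]
  subspace_neg[OF subspace_V] subspace_0[OF subspace_V] subspace_scale[OF subspace_V]

lemma H_V_disjoint: "x \<in> H \<Longrightarrow> x \<in> V \<Longrightarrow> x = 0"
  using decomposition
  by (auto simp: open_respectful_decomposition_def respectful_decomposition_def)

lemma H_V_decompose: obtains h v where "h \<in> H" "v \<in> V" "x = h + v"
proof -
  have "x \<in> {h + v | h v. h \<in> H \<and> v \<in> V}"
    using decomposition
    by (simp add: open_respectful_decomposition_def respectful_decomposition_def)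
  then show ?thesis
    using that by blast
qed

lemma V_part_zero:
  assumes "x + v \<in> H" "x \<in> H" "v \<in> V"
  shows "v = 0"
  using H_V_disjoint assms H_closed(2)[OF assms(1,2)] by simp

lemma scale_notin_H:
  assumes "c *\<^sub>R x \<in> H" "x \<notin> H"
  shows "c = 0"
  using subspace_scale[OF subspace_H assms(1), of "inverse c"] assms(2) by (cases "c = 0") auto

lemma br_V_H: "v \<in> V \<Longrightarrow> h \<in> H \<Longrightarrow> br v h \<in> H"
  using decomposition bracket_spanI[of v V h H br]
  by (auto simp: open_respectful_decomposition_def respectful_decomposition_def)

lemma br_H_V: "v \<in> V \<Longrightarrow> h \<in> H \<Longrightarrow> br h v \<in> H"
  using br_V_H H_closed(3) by (subst br_anti) auto

lemma not_closed_H: obtains g1 g2 where "g1 \<in> H" "g2 \<in> H" "br g1 g2 \<notin> H"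
proof -
  have "\<not> bracket_span br H H \<subseteq> H"
    using decomposition subspace_H
    by (simp add: open_respectful_decomposition_def lie_subalgebra_def)
  then show ?thesis
    using bracket_span_least[OF subspace_H] that by blast
qed

lemma not_closed_V: obtains v1 v2 where "v1 \<in> V" "v2 \<in> V" "br v1 v2 \<notin> V"
proof -
  have "\<not> bracket_span br V V \<subseteq> V"
    using decomposition subspace_V
    by (simp add: open_respectful_decomposition_def lie_subalgebra_def)
  then show ?thesis
    using bracket_span_least[OF subspace_V] that by blast
qed

section \<open>The radical \<open>K\<close> and the action of \<open>V\<close> on it\<close>

definition K :: "'a set" where
  "K = {x \<in> H. \<forall>h\<in>H. br x h \<in> H}"

lemma subspace_K: "subspace K"
  using subspace_H by (auto simp: K_def subspace_def)

text \<open>\<open>ad k\<close> equals \<open>[ad v, ad w] - ad b\<close>, and each of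
  \<open>ad v\<close>, \<open>ad w\<close>, \<open>ad b\<close> preserves \<open>H\<close>.\<close>

lemma H_part_in_K:
  assumes "v \<in> V" "w \<in> V" "br v w = k + b" "k \<in> H" "b \<in> V"
  shows "k \<in> K"
proof -
  have "br k h \<in> H" if "h \<in> H" for h
  proof -
    have "k = br v w - b"
      using assms(3) by simp
    then have "br k h = br v (br w h) - br w (br v h) - br b h"
      by (simp add: br_br_left)
    then show ?thesis
      using that assms H_closed br_V_H by simp
  qed
  then show ?thesis
    using assms(4) by (simp add: K_def)
qed

text \<open>Bracketing the combination with \<open>g2\<close> and then with \<open>g1\<close>
  isolates \<open>a\<close> and \<open>b\<close> modulo \<open>H\<close>, as \<open>k\<close> lies
  in the radical.\<close>

lemma independent_H:
  assumes "g1 \<in> H" "g2 \<in> H" "br g1 g2 \<notin> H" "k \<in> K" "k \<noteq> 0"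
    and zero: "a *\<^sub>R g1 + b *\<^sub>R g2 + c *\<^sub>R k = 0"
  shows "a = 0 \<and> b = 0 \<and> c = 0"
proof -
  have kH: "br k g1 \<in> H" "br k g2 \<in> H"
    using assms by (auto simp: K_def)
  have "br (a *\<^sub>R g1 + b *\<^sub>R g2 + c *\<^sub>R k) g2 = 0"
    using zero by simp
  then have "a *\<^sub>R br g1 g2 = - c *\<^sub>R br k g2"
    by (simp add: add_eq_0_iff)
  then have "a *\<^sub>R br g1 g2 \<in> H"
    using kH H_closed by simp
  then have a: "a = 0"
    using assms(3) scale_notin_H by blast
  have "br (a *\<^sub>R g1 + b *\<^sub>R g2 + c *\<^sub>R k) g1 = 0"
    using zero by simp
  then have "b *\<^sub>R br g1 g2 = c *\<^sub>R br k g1"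
    using br_anti[of g2 g1] by (simp add: a add_eq_0_iff)
  then have "b *\<^sub>R br g1 g2 \<in> H"
    using kH H_closed by simp
  then have b: "b = 0"
    using assms(3) scale_notin_H by blast
  show ?thesis
    using a b zero assms(5) by simp
qed

lemma span_H:
  assumes "g1 \<in> H" "g2 \<in> H" "br g1 g2 \<notin> H" "k \<in> K" "k \<noteq> 0"
  shows "span {g1, g2, k} = H"
  by (rule dim_3_combination[OF subspace_H dim_H])
    (use assms independent_H[OF assms] in \<open>auto simp: K_def\<close>)

text \<open>Write \<open>x\<close> in the basis \<open>g1\<close>, \<open>g2\<close>,
  \<open>k\<close> of \<open>H\<close>. The part in \<open>g1\<close>, \<open>g2\<close> again lies
  in \<open>K\<close>, and bracketing it with \<open>g2\<close> and \<open>g1\<close> modulo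
  \<open>H\<close> shows that it vanishes.\<close>

lemma K_line:
  assumes "k \<in> K" "k \<noteq> 0" "x \<in> K"
  obtains c where "x = c *\<^sub>R k"
proof -
  obtain g1 g2 where g: "g1 \<in> H" "g2 \<in> H" "br g1 g2 \<notin> H"
    by (rule not_closed_H)
  have "x \<in> span {g1, g2, k}"
    using span_H[OF g assms(1,2)] assms(3) by (simp add: K_def)
  then obtain a b c where x: "x = a *\<^sub>R g1 + b *\<^sub>R g2 + c *\<^sub>R k"
    by (auto simp: in_span_3)
  have "x - c *\<^sub>R k \<in> K"
    using assms subspace_K by (simp add: subspace_diff subspace_scale)
  then have y: "a *\<^sub>R g1 + b *\<^sub>R g2 \<in> K"
    by (simp add: x)
  have "a *\<^sub>R br g1 g2 \<in> H" "b *\<^sub>R br g2 g1 \<in> H"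
    using y g by (auto simp: K_def)
  moreover have "b *\<^sub>R br g2 g1 = - b *\<^sub>R br g1 g2"
    using br_anti[of g2 g1] by simp
  ultimately have "a = 0 \<and> - b = 0"
    using g(3) scale_notin_H by metis
  then have "x = c *\<^sub>R k"
    using x by simp
  then show ?thesis
    by (rule that)
qed

text \<open>By Jacobi \<open>ad v\<close> preserves the line \<open>K\<close>, so \<open>k\<close>
  is an eigenvector and its eigenvalue is 0.\<close>

lemma V_centralizes_K:
  assumes "v \<in> V" "k \<in> K"
  shows "br v k = 0"
proof (cases "k = 0")
  case False
  have "br (br v k) h \<in> H" if "h \<in> H" for h
    using assms that br_V_H H_closed by (auto simp: br_br_left K_def)
  then have "br v k \<in> K"
    using assms br_V_H by (simp add: K_def)
  then obtain c where "br v k = c *\<^sub>R k"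
    using K_line assms(2) False by blast
  then show ?thesis
    using eigenvalue[of v k c] False by simp
qed auto

text \<open>\<open>H\<close> contains \<open>x\<close> outside \<open>I\<close> and
  \<open>x'\<close> with \<open>br x' x\<close> outside \<open>H\<close>. If
  \<open>v - t *\<^sub>R x\<close> and \<open>x' - s *\<^sub>R x\<close> lie in \<open>I\<close>,
  they commute, which places \<open>t *\<^sub>R br x' x\<close> in \<open>H\<close> and forces
  \<open>t = 0\<close>. So \<open>V\<close> lies in \<open>I\<close>, is abelian, and would be a
  subalgebra.\<close>

lemma codim_1_not_abelian:
  assumes "subspace I" "abelian_on br I" "dim I + 1 = 6"
  shows False
proof -
  have I: "br x y = 0" if "x \<in> I" "y \<in> I" for x y
    using assms(2) that by (simp add: abelian_on_def)
  obtain g1 g2 where g: "g1 \<in> H" "g2 \<in> H" "br g1 g2 \<notin> H"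
    by (rule not_closed_H)
  obtain v1 v2 where v: "v1 \<in> V" "v2 \<in> V" "br v1 v2 \<notin> V"
    by (rule not_closed_V)
  obtain x x' where x: "x \<in> H" "x' \<in> H" "br x' x \<notin> H" "x \<notin> I"
  proof (cases "g1 \<in> I")
    case True
    then have "g2 \<notin> I"
      using g(3) I[of g1 g2] H_closed(4) by auto
    then show ?thesis
      using that g by blast
  next
    case False
    have "br g2 g1 \<notin> H"
      using g(3) br_anti[of g2 g1] H_closed(3)[of "br g2 g1"] by auto
    then show ?thesis
      using that g False by blast
  qed
  obtain s where s: "x' - s *\<^sub>R x \<in> I"
    using codim_1_complement assms(1,3) x(4) dim_6 by metis
  have "v \<in> I" if vV: "v \<in> V" for v
  proof -
    obtain t where t: "v - t *\<^sub>R x \<in> I"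
      using codim_1_complement assms(1,3) x(4) dim_6 by metis
    have "br (x' - s *\<^sub>R x) (v - t *\<^sub>R x) = 0"
      using I s t by blast
    then have "t *\<^sub>R br x' x = br (x' - s *\<^sub>R x) v"
      by (simp add: algebra_simps)
    moreover have "br (x' - s *\<^sub>R x) v \<in> H"
      by (rule br_H_V[OF vV]) (simp add: H_closed x)
    ultimately have "t *\<^sub>R br x' x \<in> H"
      by simp
    then have "t = 0"
      using x(3) scale_notin_H by blast
    then show ?thesis
      using t by simp
  qed
  then show False
    using I[of v1 v2] v V_closed(4) by auto
qed


text \<open>Openness supplies \<open>v0\<close>, the \<open>V\<close>-part of
  \<open>br h1 h2\<close>, and \<open>k\<close>, the \<open>H\<close>-part of
  \<open>br v1 v2\<close>; both are nonzero. Coefficients that act as eigenvalues are then removed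
  by nilpotency. Two flags are possible, since \<open>ad h1\<close> may lead from \<open>k\<close>
  to \<open>h2\<close> (nonzero \<open>\<kappa>\<close>) or \<open>V\<close> from \<open>h2\<close>
  to \<open>k\<close> (nonzero \<open>\<theta>\<close>); the last conclusion records what
  \<open>\<kappa> = 0\<close> forces.\<close>

lemma decomposition_structure:
  obtains h1 h2 k v0 v1 v2 s2 s3 \<kappa> \<tau> b0 and \<theta> \<xi> \<eta> :: "'a \<Rightarrow> real" where
    "br h1 h2 = v0 + s2 *\<^sub>R h2 + s3 *\<^sub>R k" "span {v0, v1, v2} = V"
    "k \<in> H" "h1 \<in> H" "h2 \<in> H" "v0 \<in> V" "v1 \<in> V" "v2 \<in> V" "k \<noteq> 0" "v0 \<noteq> 0"
    "span {h1, h2, k} = H"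
    "br k h1 = \<kappa> *\<^sub>R h2 + \<tau> *\<^sub>R k" "br k h2 = 0"
    "br v1 v2 = k + b0 *\<^sub>R v0"
    "\<And>v. v \<in> V \<Longrightarrow> br v k = 0" "\<And>v. v \<in> V \<Longrightarrow> br v v0 = 0"
    "\<And>v. v \<in> V \<Longrightarrow> br v h2 = \<theta> v *\<^sub>R k"
    "\<And>v. v \<in> V \<Longrightarrow> br v h1 = \<xi> v *\<^sub>R h2 + \<eta> v *\<^sub>R k"
    "\<kappa> = 0 \<Longrightarrow> \<tau> = 0 \<and> s2 = 0 \<and> \<xi> v0 = 0"
proof -
  obtain v1 v2 where v12: "v1 \<in> V" "v2 \<in> V" "br v1 v2 \<notin> V"
    by (rule not_closed_V)
  obtain k b where kb: "k \<in> H" "b \<in> V" "br v1 v2 = k + b"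
    by (rule H_V_decompose)
  have k0: "k \<noteq> 0"
    using kb v12 by auto
  have kK: "k \<in> K"
    using H_part_in_K v12 kb by blast
  have brk: "br v k = 0" "br k v = 0" if "v \<in> V" for v
    using V_centralizes_K[OF that kK] br_swap_0 by auto
  have kH: "br k h \<in> H" if "h \<in> H" for h
    using kK that by (auto simp: K_def)
  have K_k: "\<exists>c. x = c *\<^sub>R k" if "x \<in> K" for x
    using K_line[OF kK k0 that] by metis
  obtain g1 g2 where g: "g1 \<in> H" "g2 \<in> H" "br g1 g2 \<notin> H"
    by (rule not_closed_H)
  have "g1 \<in> H - K"
    using g by (auto simp: K_def)
  \<comment> \<open>\<open>k\<close> joins \<open>V\<close> as an operator, since it preserves
    \<open>H\<close> by the definition of \<open>K\<close>; this controls \<open>br k h2\<close> as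
    well.\<close>
  then obtain h2 where h2: "h2 \<in> H - K" "\<And>m. m \<in> insert k V \<Longrightarrow> br m h2 \<in> K"
    by (rule engel_vector[of _ _ _ "insert k V"])
      (use subspace_0[OF subspace_K] br_V_H kH in auto)
  then obtain h1 where h1: "h1 \<in> H" "br h2 h1 \<notin> H"
    by (auto simp: K_def)
  have h12: "br h1 h2 \<notin> H"
    using h1(2) br_anti[of h2 h1] H_closed(3)[of "br h1 h2"] by auto
  have h2H: "h2 \<in> H"
    using h2(1) by simp
  have spanH: "span {h1, h2, k} = H"
    by (rule span_H[OF h1(1) h2H h12 kK k0])
  have indH: "a = 0 \<and> b = 0 \<and> c = 0" if "a *\<^sub>R h1 + b *\<^sub>R h2 + c *\<^sub>R k = 0" for a b c
    using independent_H[OF h1(1) h2H h12 kK k0 that] .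
  have comb: "\<exists>a b c. x = a *\<^sub>R h1 + b *\<^sub>R h2 + c *\<^sub>R k" if "x \<in> H" for x
    using that spanH by (metis in_span_3)
  have N: "subspace (span {h2, k})"
    by simp
  have h1N: "h1 \<notin> span {h2, k}"
  proof
    assume "h1 \<in> span {h2, k}"
    then obtain b c where "h1 = b *\<^sub>R h2 + c *\<^sub>R k"
      by (auto simp: in_span_2)
    then show False
      using indH[of 1 "- b" "- c"] by simp
  qed
  \<comment> \<open>Read from the other side, \<open>k\<close> is an eigenvector of
    \<open>ad h2\<close>.\<close>
  have kh2: "br k h2 = 0"
  proof -
    obtain \<mu> where \<mu>: "br k h2 = \<mu> *\<^sub>R k"
      using h2(2)[of k] K_k by auto
    then have "br h2 k = (- \<mu>) *\<^sub>R k"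
      by (subst br_anti) simp
    then show ?thesis
      using eigenvalue k0 \<mu> by fastforce
  qed
  have "\<exists>l. br v h2 = l *\<^sub>R k" if "v \<in> V" for v
    using h2(2)[of v] K_k that by auto
  then obtain \<theta> where \<theta>: "\<And>v. v \<in> V \<Longrightarrow> br v h2 = \<theta> v *\<^sub>R k"
    by metis
  \<comment> \<open>\<open>h1\<close> is an eigenvector of \<open>ad m\<close> modulo the invariant
    subspace \<open>span {h2, k}\<close>, so the coefficient \<open>z\<close> at \<open>h1\<close>
    vanishes.\<close>
  have "\<exists>x y. br m h1 = x *\<^sub>R h2 + y *\<^sub>R k" if m: "m \<in> insert k V" for m
  proof -
    have "br m h1 \<in> H"
      using m br_V_H kH h1(1) by auto
    then obtain z x y where z: "br m h1 = z *\<^sub>R h1 + x *\<^sub>R h2 + y *\<^sub>R k"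
      using comb by blast
    have "br m n \<in> span {h2, k}" if n: "n \<in> span {h2, k}" for n
    proof -
      obtain a b where "n = a *\<^sub>R h2 + b *\<^sub>R k"
        using n by (auto simp: in_span_2)
      moreover obtain c where "br m h2 = c *\<^sub>R k"
        using m kh2 \<theta> by (metis insertE scaleR_zero_left)
      moreover have "br m k = 0"
        using m brk by auto
      ultimately have "br m n = 0 *\<^sub>R h2 + (a * c) *\<^sub>R k"
        by simp
      then show ?thesis
        using in_span_2 by blast
    qed
    moreover have "br m h1 - z *\<^sub>R h1 \<in> span {h2, k}"
      by (auto simp: z in_span_2 algebra_simps)
    ultimately have "z = 0"
      using eigenvalue_mod[OF N _ _ h1N] by blast
    then show ?thesis
      using z by auto
  qed
  then obtain \<xi> \<eta> where \<xi>\<eta>: "\<And>m. m \<in> insert k V \<Longrightarrow> br m h1 = \<xi> m *\<^sub>R h2 + \<eta> m *\<^sub>R k"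
    by metis
  define \<kappa> \<tau> where "\<kappa> = \<xi> k" and "\<tau> = \<eta> k"
  have kh1: "br k h1 = \<kappa> *\<^sub>R h2 + \<tau> *\<^sub>R k"
    using \<xi>\<eta>[of k] by (simp add: \<kappa>_def \<tau>_def)
  \<comment> \<open>Jacobi for \<open>v\<close>, \<open>k\<close>, \<open>h1\<close>. Thus
    \<open>\<kappa> = 0\<close> or \<open>\<theta>\<close> vanishes on \<open>V\<close>, a dichotomy
    that settles the mixed terms below.\<close>
  have \<kappa>\<theta>: "\<kappa> * \<theta> v = 0" if "v \<in> V" for v
  proof -
    have "br (br v k) h1 = br v (br k h1) - br k (br v h1)"
      by (rule br_br_left)
    then have "(\<kappa> * \<theta> v) *\<^sub>R k = 0"
      using that by (simp add: brk kh1 \<xi>\<eta> kh2 \<theta>)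
    then show ?thesis
      using k0 by simp
  qed
  have \<tau>0: "\<tau> = 0" if "\<kappa> = 0"
  proof -
    have "br h1 k = (- \<tau>) *\<^sub>R k"
      using that by (subst br_anti) (simp add: kh1)
    then show ?thesis
      using eigenvalue[of h1 k "- \<tau>"] k0 by simp
  qed
  obtain w v0 where w: "w \<in> H" "v0 \<in> V" "br h1 h2 = w + v0"
    by (rule H_V_decompose)
  have v00: "v0 \<noteq> 0"
    using w h12 by auto
  obtain s1 s2 s3 where s: "w = s1 *\<^sub>R h1 + s2 *\<^sub>R h2 + s3 *\<^sub>R k"
    using comb w(1) by blast
  define u where "u = br h1 h2"
  have uk: "u \<notin> span {k}"
  proof
    assume "u \<in> span {k}"
    then have "u \<in> H"
      using kb(1) H_closed by (auto simp: span_singleton)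
    then show False
      using h12 u_def by simp
  qed
  have u: "u = s1 *\<^sub>R h1 + s2 *\<^sub>R h2 + s3 *\<^sub>R k + v0"
    using w(3) s by (simp add: u_def)
  have h21: "br h2 h1 = - u"
    using br_anti[of h2 h1] by (simp add: u_def)
  have h2k: "br h2 k = 0"
    using kh2 by (rule br_swap_0)
  have h1k: "br h1 k = - \<kappa> *\<^sub>R h2 - \<tau> *\<^sub>R k"
    using br_anti[of h1 k] by (simp add: kh1)
  have s1: "s1 = 0"
  proof -
    have "br h2 v0 = - \<theta> v0 *\<^sub>R k"
      using br_anti[of h2 v0] \<theta> w(2) by simp
    then have "br h2 u - (- s1) *\<^sub>R u = - \<theta> v0 *\<^sub>R k"
      by (simp add: u[THEN arg_cong, of "br h2"] h2k h21)
    then have "br h2 u - (- s1) *\<^sub>R u \<in> span {k}"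
      by (simp add: span_base span_scale span_neg)
    moreover have "br h2 n \<in> span {k}" if "n \<in> span {k}" for n
      using that by (auto simp: span_singleton h2k)
    ultimately have "- s1 = 0"
      by (intro eigenvalue_mod[of "span {k}" h2 u "- s1"] uk) auto
    then show ?thesis
      by simp
  qed
  \<comment> \<open>Jacobi for \<open>v\<close>, \<open>h1\<close>, \<open>h2\<close> leaves
    \<open>\<theta> v\<close> times \<open>br h1 k\<close>, which is zero on either side of the
    dichotomy.\<close>
  have vu: "br v u = 0" if "v \<in> V" for v
  proof -
    have "br (br v h1) h2 = br v u - br h1 (br v h2)"
        unfolding u_def by (rule br_br_left)
    then have "br v u + ((\<kappa> * \<theta> v) *\<^sub>R h2 + (\<tau> * \<theta> v) *\<^sub>R k) = 0"
      using that by (simp add: \<xi>\<eta> \<theta> kh2 h1k algebra_simps)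
    then show ?thesis
      using \<kappa>\<theta>[OF that] \<tau>0 by (cases "\<kappa> = 0") auto
  qed
  have h1v0: "br h1 v0 = - \<xi> v0 *\<^sub>R h2 - \<eta> v0 *\<^sub>R k"
    using br_anti[of h1 v0] \<xi>\<eta> w(2) by simp
  \<comment> \<open>When \<open>ad h1\<close> kills \<open>k\<close>, it acts on the plane of
    \<open>h2\<close> and \<open>u\<close> modulo \<open>k\<close> as the companion matrix with
    trace \<open>s2\<close> and determinant \<open>\<xi> v0\<close>. The determinant goes first;
    then \<open>u\<close> is an eigenvector for \<open>s2\<close>.\<close>
  have \<kappa>0: "s2 = 0 \<and> \<xi> v0 = 0" if "\<kappa> = 0"
  proof -
    have hk: "br h1 k = 0"
      using h1k that \<tau>0 by simp
    have eq: "br h1 u = s2 *\<^sub>R u - \<xi> v0 *\<^sub>R h2 - \<eta> v0 *\<^sub>R k"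
      by (simp add: u[THEN arg_cong, of "br h1"] s1 hk h1v0 u_def[symmetric])
    have stable: "br h1 n \<in> span {k}" if "n \<in> span {k}" for n
      using that by (auto simp: span_singleton hk)
    have "h2 \<notin> span {k}"
    proof
      assume "h2 \<in> span {k}"
      then obtain c where "h2 = c *\<^sub>R k"
        by (auto simp: span_singleton)
      then show False
        using indH[of 0 1 "- c"] by simp
    qed
    moreover have "br h1 u + \<xi> v0 *\<^sub>R h2 - s2 *\<^sub>R u \<in> span {k}"
      by (simp add: eq span_base span_scale span_neg)
    ultimately have x: "\<xi> v0 = 0"
      using stable by (intro companion_det_mod[of "span {k}" h1 u _ h2 s2]) (auto simp: u_def)
    then have "br h1 u - s2 *\<^sub>R u \<in> span {k}"
      by (simp add: eq span_base span_scale span_neg)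
    then have "s2 = 0"
      using stable uk by (intro eigenvalue_mod[of "span {k}" h1 u s2]) auto
    then show ?thesis
      using x by simp
  qed
  have vv0: "br v v0 = 0" if "v \<in> V" for v
  proof -
    have "br v u = br v (s2 *\<^sub>R h2 + s3 *\<^sub>R k + v0)"
      by (subst u) (simp add: s1)
    then have "br v v0 = - (s2 * \<theta> v) *\<^sub>R k"
      using that by (simp add: vu \<theta> brk add_eq_0_iff2)
    then show ?thesis
      using \<kappa>\<theta>[OF that] \<kappa>0 by (cases "\<kappa> = 0") auto
  qed
  have dimV: "dim V = 3"
  proof -
    have "dim {x + y |x y. x \<in> H \<and> y \<in> V} + dim (H \<inter> V) = dim H + dim V"
      by (rule dim_sums_Int[OF subspace_H subspace_V])
    moreover have "{x + y |x y. x \<in> H \<and> y \<in> V} = UNIV" "H \<inter> V = {0}"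
      using decomposition
      by (simp_all add: open_respectful_decomposition_def respectful_decomposition_def)
    ultimately show ?thesis
      using dim_H dim_6 by simp
  qed
  have indV: "a = 0 \<and> b = 0 \<and> c = 0" if z: "a *\<^sub>R v0 + b *\<^sub>R v1 + c *\<^sub>R v2 = 0" for a b c
  proof -
    have nz: "br v1 v2 \<noteq> 0"
      using v12(3) V_closed(4) by metis
    have "br v1 (a *\<^sub>R v0 + b *\<^sub>R v1 + c *\<^sub>R v2) = 0"
      by (simp only: z br_linear)
    then have c: "c = 0"
      using nz v12 vv0 by simp
    have "br v2 (a *\<^sub>R v0 + b *\<^sub>R v1 + c *\<^sub>R v2) = 0"
      by (simp only: z br_linear)
    then have "b = 0"
      using nz v12 vv0 c br_anti[of v2 v1] by simp
    then show ?thesis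
      using z c v00 by simp
  qed
  have spanV: "span {v0, v1, v2} = V"
    by (rule dim_3_combination[OF subspace_V dimV w(2) v12(1,2) indV])
  obtain b0 b1 b2 where b: "b = b0 *\<^sub>R v0 + b1 *\<^sub>R v1 + b2 *\<^sub>R v2"
    using kb(2) spanV by (metis in_span_3)
  have v1v2: "br v1 v2 = k + b0 *\<^sub>R v0 + b1 *\<^sub>R v1 + b2 *\<^sub>R v2"
    by (simp add: kb(3) b)
  have notin: "x \<notin> span {v0, k, y}"
    if "x \<in> V" "y \<in> V" "\<And>a c. a *\<^sub>R v0 + c *\<^sub>R y \<noteq> x" for x y
  proof
    assume "x \<in> span {v0, k, y}"
    then obtain a b c where x: "x = a *\<^sub>R v0 + b *\<^sub>R k + c *\<^sub>R y"
      by (auto simp: in_span_3)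
    have "b *\<^sub>R k = x - a *\<^sub>R v0 - c *\<^sub>R y"
      by (simp add: x)
    then have "b *\<^sub>R k \<in> V"
      using that w(2) V_closed by simp
    then have "b *\<^sub>R k = 0"
      by (rule H_V_disjoint[OF H_closed(5)[OF kb(1)]])
    then show False
      using that(3)[of a c] x by simp
  qed
  have stable: "br x n \<in> span {v0, k, x}" if x: "x \<in> V" and n: "n \<in> span {v0, k, x}" for x n
  proof -
    obtain a b c where "n = a *\<^sub>R v0 + b *\<^sub>R k + c *\<^sub>R x"
      using n by (auto simp: in_span_3)
    then show ?thesis
      using x by (simp add: vv0 brk span_zero)
  qed
  \<comment> \<open>\<open>v2\<close> is an eigenvector of \<open>ad v1\<close> modulo
    \<open>span {v0, k, v1}\<close>. Exchanging \<open>v1\<close> and \<open>v2\<close> reverses the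
    sign of the bracket, hence \<open>- b1\<close> in the next step.\<close>
  have b2: "b2 = 0"
  proof (rule eigenvalue_mod[of "span {v0, k, v1}" v1 v2])
    have "br v1 v2 - b2 *\<^sub>R v2 = b0 *\<^sub>R v0 + 1 *\<^sub>R k + b1 *\<^sub>R v1"
      by (simp add: v1v2)
    then show "br v1 v2 - b2 *\<^sub>R v2 \<in> span {v0, k, v1}"
      using in_span_3 by blast
    show "v2 \<notin> span {v0, k, v1}"
    proof (rule notin)
      show "a *\<^sub>R v0 + c *\<^sub>R v1 \<noteq> v2" for a c
        using indV[of a c "- 1"] by auto
    qed (use v12 in auto)
    show "br v1 n \<in> span {v0, k, v1}" if "n \<in> span {v0, k, v1}" for n
      using stable v12 that by blast
  qed auto
  have b1: "- b1 = 0"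
  proof (rule eigenvalue_mod[of "span {v0, k, v2}" v2 v1])
    have "br v2 v1 - (- b1) *\<^sub>R v1 = (- b0) *\<^sub>R v0 + (- 1) *\<^sub>R k + 0 *\<^sub>R v2"
      using br_anti[of v2 v1] by (simp add: v1v2 b2)
    then show "br v2 v1 - (- b1) *\<^sub>R v1 \<in> span {v0, k, v2}"
      using in_span_3 by blast
    show "v1 \<notin> span {v0, k, v2}"
    proof (rule notin)
      show "a *\<^sub>R v0 + c *\<^sub>R v2 \<noteq> v1" for a c
        using indV[of a "- 1" c] by auto
    qed (use v12 in auto)
    show "br v2 n \<in> span {v0, k, v2}" if "n \<in> span {v0, k, v2}" for n
      using stable v12 that by blast
  qed auto
  show ?thesis
  proof (rule that[OF _ spanV kb(1) h1(1) h2H w(2) v12(1,2) k0 v00 spanH kh1 kh2 _ brk(1) vv0 \<theta>])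
    show "br h1 h2 = v0 + s2 *\<^sub>R h2 + s3 *\<^sub>R k"
      using u s1 by (simp add: u_def)
    show "br v1 v2 = k + b0 *\<^sub>R v0"
      using v1v2 b1 b2 by simp
    show "br v h1 = \<xi> v *\<^sub>R h2 + \<eta> v *\<^sub>R k" if "v \<in> V" for v
      using \<xi>\<eta> that by blast
    show "\<kappa> = 0 \<Longrightarrow> \<tau> = 0 \<and> s2 = 0 \<and> \<xi> v0 = 0"
      using \<tau>0 \<kappa>0 by blast
  qed
qed

end

lemma dim_span_3_le: "dim (span {x, y, z :: 'a::euclidean_space}) \<le> 3"
  by (simp add: dim_insert)

lemma dim_span_2_le: "dim (span {x, y :: 'a::euclidean_space}) \<le> 2"
  by (simp add: dim_insert)

section \<open>From the triangular form to the four conditions\<close>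

context open_decomposition
begin

text \<open>Used twice: for the bound in condition (3), and to force dimension at most two when
  \<open>\<xi>\<close> vanishes on \<open>V\<close>.\<close>

lemma derived_algebra_subset:
  assumes S: "subspace S" and H: "span {h1, h2, k} = H" and V: "span {v0, v1, v2} = V"
    and HH: "br h1 h2 \<in> S" "br k h1 \<in> S" "br k h2 = 0"
    and VH: "\<And>v. v \<in> {v0, v1, v2} \<Longrightarrow> br v h1 \<in> S \<and> br v h2 \<in> S \<and> br v k = 0"
    and VV: "br v1 v2 \<in> S" "br v1 v0 = 0" "br v2 v0 = 0"
  shows "derived_algebra br \<subseteq> S"
  unfolding derived_algebra_def
proof (rule bracket_span_least[OF S])
  note closed = subspace_add[OF S] subspace_diff[OF S] subspace_neg[OF S] subspace_0[OF S]
    subspace_scale[OF S]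
  have anti: "br y x \<in> S" if "br x y \<in> S" for x y
    using that by (subst br_anti) (rule closed(3))
  note facts = HH anti[OF HH(1)] anti[OF HH(2)] br_swap_0[OF HH(3)] VV anti[OF VV(1)]
    br_swap_0[OF VV(2)] br_swap_0[OF VV(3)]
  have VH': "br v0 h1 \<in> S" "br v0 h2 \<in> S" "br v0 k = 0" "br v1 h1 \<in> S" "br v1 h2 \<in> S"
    "br v1 k = 0" "br v2 h1 \<in> S" "br v2 h2 \<in> S" "br v2 k = 0"
    using VH by auto
  fix x y :: 'a
  obtain h v where x: "h \<in> H" "v \<in> V" "x = h + v"
    by (rule H_V_decompose)
  obtain h' v' where y: "h' \<in> H" "v' \<in> V" "y = h' + v'"
    by (rule H_V_decompose)
  have HHS: "br h h' \<in> S" if "h \<in> H" "h' \<in> H" for h h'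
    using that unfolding H[symmetric] in_span_3 by (auto intro!: closed simp: facts)
  have VHS: "br v h \<in> S" if "v \<in> V" "h \<in> H" for v h
    using that unfolding H[symmetric] V[symmetric] in_span_3 by (auto intro!: closed simp: VH')
  have VVS: "br v v' \<in> S" if "v \<in> V" "v' \<in> V" for v v'
    using that unfolding V[symmetric] in_span_3 by (auto intro!: closed simp: facts)
  have "br x y = br h h' + br h v' + (br v h' + br v v')"
    by (simp add: x(3) y(3) add_ac)
  also have "\<dots> \<in> S"
    using x y HHS VHS VVS anti closed(1) by metis
  finally show "br x y \<in> S" .
qed

lemma four_conditions: "four_conditions br"
proof -
  obtain h1 h2 k v0 v1 v2 s2 s3 \<kappa> \<tau> b0 and \<theta> \<xi> \<eta> :: "'a \<Rightarrow> real" where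
    h1h2: "br h1 h2 = v0 + s2 *\<^sub>R h2 + s3 *\<^sub>R k" and V: "span {v0, v1, v2} = V"
    and mem: "k \<in> H" "h1 \<in> H" "h2 \<in> H" "v0 \<in> V" "v1 \<in> V" "v2 \<in> V" and nz: "k \<noteq> 0" "v0 \<noteq> 0"
    and H: "span {h1, h2, k} = H"
    and kh1: "br k h1 = \<kappa> *\<^sub>R h2 + \<tau> *\<^sub>R k" and kh2: "br k h2 = 0"
    and v1v2: "br v1 v2 = k + b0 *\<^sub>R v0"
    and Vk: "\<And>v. v \<in> V \<Longrightarrow> br v k = 0" and Vv0: "\<And>v. v \<in> V \<Longrightarrow> br v v0 = 0"
    and Vh2: "\<And>v. v \<in> V \<Longrightarrow> br v h2 = \<theta> v *\<^sub>R k"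
    and Vh1: "\<And>v. v \<in> V \<Longrightarrow> br v h1 = \<xi> v *\<^sub>R h2 + \<eta> v *\<^sub>R k"
    and \<kappa>0: "\<kappa> = 0 \<Longrightarrow> \<tau> = 0 \<and> s2 = 0 \<and> \<xi> v0 = 0"
    by (rule decomposition_structure) (rule that)
  \<comment> \<open>This space contains the derived algebra and the center at the same time, which
    gives condition (3).\<close>
  define D where "D = span {v0, h2, k}"
  have sD: "subspace D" and D: "v0 \<in> D" "h2 \<in> D" "k \<in> D"
    by (auto simp: D_def span_base)
  note closedD = subspace_add[OF sD] subspace_diff[OF sD] subspace_neg[OF sD] subspace_0[OF sD]
    subspace_scale[OF sD]
  have der: "derived_algebra br \<subseteq> D"
    by (rule derived_algebra_subset[OF sD H V])
      (auto simp: h1h2 kh1 kh2 Vk Vv0 Vh1 Vh2 v1v2 mem D intro!: closedD)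
  have no_V: "c = 0" if "x + c *\<^sub>R v0 = 0" "x \<in> H" for c x
  proof -
    have "c *\<^sub>R v0 = 0"
      using V_part_zero[of x "c *\<^sub>R v0"] that mem H_closed(4) V_closed by simp
    then show ?thesis
      using nz by simp
  qed
  \<comment> \<open>Bracketing a central \<open>z\<close> with \<open>h2\<close>, \<open>h1\<close>,
    \<open>v1\<close>, \<open>v2\<close> removes its coefficients at \<open>h1\<close>,
    \<open>h2\<close>, \<open>v2\<close>, \<open>v1\<close>; the first two are read off at
    \<open>v0\<close>.\<close>
  have center: "lie_center br \<subseteq> span {k, v0}"
  proof
    fix z assume z: "z \<in> lie_center br"
    obtain h v where hv: "h \<in> H" "v \<in> V" "z = h + v"
      by (rule H_V_decompose)
    obtain a b c where h: "h = a *\<^sub>R h1 + b *\<^sub>R h2 + c *\<^sub>R k"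
      using hv(1) unfolding H[symmetric] in_span_3 by blast
    obtain d0 d1 d2 where v: "v = d0 *\<^sub>R v0 + d1 *\<^sub>R v1 + d2 *\<^sub>R v2"
      using hv(2) unfolding V[symmetric] in_span_3 by blast
    have "br z h2 = 0"
      by (rule lie_center_br(1)[OF z])
    then have "((a * s2) *\<^sub>R h2 + (a * s3 + \<theta> v) *\<^sub>R k) + a *\<^sub>R v0 = 0"
      using hv(2) by (simp add: hv(3) h h1h2 kh2 Vh2 algebra_simps)
    then have a: "a = 0"
      by (rule no_V) (simp add: mem H_closed)
    have "br z h1 = 0"
      by (rule lie_center_br(1)[OF z])
    then have "((\<xi> v + c * \<kappa> - b * s2) *\<^sub>R h2 + (\<eta> v + c * \<tau> - b * s3) *\<^sub>R k) + (- b) *\<^sub>R v0 = 0"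
      using hv(2) br_anti[of h2 h1] by (simp add: hv(3) h h1h2 kh1 Vh1 a algebra_simps)
    then have b: "- b = 0"
      by (rule no_V) (simp add: mem H_closed)
    have kv: "br k v = 0" if "v \<in> V" for v
      using Vk[OF that] by (rule br_swap_0)
    have nz': "br v1 v2 \<noteq> 0" "br v2 v1 \<noteq> 0"
    proof -
      show "br v1 v2 \<noteq> 0"
      proof
        assume "br v1 v2 = 0"
        then have "k = (- b0) *\<^sub>R v0"
          by (simp add: v1v2 add_eq_0_iff2)
        then have "k \<in> V"
          using mem(4) V_closed by simp
        then show False
          using H_V_disjoint mem nz by blast
      qed
      then show "br v2 v1 \<noteq> 0"
        using br_swap_0 by blast
    qed
    have v0v: "br v0 v = 0" if "v \<in> V" for v
      using Vv0[OF that] by (rule br_swap_0)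
    have "br z v1 = 0" "br z v2 = 0"
      by (rule lie_center_br(1)[OF z])+
    then have "d2 = 0" "d1 = 0"
      using nz' b by (auto simp: hv(3) h v a kv v0v mem)
    then have "z = c *\<^sub>R k + d0 *\<^sub>R v0"
      using b by (simp add: hv(3) h v a)
    then show "z \<in> span {k, v0}"
      by (auto simp: in_span_2)
  qed
  have centerD: "lie_center br \<subseteq> D"
    using center span_mono[of "{k, v0}" "{v0, h2, k}"] by (auto simp: D_def)
  \<comment> \<open>A nonzero \<open>\<kappa>\<close> gives \<open>br h1 (br h1 k)\<close> a
    \<open>v0\<close>-component. If \<open>\<kappa> = 0\<close>, then \<open>k\<close> is central,
    so \<open>v0\<close> is not, and for some \<open>v\<close> two applications of
    \<open>ad h1\<close> carry \<open>br v h1\<close> through \<open>v0\<close> to a nonzero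
    multiple of \<open>k\<close>.\<close>
  have deep: "bracket_span br UNIV (bracket_span br UNIV (derived_algebra br)) \<noteq> {0}"
    if Z1: "dim (lie_center br) = 1" and d3: "dim (derived_algebra br) = 3"
  proof
    assume triv: "bracket_span br UNIV (bracket_span br UNIV (derived_algebra br)) = {0}"
    have zero: "br x (br y d) = 0" if "d \<in> derived_algebra br" for x y d
      using triv bracket_spanI[of x UNIV "br y d" "bracket_span br UNIV (derived_algebra br)" br]
        bracket_spanI[of y UNIV d "derived_algebra br" br] that by auto
    have "derived_algebra br = D"
      by (rule subspace_dim_equal[OF _ sD der])
        (use d3 dim_span_3_le[of v0 h2 k] in \<open>auto simp: D_def\<close>)
    then have "br h1 (br k h1) = 0"
      using zero[of k h1 h1] D br_anti[of k h1] by simp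
    then have "((\<kappa> * s2) *\<^sub>R h2 + (\<kappa> * s3) *\<^sub>R k - \<tau> *\<^sub>R br k h1) + \<kappa> *\<^sub>R v0 = 0"
      using br_anti[of h1 k] by (simp add: kh1[THEN arg_cong, of "br h1"] h1h2 algebra_simps)
    then have k0: "\<kappa> = 0"
      by (rule no_V) (simp add: mem H_closed kh1)
    then have \<tau>: "\<tau> = 0" and s2: "s2 = 0" and \<xi>0: "\<xi> v0 = 0"
      using \<kappa>0 by auto
    have kZ: "k \<in> lie_center br"
    proof -
      have "br k x = 0" for x
      proof -
        obtain h v where x: "h \<in> H" "v \<in> V" "x = h + v"
          by (rule H_V_decompose)
        have "br k h = 0"
          using x(1) unfolding H[symmetric] in_span_3 by (auto simp: kh1 kh2 k0 \<tau>)
        then show ?thesis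
          using Vk[OF x(2), THEN br_swap_0] by (simp add: x(3))
      qed
      then show ?thesis
        by (simp add: lie_center_def)
    qed
    have v0Z: "v0 \<notin> lie_center br"
    proof
      assume "v0 \<in> lie_center br"
      then have "dim {k, v0} \<le> dim (lie_center br)"
        using kZ by (intro dim_subset) auto
      moreover have "k \<notin> span {v0}"
        using H_V_disjoint mem nz V_closed(5) by (auto simp: span_singleton)
      ultimately show False
        using Z1 nz by (simp add: dim_insert)
    qed
    have "\<exists>v\<in>V. \<xi> v \<noteq> 0"
    proof (rule ccontr)
      assume *: "\<not> (\<exists>v\<in>V. \<xi> v \<noteq> 0)"
      have "v0 \<in> span {v0, k}" "k \<in> span {v0, k}"
        by (auto intro: span_base)
      then have "derived_algebra br \<subseteq> span {v0, k}"
        using * by (intro derived_algebra_subset[OF _ H V])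
          (auto simp: h1h2 kh1 kh2 Vk Vv0 Vh1 Vh2 v1v2 mem s2 \<tau> k0 intro!: span_add span_scale span_zero)
      then have "dim (derived_algebra br) \<le> 2"
        using dim_subset dim_span_2_le order_trans by blast
      then show False
        using d3 by simp
    qed
    then obtain v where v: "v \<in> V" "\<xi> v \<noteq> 0"
      by blast
    have v0v: "br v0 v' = 0" if "v' \<in> V" for v'
      using Vv0[OF that] by (rule br_swap_0)
    have "br (br v0 v) h1 = br v0 (br v h1) - br v (br v0 h1)"
      by (rule br_br_left)
    then have \<theta>0: "\<theta> v0 = 0"
      using v nz by (simp add: v0v Vh1 mem \<xi>0 Vk Vh2)
    have \<eta>0: "\<eta> v0 \<noteq> 0"
    proof
      assume "\<eta> v0 = 0"
      have "br v0 x = 0" for x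
      proof -
        obtain h v where x: "h \<in> H" "v \<in> V" "x = h + v"
          by (rule H_V_decompose)
        have "br v0 h = 0"
          using x(1) unfolding H[symmetric] in_span_3
          by (auto simp: Vh1 Vh2 Vk mem \<theta>0 \<xi>0 \<open>\<eta> v0 = 0\<close>)
        then show ?thesis
          by (simp add: x(3) v0v x(2))
      qed
      then show False
        using v0Z by (simp add: lie_center_def)
    qed
    have h1k: "br h1 k = 0"
      using lie_center_br(2)[OF kZ] .
    have h1v0: "br h1 v0 = - \<eta> v0 *\<^sub>R k"
      using br_anti[of h1 v0] by (simp add: Vh1 mem \<xi>0)
    have "br h1 (br h1 (br v h1)) = - (\<xi> v * \<eta> v0) *\<^sub>R k"
      using v(1) by (simp add: Vh1 h1k h1h2 s2 h1v0)
    moreover have "br h1 (br h1 (br v h1)) = 0"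
      by (rule zero) (rule derived_algebra_br)
    ultimately show False
      using v(2) \<eta>0 nz by simp
  qed
  have "{x + z |x z. x \<in> derived_algebra br \<and> z \<in> lie_center br} \<subseteq> D"
    using der centerD by (auto intro!: closedD(1))
  from dim_subset[OF this]
  have "dim {x + z |x z. x \<in> derived_algebra br \<and> z \<in> lie_center br} \<le> 3"
    using dim_span_3_le[of v0 h2 k] by (simp add: D_def)
  moreover have "dim (lie_center br) \<le> 2"
    using center dim_subset dim_span_2_le order_trans by blast
  moreover have "\<not> (\<exists>I. lie_ideal br I \<and> abelian_on br I \<and> dim I + 1 = dim (UNIV :: 'a set))"
    using codim_1_not_abelian dim_6 by (auto simp: lie_ideal_def)
  ultimately show ?thesis
    using deep by (simp add: four_conditions_def)
qed

end

subsection \<open>Coordinates on \<open>real^6\<close>\<close>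

lemma exhaust_6:
  fixes x :: 6
  shows "x = 1 \<or> x = 2 \<or> x = 3 \<or> x = 4 \<or> x = 5 \<or> x = 6"
proof (induct x)
  case (of_int z)
  then have "0 \<le> z" and "z < 6"
    by simp_all
  then have "z = 0 \<or> z = 1 \<or> z = 2 \<or> z = 3 \<or> z = 4 \<or> z = 5"
    by arith
  then show ?case
    by auto
qed

lemma forall_6: "(\<forall>i::6. P i) \<longleftrightarrow> P 1 \<and> P 2 \<and> P 3 \<and> P 4 \<and> P 5 \<and> P 6"
  by (metis exhaust_6)

definition vec6 :: "real \<Rightarrow> real \<Rightarrow> real \<Rightarrow> real \<Rightarrow> real \<Rightarrow> real \<Rightarrow> real^6" where
  "vec6 a b c d e f = (\<chi> i. if i = 1 then a else if i = 2 then b else if i = 3 then c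
     else if i = 4 then d else if i = 5 then e else f)"

lemma vec6_nth [simp]:
  "vec6 a b c d e f $ 1 = a" "vec6 a b c d e f $ 2 = b" "vec6 a b c d e f $ 3 = c"
  "vec6 a b c d e f $ 4 = d" "vec6 a b c d e f $ 5 = e" "vec6 a b c d e f $ 6 = f"
  by (simp_all add: vec6_def)

lemma vec6_eq_iff:
  "(x :: real^6) = y \<longleftrightarrow>
    x$1 = y$1 \<and> x$2 = y$2 \<and> x$3 = y$3 \<and> x$4 = y$4 \<and> x$5 = y$5 \<and> x$6 = y$6"
  by (simp add: vec_eq_iff forall_6)

definition coords :: "6 set \<Rightarrow> (real^6) set" where
  "coords J = {x. \<forall>i. i \<notin> J \<longrightarrow> x$i = 0}"

lemma dim_coords: "dim (coords J) = card J"
  using dim_substandard_cart[of J, where 'a = real] by (simp add: coords_def dim_vec_eq)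

lemma subspace_coords [simp]: "subspace (coords J)"
  by (auto simp: subspace_def coords_def)

definition wedge :: "6 \<Rightarrow> 6 \<Rightarrow> real^6 \<Rightarrow> real^6 \<Rightarrow> real" where
  "wedge i j x y = x$i * y$j - x$j * y$i"

subsection \<open>The fourteen algebras\<close>

text \<open>\<open>wedge i j\<close> is \<open>e\<^sup>i \<and> e\<^sup>j\<close>, so the components below are the structure equations, up to the sign
  convention \<open>de\<^sup>k(x, y) = - e\<^sup>k [x, y]\<close>.\<close>

definition alg_heis :: "real^6 \<Rightarrow> real^6 \<Rightarrow> real^6" where
  "alg_heis x y = vec6 0 0 0 0 0 (wedge 1 2 x y + wedge 3 4 x y)"

text \<open>The Heisenberg algebra over \<open>R[t]/(t^2 - D)\<close> as a real algebra, with
  \<open>e2 = t e1\<close>, \<open>e4 = t e3\<close>, \<open>e6 = t e5\<close>. So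
  \<open>D = -1\<close> is the complex Heisenberg algebra and \<open>D = 1\<close> the sum of two
  real ones.\<close>

definition alg_pencil :: "real \<Rightarrow> real^6 \<Rightarrow> real^6 \<Rightarrow> real^6" where
  "alg_pencil D x y = vec6 0 0 0 0 (wedge 1 3 x y + D * wedge 2 4 x y) (wedge 1 4 x y + wedge 2 3 x y)"

definition alg_12_15_34 :: "real^6 \<Rightarrow> real^6 \<Rightarrow> real^6" where
  "alg_12_15_34 x y = vec6 0 0 0 0 (wedge 1 2 x y) (wedge 1 5 x y + wedge 3 4 x y)"

definition alg_12_15_23 :: "real^6 \<Rightarrow> real^6 \<Rightarrow> real^6" where
  "alg_12_15_23 x y = vec6 0 0 0 0 (wedge 1 2 x y) (wedge 1 5 x y + wedge 2 3 x y)"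

text \<open>On the plane of \<open>e1\<close>, \<open>e2\<close> one has
  \<open>ad e3 = T (ad e4)\<close>, where \<open>T e5 = e6\<close> and \<open>T e6 = D e5\<close>,
  so again \<open>T^2 = D\<close>.\<close>

definition alg_twist :: "real \<Rightarrow> real^6 \<Rightarrow> real^6 \<Rightarrow> real^6" where
  "alg_twist D x y = vec6 0 0 0 (wedge 1 2 x y) (wedge 1 4 x y + D * wedge 2 3 x y) (wedge 1 3 x y + wedge 2 4 x y)"

definition alg_12_13_14_23 :: "real^6 \<Rightarrow> real^6 \<Rightarrow> real^6" where
  "alg_12_13_14_23 x y = vec6 0 0 0 (wedge 1 2 x y) (wedge 1 3 x y) (wedge 1 4 x y + wedge 2 3 x y)"

definition alg_12_23_14 :: "real^6 \<Rightarrow> real^6 \<Rightarrow> real^6" where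
  "alg_12_23_14 x y = vec6 0 0 0 (wedge 1 2 x y) (wedge 2 3 x y) (wedge 1 4 x y)"

definition alg_4step :: "real^6 \<Rightarrow> real^6 \<Rightarrow> real^6" where
  "alg_4step x y = vec6 0 0 0 (wedge 1 2 x y) (wedge 1 4 x y - wedge 2 3 x y) (wedge 1 5 x y + wedge 3 4 x y)"

definition alg_4step_split :: "real \<Rightarrow> real^6 \<Rightarrow> real^6 \<Rightarrow> real^6" where
  "alg_4step_split C x y = vec6 0 0 0 (wedge 1 2 x y) (wedge 1 4 x y) (wedge 1 5 x y + wedge 2 3 x y + C * wedge 2 4 x y)"

lemmas alg_defs = alg_heis_def alg_pencil_def alg_12_15_34_def alg_12_15_23_def alg_twist_def alg_12_13_14_23_def alg_12_23_14_def
  alg_4step_def alg_4step_split_def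

section \<open>Lie algebra axioms and nilpotency of the models\<close>

lemma lie_algebra_vec6I:
  fixes br :: "real^6 \<Rightarrow> real^6 \<Rightarrow> real^6"
  assumes "\<And>x x' y. br (x + x') y = br x y + br x' y" "\<And>c x y. br (c *\<^sub>R x) y = c *\<^sub>R br x y"
    "\<And>x y y'. br x (y + y') = br x y + br x y'" "\<And>c x y. br x (c *\<^sub>R y) = c *\<^sub>R br x y"
    "\<And>x. br x x = 0"
    "\<And>x y z. br x (br y z) + br y (br z x) + br z (br x y) = 0"
  shows "lie_algebra br"
proof
  show "bilinear br"
    using assms by (auto simp: bilinear_def intro!: linearI)
  show "br x x = 0" for x
    by (rule assms)
  show "br x (br y z) + br y (br z x) + br z (br x y) = 0" for x y z
    by (rule assms)
qed

text \<open>One coordinate flag serves all fourteen algebras; it contains the lower central series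
  without having to equal it.\<close>

lemma nilpotent_vec6I:
  fixes br :: "real^6 \<Rightarrow> real^6 \<Rightarrow> real^6"
  assumes "\<And>x y. br x y \<in> coords {4, 5, 6}"
    "\<And>x y. y \<in> coords {4, 5, 6} \<Longrightarrow> br x y \<in> coords {5, 6}"
    "\<And>x y. y \<in> coords {5, 6} \<Longrightarrow> br x y \<in> coords {6}"
    "\<And>x y. y \<in> coords {6} \<Longrightarrow> br x y = 0"
  shows "nilpotent_lie br"
proof -
  have "lower_central br 1 \<subseteq> coords {4, 5, 6}"
    using assms(1) by (auto intro: bracket_span_least[THEN subsetD, rotated 2])
  then have "lower_central br 2 \<subseteq> coords {5, 6}"
    using assms(2) unfolding numeral_2_eq_2 One_nat_def lower_central.simps(2)[of br "Suc 0"]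
    by (intro bracket_span_least) auto
  then have "lower_central br 3 \<subseteq> coords {6}"
    using assms(3) unfolding numeral_3_eq_3 numeral_2_eq_2 lower_central.simps(2)[of br "Suc (Suc 0)"]
    by (intro bracket_span_least) auto
  then have "lower_central br (Suc 3) \<subseteq> {0}"
    using assms(4) unfolding lower_central.simps(2)[of br 3]
    by (intro bracket_span_least) auto
  then have "lower_central br (Suc 3) = {0}"
    using subspace_0[OF subspace_lower_central] by blast
  then show ?thesis
    unfolding nilpotent_lie_def by blast
qed

lemma nilpotent_lie_algebra_6I:
  fixes br :: "real^6 \<Rightarrow> real^6 \<Rightarrow> real^6"
  assumes "lie_algebra br" "nilpotent_lie br"
  shows "nilpotent_lie_algebra_6 br"
  using assms by (simp add: nilpotent_lie_algebra_6_def)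

lemmas coord_simps = vec6_eq_iff wedge_def coords_def forall_6

lemma lie_algebra_models:
  "lie_algebra alg_heis" "lie_algebra (alg_pencil D)" "lie_algebra alg_12_15_34" "lie_algebra alg_12_15_23"
  "lie_algebra (alg_twist D)" "lie_algebra alg_12_13_14_23" "lie_algebra alg_12_23_14" "lie_algebra alg_4step"
  "lie_algebra (alg_4step_split C)"
  by (rule lie_algebra_vec6I; simp add: alg_defs coord_simps algebra_simps)+

lemma nilpotent_models:
  "nilpotent_lie alg_heis" "nilpotent_lie (alg_pencil D)" "nilpotent_lie alg_12_15_34" "nilpotent_lie alg_12_15_23"
  "nilpotent_lie (alg_twist D)" "nilpotent_lie alg_12_13_14_23" "nilpotent_lie alg_12_23_14" "nilpotent_lie alg_4step"
  "nilpotent_lie (alg_4step_split C)"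
  by (rule nilpotent_vec6I; simp add: alg_defs coord_simps)+

section \<open>Open respectful decompositions of the models\<close>

lemma open_respectful_decompositionI:
  assumes "subspace H" "subspace V" "H \<inter> V \<subseteq> {0}" "\<And>x. \<exists>h\<in>H. x - h \<in> V"
    "\<And>v h. v \<in> V \<Longrightarrow> h \<in> H \<Longrightarrow> br v h \<in> H"
    "h \<in> H" "h' \<in> H" "br h h' \<notin> H" "v \<in> V" "v' \<in> V" "br v v' \<notin> V"
  shows "open_respectful_decomposition br H V"
proof -
  have "x \<in> {h + v |h v. h \<in> H \<and> v \<in> V}" for x
  proof -
    obtain h where "h \<in> H" "x - h \<in> V"
      using assms(4) by blast
    moreover have "x = h + (x - h)"
      by simp
    ultimately show ?thesis
      by blast
  qed
  moreover have "\<not> bracket_span br H H \<subseteq> H" "\<not> bracket_span br V V \<subseteq> V"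
    using assms bracket_spanI by blast+
  moreover have "bracket_span br V H \<subseteq> H"
    by (rule bracket_span_least) (use assms in auto)
  ultimately show ?thesis
    using assms(1-3) subspace_0[OF assms(1)] subspace_0[OF assms(2)]
    unfolding open_respectful_decomposition_def respectful_decomposition_def lie_subalgebra_def
    by blast
qed

text \<open>\<open>V\<close> is spanned by \<open>e_p\<close>, \<open>e_q\<close> and the tilted
  vector \<open>e_m + a e_k\<close>. The tilt serves the models in which \<open>br e_p e_q\<close>
  is a multiple of \<open>e_m\<close>: for \<open>a = 0\<close> that bracket would stay in
  \<open>V\<close>.\<close>

lemma coordinate_decomposition:
  fixes br :: "real^6 \<Rightarrow> real^6 \<Rightarrow> real^6" and i j k m p q :: 6
  assumes "distinct [i, j, k, m, p, q]"
    and "\<And>v h. v$i = 0 \<Longrightarrow> v$j = 0 \<Longrightarrow> v$k = a * v$m \<Longrightarrow> h \<in> coords {i, j, k} \<Longrightarrow>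
      br v h \<in> coords {i, j, k}"
    and "br (axis i 1) (axis j 1) \<notin> coords {i, j, k}"
    and "br (axis p 1) (axis q 1) $ k \<noteq> a * br (axis p 1) (axis q 1) $ m"
  shows "\<exists>H V. open_respectful_decomposition br H V \<and> dim H = 3"
proof -
  note d = assms(1)[simplified]
  have "open_respectful_decomposition br (coords {i, j, k}) {x. x$i = 0 \<and> x$j = 0 \<and> x$k = a * x$m}"
  proof (rule open_respectful_decompositionI[where h = "axis i 1" and h' = "axis j 1" and
        v = "axis p 1" and v' = "axis q 1"])
    have "y \<in> {i, j, k, m, p, q}" for y :: 6
    proof -
      have "card {i, j, k, m, p, q} = CARD(6)"
        using d by simp
      then show ?thesis
        by (metis UNIV_I card_eq_UNIV_imp_eq_UNIV finite)
    qed
    then show "coords {i, j, k} \<inter> {x. x$i = 0 \<and> x$j = 0 \<and> x$k = a * x$m} \<subseteq> {0}"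
      using d by (auto simp: coords_def vec_eq_iff) (metis mult_zero_right)
    show "\<exists>h\<in>coords {i, j, k}. x - h \<in> {x. x$i = 0 \<and> x$j = 0 \<and> x$k = a * x$m}" for x
      by (rule bexI[of _ "axis i (x$i) + axis j (x$j) + axis k (x$k - a * x$m)"])
        (use d in \<open>auto simp: coords_def axis_def\<close>)
  qed (use assms(2-4) d in \<open>auto simp: coords_def axis_def subspace_def algebra_simps\<close>)
  moreover have "dim (coords {i, j, k}) = 3"
    using d by (simp add: dim_coords)
  ultimately show ?thesis
    by blast
qed

lemma decomposition_models:
  "\<exists>H V. open_respectful_decomposition alg_heis H V \<and> dim H = 3"
  "\<exists>H V. open_respectful_decomposition (alg_pencil D) H V \<and> dim H = 3"
  "\<exists>H V. open_respectful_decomposition alg_12_15_34 H V \<and> dim H = 3"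
  "\<exists>H V. open_respectful_decomposition alg_12_15_23 H V \<and> dim H = 3"
  "\<exists>H V. open_respectful_decomposition (alg_twist D) H V \<and> dim H = 3"
  "\<exists>H V. open_respectful_decomposition alg_12_13_14_23 H V \<and> dim H = 3"
  "\<exists>H V. open_respectful_decomposition alg_12_23_14 H V \<and> dim H = 3"
  "\<exists>H V. open_respectful_decomposition alg_4step H V \<and> dim H = 3"
  "\<exists>H V. open_respectful_decomposition (alg_4step_split C) H V \<and> dim H = 3"
  \<comment> \<open>The arguments are \<open>i j k m p q a\<close>. The tilt is \<open>-1\<close>
    where the bracket of \<open>e_p\<close> and \<open>e_q\<close> is along \<open>e_m\<close>, and
    \<open>0\<close> where it is along \<open>e_k\<close>.\<close>
  subgoal by (rule coordinate_decomposition[of 1 2 5 6 3 4 "-1"]; simp add: alg_defs coord_simps axis_def)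
  subgoal by (rule coordinate_decomposition[of 1 4 5 6 2 3 "-1"]; simp add: alg_defs coord_simps axis_def)
  subgoal by (rule coordinate_decomposition[of 1 2 6 5 3 4 0]; simp add: alg_defs coord_simps axis_def)
  subgoal by (rule coordinate_decomposition[of 1 5 4 6 2 3 "-1"]; simp add: alg_defs coord_simps axis_def)
  subgoal by (rule coordinate_decomposition[of 2 4 5 6 1 3 "-1"]; simp add: alg_defs coord_simps axis_def)
  subgoal by (rule coordinate_decomposition[of 1 4 5 6 2 3 "-1"]; simp add: alg_defs coord_simps axis_def)
  subgoal by (rule coordinate_decomposition[of 1 4 5 6 2 3 0]; simp add: alg_defs coord_simps axis_def)
  subgoal by (rule coordinate_decomposition[of 1 4 6 5 2 3 "-1"]; simp add: alg_defs coord_simps axis_def)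
  subgoal by (rule coordinate_decomposition[of 1 4 6 5 2 3 0]; simp add: alg_defs coord_simps axis_def)
  done

subsection \<open>Invariants separating the fourteen algebras\<close>

definition centralizer :: "('a::real_vector \<Rightarrow> 'a \<Rightarrow> 'a) \<Rightarrow> 'a set \<Rightarrow> 'a set" where
  "centralizer br S = {x. \<forall>y\<in>S. br x y = 0}"

text \<open>The case \<open>w = 0\<close> covers the center. The set need not be closed under
  addition, hence its span in \<open>lie_invariants\<close>.\<close>

definition rank_le_1 :: "('a::real_vector \<Rightarrow> 'a \<Rightarrow> 'a) \<Rightarrow> 'a set" where
  "rank_le_1 br = {x. \<exists>w. \<forall>u. br x u \<in> span {w}}"

definition lie_invariants :: "('a::real_vector \<Rightarrow> 'a \<Rightarrow> 'a) \<Rightarrow> nat \<times> nat \<times> nat \<times> nat" where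
  "lie_invariants br = (dim (derived_algebra br), dim (lie_center br),
     dim (span (rank_le_1 br)), dim (centralizer br (derived_algebra br)))"

context lie_isomorphism
begin

lemma image_centralizer: "f ` centralizer br S = centralizer br' (f ` S)"
  by (rule image_eqI) (simp add: centralizer_def hom[symmetric] eq_zero)

lemma image_rank_le_1: "f ` rank_le_1 br = rank_le_1 br'"
proof (rule image_eqI)
  have *: "f v \<in> span {f w} \<longleftrightarrow> v \<in> span {w}" for v w
    using bij_is_inj[OF bij] linear_cmul[OF linear]
    by (auto simp: span_singleton image_iff inj_eq simp flip: linear_cmul[OF linear])
  have ex: "(\<exists>w. P w) \<longleftrightarrow> (\<exists>w. P (f w))" for P
    using all_image[of "\<lambda>w. \<not> P w"] by blast
  show "f x \<in> rank_le_1 br' \<longleftrightarrow> x \<in> rank_le_1 br" for x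
    by (simp add: rank_le_1_def ex all_image[of "\<lambda>u. br' (f x) u \<in> span _"] * flip: hom)
qed

lemma lie_invariants_eq: "lie_invariants br = lie_invariants br'"
proof -
  have "f ` span (rank_le_1 br) = span (rank_le_1 br')"
    using image_rank_le_1 linear_span_image[OF linear] by metis
  then show ?thesis
    unfolding lie_invariants_def
    by (metis dim_image image_derived_algebra image_lie_center image_centralizer)
qed

end

lemma lie_isomorphic_invariants: "lie_isomorphic br br' \<Longrightarrow> lie_invariants br = lie_invariants br'"
  using lie_isomorphic_iff lie_isomorphism.lie_invariants_eq by blast

section \<open>Computing the invariants in coordinates\<close>

lemma coords_subset:
  assumes "subspace S" "\<And>j. j \<in> J \<Longrightarrow> axis j 1 \<in> S"
  shows "coords J \<subseteq> S"
proof
  fix x assume x: "x \<in> coords J"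
  have "x = (\<Sum>j\<in>UNIV. x$j *\<^sub>R axis j 1)"
    using basis_expansion[of x] by (simp add: scalar_mult_eq_scaleR)
  also have "\<dots> = (\<Sum>j\<in>J. x$j *\<^sub>R axis j 1)"
    using x by (intro sum.mono_neutral_right) (auto simp: coords_def)
  also have "\<dots> \<in> S"
    using assms by (intro subspace_sum subspace_scale)
  finally show "x \<in> S" .
qed

lemma derived_algebra_coords:
  assumes "\<And>x y. br x y \<in> coords J" "\<And>j. j \<in> J \<Longrightarrow> \<exists>x y. br x y = axis j 1"
  shows "derived_algebra br = coords J"
proof
  show "derived_algebra br \<subseteq> coords J"
    unfolding derived_algebra_def by (rule bracket_span_least) (use assms in auto)
  show "coords J \<subseteq> derived_algebra br"
  proof (rule coords_subset)
    show "axis j 1 \<in> derived_algebra br" if "j \<in> J" for j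
      using assms(2)[OF that] derived_algebra_br by metis
  qed simp
qed

lemma centralizer_coords:
  assumes "lie_algebra br"
  shows "centralizer br (coords J) = {x. \<forall>j\<in>J. br x (axis j 1) = 0}"
proof -
  interpret lie_algebra br
    by (rule assms)
  have "coords J \<subseteq> {y. br x y = 0}" if "\<And>j. j \<in> J \<Longrightarrow> br x (axis j 1) = 0" for x
    using that by (intro coords_subset) (auto simp: subspace_def)
  moreover have "axis j 1 \<in> coords J" if "j \<in> J" for j
    using that by (auto simp: coords_def axis_def)
  ultimately show ?thesis
    unfolding centralizer_def by blast
qed

lemma lie_center_coords:
  fixes br :: "real^6 \<Rightarrow> real^6 \<Rightarrow> real^6"
  assumes "lie_algebra br"
  shows "lie_center br = {x. \<forall>j. br x (axis j 1) = 0}"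
  using centralizer_coords[OF assms, of UNIV] by (simp add: centralizer_def lie_center_def coords_def)

text \<open>Two columns of the matrix of \<open>ad x\<close> are multiples of one vector, so its 2 x
  2 minors vanish. The upper bounds below pick minors that are squares or sums of squares.\<close>

lemma rank_le_1_minor:
  fixes br :: "real^6 \<Rightarrow> real^6 \<Rightarrow> real^6"
  assumes "x \<in> rank_le_1 br"
  shows "br x (axis a 1) $ i * br x (axis b 1) $ j = br x (axis a 1) $ j * br x (axis b 1) $ i"
proof -
  obtain w where w: "\<And>u. br x u \<in> span {w}"
    using assms by (auto simp: rank_le_1_def)
  obtain s t where "br x (axis a 1) = s *\<^sub>R w" "br x (axis b 1) = t *\<^sub>R w"
    using w[of "axis a 1"] w[of "axis b 1"] by (auto simp: span_singleton)
  then show ?thesis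
    by simp
qed

lemma rank_le_1I: "(\<And>u. br x u = c u *\<^sub>R w) \<Longrightarrow> x \<in> span (rank_le_1 br)"
  by (rule span_base) (auto simp: rank_le_1_def span_singleton)

lemma span_rank_le_1:
  assumes "\<And>x. x \<in> rank_le_1 br \<Longrightarrow> x \<in> coords J" "\<And>j. j \<in> J \<Longrightarrow> axis j 1 \<in> span (rank_le_1 br)"
  shows "span (rank_le_1 br) = coords J"
  using assms by (intro subset_antisym span_minimal coords_subset) auto

lemmas alg_simps = alg_defs vec6_eq_iff wedge_def axis_def

lemma derived_algebra_models:
  "derived_algebra alg_heis = coords {6}"
  "derived_algebra (alg_pencil D) = coords {5, 6}"
  "derived_algebra alg_12_15_34 = coords {5, 6}"
  "derived_algebra alg_12_15_23 = coords {5, 6}"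
  "derived_algebra (alg_twist D) = coords {4, 5, 6}"
  "derived_algebra alg_12_13_14_23 = coords {4, 5, 6}"
  "derived_algebra alg_12_23_14 = coords {4, 5, 6}"
  "derived_algebra alg_4step = coords {4, 5, 6}"
  "derived_algebra (alg_4step_split C) = coords {4, 5, 6}"
proof -
  have heis: "alg_heis (axis 1 1) (axis 2 1) = axis 6 1"
    by (simp add: alg_simps)
  have pencil: "alg_pencil D (axis 1 1) (axis 3 1) = axis 5 1"
    "alg_pencil D (axis 1 1) (axis 4 1) = axis 6 1"
    by (simp_all add: alg_simps)
  have c34: "alg_12_15_34 (axis 1 1) (axis 2 1) = axis 5 1" "alg_12_15_34 (axis 1 1) (axis 5 1) = axis 6 1"
    by (simp_all add: alg_simps)
  have c23: "alg_12_15_23 (axis 1 1) (axis 2 1) = axis 5 1" "alg_12_15_23 (axis 1 1) (axis 5 1) = axis 6 1"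
    by (simp_all add: alg_simps)
  have tw: "alg_twist D (axis 1 1) (axis 2 1) = axis 4 1" "alg_twist D (axis 1 1) (axis 4 1) = axis 5 1"
    "alg_twist D (axis 1 1) (axis 3 1) = axis 6 1"
    by (simp_all add: alg_simps)
  have s21: "alg_12_13_14_23 (axis 1 1) (axis 2 1) = axis 4 1" "alg_12_13_14_23 (axis 1 1) (axis 3 1) = axis 5 1"
    "alg_12_13_14_23 (axis 1 1) (axis 4 1) = axis 6 1"
    by (simp_all add: alg_simps)
  have a22: "alg_12_23_14 (axis 1 1) (axis 2 1) = axis 4 1" "alg_12_23_14 (axis 2 1) (axis 3 1) = axis 5 1"
    "alg_12_23_14 (axis 1 1) (axis 4 1) = axis 6 1"
    by (simp_all add: alg_simps)
  have a9: "alg_4step (axis 1 1) (axis 2 1) = axis 4 1" "alg_4step (axis 1 1) (axis 4 1) = axis 5 1"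
    "alg_4step (axis 1 1) (axis 5 1) = axis 6 1"
    by (simp_all add: alg_simps)
  have a10: "alg_4step_split C (axis 1 1) (axis 2 1) = axis 4 1" "alg_4step_split C (axis 1 1) (axis 4 1) = axis 5 1"
    "alg_4step_split C (axis 1 1) (axis 5 1) = axis 6 1"
    by (simp_all add: alg_simps)
  show "derived_algebra alg_heis = coords {6}"
    by (rule derived_algebra_coords) (simp add: alg_defs coord_simps, use heis in blast)
  show "derived_algebra (alg_pencil D) = coords {5, 6}"
    by (rule derived_algebra_coords) (simp add: alg_defs coord_simps, use pencil in blast)
  show "derived_algebra alg_12_15_34 = coords {5, 6}"
    by (rule derived_algebra_coords) (simp add: alg_defs coord_simps, use c34 in blast)
  show "derived_algebra alg_12_15_23 = coords {5, 6}"
    by (rule derived_algebra_coords) (simp add: alg_defs coord_simps, use c23 in blast)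
  show "derived_algebra (alg_twist D) = coords {4, 5, 6}"
    by (rule derived_algebra_coords) (simp add: alg_defs coord_simps, use tw in blast)
  show "derived_algebra alg_12_13_14_23 = coords {4, 5, 6}"
    by (rule derived_algebra_coords) (simp add: alg_defs coord_simps, use s21 in blast)
  show "derived_algebra alg_12_23_14 = coords {4, 5, 6}"
    by (rule derived_algebra_coords) (simp add: alg_defs coord_simps, use a22 in blast)
  show "derived_algebra alg_4step = coords {4, 5, 6}"
    by (rule derived_algebra_coords) (simp add: alg_defs coord_simps, use a9 in blast)
  show "derived_algebra (alg_4step_split C) = coords {4, 5, 6}"
    by (rule derived_algebra_coords) (simp add: alg_defs coord_simps, use a10 in blast)
qed

lemma lie_center_models:
  "lie_center (alg_pencil D) = coords {5, 6}" "lie_center alg_12_15_34 = coords {6}"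
  "lie_center alg_12_15_23 = coords {4, 6}" "lie_center (alg_twist D) = coords {5, 6}"
  "lie_center alg_12_13_14_23 = coords {5, 6}" "lie_center alg_12_23_14 = coords {5, 6}"
  "lie_center alg_4step = coords {6}"
  "lie_center (alg_4step_split 0) = coords {6}" "lie_center (alg_4step_split 1) = coords {6}"
  by (subst lie_center_coords, rule lie_algebra_models, (auto simp: coord_simps alg_simps)[1])+

lemma centralizer_models:
  "centralizer (alg_pencil D) (coords {5, 6}) = coords UNIV"
  "centralizer alg_12_15_23 (coords {5, 6}) = coords {2, 3, 4, 5, 6}"
  "centralizer (alg_twist D) (coords {4, 5, 6}) = coords {3, 4, 5, 6}"
  "centralizer alg_12_13_14_23 (coords {4, 5, 6}) = coords {2, 3, 4, 5, 6}"
  "centralizer alg_12_23_14 (coords {4, 5, 6}) = coords {2, 3, 4, 5, 6}"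
  "centralizer (alg_4step_split 0) (coords {4, 5, 6}) = coords {2, 3, 4, 5, 6}"
  "centralizer (alg_4step_split 1) (coords {4, 5, 6}) = coords {3, 4, 5, 6}"
  by (subst centralizer_coords, rule lie_algebra_models, (auto simp: coord_simps alg_simps)[1])+


lemma span_rank_le_1_models:
  "span (rank_le_1 (alg_pencil (-1))) = coords {5, 6}"
  "span (rank_le_1 (alg_pencil 0)) = coords {2, 4, 5, 6}"
  "span (rank_le_1 (alg_pencil 1)) = coords UNIV"
  "span (rank_le_1 alg_12_15_23) = coords {3, 4, 5, 6}"
  "span (rank_le_1 (alg_twist (-1))) = coords {5, 6}"
  "span (rank_le_1 (alg_twist 0)) = coords {3, 5, 6}"
  "span (rank_le_1 (alg_twist 1)) = coords {3, 4, 5, 6}"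
  "span (rank_le_1 alg_12_13_14_23) = coords {4, 5, 6}"
  "span (rank_le_1 alg_12_23_14) = coords {3, 4, 5, 6}"
  "span (rank_le_1 alg_4step) = coords {5, 6}"
  "span (rank_le_1 (alg_4step_split C)) = coords {3, 4, 5, 6}"
proof -
  have axisI: "axis j 1 \<in> span (rank_le_1 br)"
    if "\<And>u. br (axis j 1) u = (br (axis j 1) u $ m) *\<^sub>R axis m 1"
    for m j and br :: "real^6 \<Rightarrow> real^6 \<Rightarrow> real^6"
    by (rule rank_le_1I) (rule that)
  have half_sum: "a \<in> span S" if "a + b \<in> span S" "a - b \<in> span S" for a b :: "real^6" and S
  proof -
    have "a = (1 / 2) *\<^sub>R ((a + b) + (a - b))"
      by (simp add: scaleR_2[symmetric])
    then show ?thesis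
      using that by (metis span_add span_scale)
  qed
  have half_diff: "b \<in> span S" if "a + b \<in> span S" "a - b \<in> span S" for a b :: "real^6" and S
    using half_sum[of b a S] that by (metis add.commute minus_diff_eq span_neg)
  note m = rank_le_1_minor
  show "span (rank_le_1 (alg_pencil (-1))) = coords {5, 6}"
  proof (rule span_rank_le_1)
    fix x assume x: "x \<in> rank_le_1 (alg_pencil (- 1))"
    \<comment> \<open>The two minors read \<open>x3^2 = D x4^2\<close> and
      \<open>x1^2 = D x2^2\<close>: sums of squares here, plain squares for
      \<open>D = 0\<close>.\<close>
    show "x \<in> coords {5, 6}"
      using m[OF x, of 1 5 2 6] m[OF x, of 3 5 4 6] sum_squares_eq_zero_iff[of "x$1" "x$2"]
        sum_squares_eq_zero_iff[of "x$3" "x$4"] by (simp add: alg_simps coord_simps)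
  next
    fix j :: 6 assume "j \<in> {5, 6}"
    then show "axis j 1 \<in> span (rank_le_1 (alg_pencil (-1)))"
      by (intro axisI[where m = 5]; auto simp: alg_simps)+
  qed
  show "span (rank_le_1 (alg_pencil 0)) = coords {2, 4, 5, 6}"
  proof (rule span_rank_le_1)
    fix x assume x: "x \<in> rank_le_1 (alg_pencil 0)"
    show "x \<in> coords {2, 4, 5, 6}"
      using m[OF x, of 1 5 2 6] m[OF x, of 3 5 4 6] by (simp add: alg_simps coord_simps)
  next
    fix j :: 6 assume "j \<in> {2, 4, 5, 6}"
    then show "axis j 1 \<in> span (rank_le_1 (alg_pencil 0))"
      by (intro axisI[where m = 6]; auto simp: alg_simps)+
  qed
  show "span (rank_le_1 (alg_pencil 1)) = coords UNIV"
  proof (rule span_rank_le_1)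
    \<comment> \<open>For \<open>D = 1\<close> the ring \<open>R[t]/(t^2 - 1)\<close> has the
      idempotents \<open>(1 + t)/2\<close> and \<open>(1 - t)/2\<close>; up to a factor they send
      \<open>e1\<close> to \<open>e1 + e2\<close> and \<open>e1 - e2\<close>, each lying in one
      Heisenberg summand.\<close>
    have "axis 1 1 + axis 2 1 \<in> span (rank_le_1 (alg_pencil 1))"
      by (rule rank_le_1I[where w = "axis 5 1 + axis 6 1" and c = "\<lambda>u. u$3 + u$4"]) (simp add: alg_simps)
    moreover have "axis 1 1 - axis 2 1 \<in> span (rank_le_1 (alg_pencil 1))"
      by (rule rank_le_1I[where w = "axis 5 1 - axis 6 1" and c = "\<lambda>u. u$3 - u$4"]) (simp add: alg_simps)
    ultimately have "axis 1 1 \<in> span (rank_le_1 (alg_pencil 1))"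
      "axis 2 1 \<in> span (rank_le_1 (alg_pencil 1))"
      by (rule half_sum, rule half_diff)
    moreover have "axis 3 1 + axis 4 1 \<in> span (rank_le_1 (alg_pencil 1))"
      by (rule rank_le_1I[where w = "axis 5 1 + axis 6 1" and c = "\<lambda>u. - u$1 - u$2"]) (simp add: alg_simps)
    moreover have "axis 3 1 - axis 4 1 \<in> span (rank_le_1 (alg_pencil 1))"
      by (rule rank_le_1I[where w = "axis 5 1 - axis 6 1" and c = "\<lambda>u. - u$1 + u$2"]) (simp add: alg_simps)
    ultimately have *: "axis 1 1 \<in> span (rank_le_1 (alg_pencil 1))"
      "axis 2 1 \<in> span (rank_le_1 (alg_pencil 1))"
      "axis 3 1 \<in> span (rank_le_1 (alg_pencil 1))"
      "axis 4 1 \<in> span (rank_le_1 (alg_pencil 1))"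
      using half_sum half_diff by blast+
    have "axis 5 1 \<in> span (rank_le_1 (alg_pencil 1))" "axis 6 1 \<in> span (rank_le_1 (alg_pencil 1))"
      by (intro axisI[where m = 5]; auto simp: alg_simps)+
    with * show "axis j 1 \<in> span (rank_le_1 (alg_pencil 1))" for j
      using exhaust_6[of j] by metis
  qed (simp add: coords_def)
  show "span (rank_le_1 alg_12_15_23) = coords {3, 4, 5, 6}"
  proof (rule span_rank_le_1)
    fix x assume x: "x \<in> rank_le_1 alg_12_15_23"
    show "x \<in> coords {3, 4, 5, 6}"
      using m[OF x, of 2 5 5 6] m[OF x, of 1 5 3 6] by (simp add: alg_simps coord_simps)
  next
    fix j :: 6 assume "j \<in> {3, 4, 5, 6}"
    then show "axis j 1 \<in> span (rank_le_1 alg_12_15_23)"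
      by (intro axisI[where m = 6]; auto simp: alg_simps)+
  qed
  show "span (rank_le_1 (alg_twist (-1))) = coords {5, 6}"
  proof (rule span_rank_le_1)
    fix x assume x: "x \<in> rank_le_1 (alg_twist (- 1))"
    have "x$1 = 0" "x$2 = 0"
      using m[OF x, of 2 4 4 5] m[OF x, of 1 4 4 6] by (simp_all add: alg_simps)
    \<comment> \<open>With the first two coordinates gone, the remaining minor reads
      \<open>x4^2 = D x3^2\<close>. For \<open>D = 1\<close> it splits into two lines, those of
      \<open>e3 + e4\<close> and \<open>e3 - e4\<close>.\<close>
    then show "x \<in> coords {5, 6}"
      using m[OF x, of 1 5 2 6] sum_squares_eq_zero_iff[of "x$4" "x$3"]
      by (simp add: alg_simps coord_simps)
  next
    fix j :: 6 assume "j \<in> {5, 6}"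
    then show "axis j 1 \<in> span (rank_le_1 (alg_twist (-1)))"
      by (intro axisI[where m = 5]; auto simp: alg_simps)+
  qed
  show "span (rank_le_1 (alg_twist 0)) = coords {3, 5, 6}"
  proof (rule span_rank_le_1)
    fix x assume x: "x \<in> rank_le_1 (alg_twist 0)"
    have "x$1 = 0" "x$2 = 0"
      using m[OF x, of 2 4 4 5] m[OF x, of 1 4 4 6] by (simp_all add: alg_simps)
    then show "x \<in> coords {3, 5, 6}"
      using m[OF x, of 1 5 2 6] by (simp add: alg_simps coord_simps)
  next
    fix j :: 6 assume "j \<in> {3, 5, 6}"
    then show "axis j 1 \<in> span (rank_le_1 (alg_twist 0))"
      by (intro axisI[where m = 6]; auto simp: alg_simps)+
  qed
  show "span (rank_le_1 (alg_twist 1)) = coords {3, 4, 5, 6}"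
  proof (rule span_rank_le_1)
    fix x assume x: "x \<in> rank_le_1 (alg_twist 1)"
    show "x \<in> coords {3, 4, 5, 6}"
      using m[OF x, of 2 4 4 5] m[OF x, of 1 4 4 6] by (simp add: alg_simps coord_simps)
  next
    have "axis 3 1 + axis 4 1 \<in> span (rank_le_1 (alg_twist 1))"
      by (rule rank_le_1I[where w = "axis 5 1 + axis 6 1" and c = "\<lambda>u. - u$1 - u$2"]) (simp add: alg_simps)
    moreover have "axis 3 1 - axis 4 1 \<in> span (rank_le_1 (alg_twist 1))"
      by (rule rank_le_1I[where w = "axis 5 1 - axis 6 1" and c = "\<lambda>u. u$1 - u$2"]) (simp add: alg_simps)
    ultimately have "axis 3 1 \<in> span (rank_le_1 (alg_twist 1))"
      "axis 4 1 \<in> span (rank_le_1 (alg_twist 1))"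
      by (rule half_sum, rule half_diff)
    moreover have "axis 5 1 \<in> span (rank_le_1 (alg_twist 1))" "axis 6 1 \<in> span (rank_le_1 (alg_twist 1))"
      by (intro axisI[where m = 5]; auto simp: alg_simps)+
    ultimately show "axis j 1 \<in> span (rank_le_1 (alg_twist 1))" if "j \<in> {3, 4, 5, 6}" for j
      using that by auto
  qed
  show "span (rank_le_1 alg_12_13_14_23) = coords {4, 5, 6}"
  proof (rule span_rank_le_1)
    fix x assume x: "x \<in> rank_le_1 alg_12_13_14_23"
    show "x \<in> coords {4, 5, 6}"
      using m[OF x, of 2 4 4 6] m[OF x, of 1 4 3 6] m[OF x, of 1 5 2 6]
      by (simp add: alg_simps coord_simps)
  next
    fix j :: 6 assume "j \<in> {4, 5, 6}"
    then show "axis j 1 \<in> span (rank_le_1 alg_12_13_14_23)"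
      by (intro axisI[where m = 6]; auto simp: alg_simps)+
  qed
  show "span (rank_le_1 alg_12_23_14) = coords {3, 4, 5, 6}"
  proof (rule span_rank_le_1)
    fix x assume x: "x \<in> rank_le_1 alg_12_23_14"
    show "x \<in> coords {3, 4, 5, 6}"
      using m[OF x, of 2 4 4 6] m[OF x, of 1 4 3 5] by (simp add: alg_simps coord_simps)
  next
    have "axis 3 1 \<in> span (rank_le_1 alg_12_23_14)"
      by (rule axisI[where m = 5]) (simp add: alg_simps)
    moreover have "axis 4 1 \<in> span (rank_le_1 alg_12_23_14)" "axis 5 1 \<in> span (rank_le_1 alg_12_23_14)"
      "axis 6 1 \<in> span (rank_le_1 alg_12_23_14)"
      by (intro axisI[where m = 6]; auto simp: alg_simps)+
    ultimately show "axis j 1 \<in> span (rank_le_1 alg_12_23_14)" if "j \<in> {3, 4, 5, 6}" for j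
      using that by auto
  qed
  show "span (rank_le_1 alg_4step) = coords {5, 6}"
  proof (rule span_rank_le_1)
    fix x assume x: "x \<in> rank_le_1 alg_4step"
    show "x \<in> coords {5, 6}"
      using m[OF x, of 2 4 5 6] m[OF x, of 1 4 3 5] m[OF x, of 2 5 4 6] m[OF x, of 1 5 3 6]
      by (simp add: alg_simps coord_simps)
  next
    fix j :: 6 assume "j \<in> {5, 6}"
    then show "axis j 1 \<in> span (rank_le_1 alg_4step)"
      by (intro axisI[where m = 6]; auto simp: alg_simps)+
  qed
  show "span (rank_le_1 (alg_4step_split C)) = coords {3, 4, 5, 6}"
  proof (rule span_rank_le_1)
    fix x assume x: "x \<in> rank_le_1 (alg_4step_split C)"
    show "x \<in> coords {3, 4, 5, 6}"
      using m[OF x, of 2 4 5 6] m[OF x, of 1 4 3 6] by (simp add: alg_simps coord_simps)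
  next
    have 3: "axis 3 1 \<in> span (rank_le_1 (alg_4step_split C))"
      by (rule axisI[where m = 6]) (simp add: alg_simps)
    \<comment> \<open>Subtracting \<open>C e3\<close> cancels the \<open>e6\<close>-component of the
      bracket with \<open>e2\<close>.\<close>
    have "axis 4 1 - C *\<^sub>R axis 3 1 \<in> span (rank_le_1 (alg_4step_split C))"
      by (rule rank_le_1I[where w = "axis 5 1" and c = "\<lambda>u. - u$1"]) (simp add: alg_simps)
    then have "axis 4 1 \<in> span (rank_le_1 (alg_4step_split C))"
      using 3 by (metis diff_add_cancel span_add span_scale)
    moreover have "axis 5 1 \<in> span (rank_le_1 (alg_4step_split C))" "axis 6 1 \<in> span (rank_le_1 (alg_4step_split C))"
      by (intro axisI[where m = 6]; auto simp: alg_simps)+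
    ultimately show "axis j 1 \<in> span (rank_le_1 (alg_4step_split C))" if "j \<in> {3, 4, 5, 6}" for j
      using that 3 by auto
  qed
qed

text \<open>A list, so that a single \<open>distinct\<close> statement about invariants yields both
  the number fourteen and pairwise non-isomorphism.\<close>

definition models :: "(real^6 \<Rightarrow> real^6 \<Rightarrow> real^6) list" where
  "models = [alg_heis, alg_12_15_34, alg_12_15_23, alg_pencil (-1), alg_pencil 0, alg_pencil 1,
     alg_4step, alg_4step_split 0, alg_4step_split 1, alg_twist (-1), alg_twist 0, alg_twist 1, alg_12_13_14_23, alg_12_23_14]"

text \<open>Comparison is lexicographic: \<open>alg_heis\<close> is settled by the first entry,
  \<open>alg_12_15_34\<close> by the second and \<open>alg_4step\<close> by the third, so their
  later entries stay unevaluated.\<close>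

lemma distinct_invariants: "distinct (map lie_invariants models)"
  by (simp add: models_def lie_invariants_def derived_algebra_models lie_center_models
      centralizer_models span_rank_le_1_models dim_coords del: dim_span)

subsection \<open>Normal forms of parametrised families\<close>

text \<open>The witness runs from \<open>m\<close> to \<open>br\<close>, against the direction of
  the conclusion, so that it reads as a change of basis: it sends the standard basis to the new
  basis vectors of \<open>br\<close>.\<close>

lemma lie_isomorphic_coordI:
  fixes g :: "real^6 \<Rightarrow> real^6"
  assumes "linear g" "\<And>x. g x = 0 \<Longrightarrow> x = 0" "\<And>x y. g (m x y) = br (g x) (g y)"
  shows "lie_isomorphic br m"
proof -
  have "inj g"
    using assms(1,2) by (metis linear_injective_0)
  then have "bij g"
    using assms(1) by (simp add: bij_def linear_injective_imp_surjective)
  then have "lie_isomorphic m br"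
    using assms(1,3) lie_isomorphic_def by blast
  then show ?thesis
    by (rule lie_isomorphic_sym)
qed

text \<open>\<open>D\<close> and \<open>v\<close> are the companion matrix entries of
  \<open>ad x2\<close> relative to \<open>ad x1\<close>; \<open>t\<close> and \<open>u\<close> are
  the coordinates of the one further bracket \<open>[x3, x4]\<close>.\<close>

definition fam_pencil :: "real \<Rightarrow> real \<Rightarrow> real \<Rightarrow> real \<Rightarrow> real^6 \<Rightarrow> real^6 \<Rightarrow> real^6" where
  "fam_pencil D v t u x y = vec6 0 0 0 0
     (wedge 1 3 x y + D * wedge 2 4 x y + t * wedge 3 4 x y)
     (wedge 1 4 x y + wedge 2 3 x y + v * wedge 2 4 x y + u * wedge 3 4 x y)"

definition fam_12_15 :: "real \<Rightarrow> real \<Rightarrow> real \<Rightarrow> real^6 \<Rightarrow> real^6 \<Rightarrow> real^6" where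
  "fam_12_15 p q r x y = vec6 0 0 0 0 (wedge 1 2 x y)
     (wedge 1 5 x y + p * wedge 2 3 x y + q * wedge 2 4 x y + r * wedge 3 4 x y)"

definition fam_twist :: "real \<Rightarrow> real \<Rightarrow> real^6 \<Rightarrow> real^6 \<Rightarrow> real^6" where
  "fam_twist D v x y = vec6 0 0 0 (wedge 1 2 x y) (wedge 1 4 x y + D * wedge 2 3 x y)
     (wedge 1 3 x y + wedge 2 4 x y + v * wedge 2 3 x y)"

definition fam_12_23_14 :: "real \<Rightarrow> real \<Rightarrow> real^6 \<Rightarrow> real^6 \<Rightarrow> real^6" where
  "fam_12_23_14 a b x y = vec6 0 0 0 (wedge 1 2 x y) (wedge 2 3 x y + a * wedge 1 3 x y)
     (wedge 1 4 x y + b * wedge 1 3 x y)"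

definition fam_12_13_14_23 :: "real \<Rightarrow> real^6 \<Rightarrow> real^6 \<Rightarrow> real^6" where
  "fam_12_13_14_23 d x y = vec6 0 0 0 (wedge 1 2 x y) (wedge 1 3 x y) (wedge 1 4 x y + d * wedge 2 3 x y)"

text \<open>The coefficient \<open>- b\<close> of \<open>wedge 3 4\<close> is forced by the Jacobi
  identity for the first three basis vectors.\<close>

definition fam_4step :: "real \<Rightarrow> real \<Rightarrow> real \<Rightarrow> real^6 \<Rightarrow> real^6 \<Rightarrow> real^6" where
  "fam_4step b b' c x y = vec6 0 0 0 (wedge 1 2 x y) (wedge 1 4 x y + b * wedge 2 3 x y)
     (wedge 1 5 x y + b' * wedge 2 3 x y + c * wedge 2 4 x y - b * wedge 3 4 x y)"

lemmas fam_defs = fam_pencil_def fam_12_15_def fam_twist_def fam_12_23_14_def fam_12_13_14_23_def fam_4step_def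

lemma lie_algebra_families:
  "lie_algebra (fam_pencil D v t u)" "lie_algebra (fam_12_15 p q r)" "lie_algebra (fam_twist D v)"
  "lie_algebra (fam_12_23_14 a b)" "lie_algebra (fam_12_13_14_23 d)" "lie_algebra (fam_4step b b' c)"
  by (rule lie_algebra_vec6I; simp add: fam_defs coord_simps algebra_simps)+

lemma normalise_sign:
  assumes pos: "\<And>l. l > 0 \<Longrightarrow> lie_isomorphic (br (l\<^sup>2)) (br 1)"
    and neg: "\<And>l. l > 0 \<Longrightarrow> lie_isomorphic (br (- l\<^sup>2)) (br (-1))"
    and zero: "lie_isomorphic (br 0) (br 0)"
  shows "\<exists>s\<in>{-1, 0, 1}. lie_isomorphic (br (D :: real)) (br s)"
proof -
  consider "D = 0" | "D > 0" | "D < 0"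
    by linarith
  then show ?thesis
  proof cases
    case 1
    then show ?thesis
      using zero by auto
  next
    case 2
    then show ?thesis
      using pos[of "sqrt D"] by simp
  next
    case 3
    then show ?thesis
      using neg[of "sqrt (- D)"] by simp
  qed
qed

lemma lie_isomorphic_refl: "lie_isomorphic br br"
  unfolding lie_isomorphic_def by (rule exI[of _ id]) (auto simp: linear_id)

lemma alg_pencil_sign: "\<exists>s\<in>{-1, 0, 1}. lie_isomorphic (alg_pencil D) (alg_pencil s)"
proof (rule normalise_sign[where br = alg_pencil])
  have "lie_isomorphic (alg_pencil (s * l\<^sup>2)) (alg_pencil s)" if "l > 0" for l s :: real
    \<comment> \<open>In the picture over \<open>R[t]/(t^2 - s l^2)\<close>, the root
      \<open>t\<close> is replaced by \<open>t / l\<close>.\<close>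
    by (rule lie_isomorphic_coordI[where g = "\<lambda>x. vec6 (x$1) (x$2 / l) (x$3) (x$4 / l) (x$5) (x$6 / l)"])
      (use that in \<open>auto simp: linear_iff alg_defs coord_simps field_simps power2_eq_square\<close>)
  from this[of _ 1] this[of _ "-1"]
  show "lie_isomorphic (alg_pencil (l\<^sup>2)) (alg_pencil 1)"
    "lie_isomorphic (alg_pencil (- l\<^sup>2)) (alg_pencil (-1))" if "l > 0" for l :: real
    using that by simp_all
qed (rule lie_isomorphic_refl)

lemma alg_twist_sign: "\<exists>s\<in>{-1, 0, 1}. lie_isomorphic (alg_twist D) (alg_twist s)"
proof (rule normalise_sign[where br = alg_twist])
  have "lie_isomorphic (alg_twist (s * l\<^sup>2)) (alg_twist s)" if "l > 0" for l s :: real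
    by (rule lie_isomorphic_coordI[where g =
        "\<lambda>x. vec6 (x$1) (x$2 / l) (x$3 / l\<^sup>2) (x$4 / l) (x$5 / l) (x$6 / l\<^sup>2)"])
      (use that in \<open>auto simp: linear_iff alg_defs coord_simps field_simps power2_eq_square\<close>)
  from this[of _ 1] this[of _ "-1"]
  show "lie_isomorphic (alg_twist (l\<^sup>2)) (alg_twist 1)"
    "lie_isomorphic (alg_twist (- l\<^sup>2)) (alg_twist (-1))" if "l > 0" for l :: real
    using that by simp_all
qed (rule lie_isomorphic_refl)

text \<open>\<open>D + v\<^sup>2/4\<close> is a quarter of the discriminant of the characteristic polynomial of \<open>ad x2\<close>
  relative to \<open>ad x1\<close>; in the twisted family, of \<open>ad x3\<close> relative to \<open>ad x4\<close>.\<close>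

lemma fam_pencil_reduce: "lie_isomorphic (fam_pencil D v t u) (alg_pencil (D + v\<^sup>2 / 4))"
  \<comment> \<open>The shifts by \<open>v / 2\<close> complete the square; the multiples of
    \<open>x1\<close> added to \<open>x3\<close> and \<open>x4\<close> remove \<open>t\<close> and
    \<open>u\<close>.\<close>
  by (rule lie_isomorphic_coordI[where g = "\<lambda>x. vec6
      (x$1 - v / 2 * x$2 - u * x$3 + (t + u * v / 2) * x$4) (x$2) (x$3 - v / 2 * x$4) (x$4)
      (x$5 - v / 2 * x$6) (x$6)"])
    (auto simp: linear_iff alg_defs fam_defs coord_simps field_simps power2_eq_square)

lemma fam_twist_reduce: "lie_isomorphic (fam_twist D v) (alg_twist (D + v\<^sup>2 / 4))"
  by (rule lie_isomorphic_coordI[where g = "\<lambda>x. vec6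
      (x$1 - v / 2 * x$2) (x$2) (x$3) (x$4 - v / 2 * x$3) (x$5 - v / 2 * x$6) (x$6)"])
    (auto simp: linear_iff alg_defs fam_defs coord_simps field_simps power2_eq_square)

lemma fam_pencil_model: "\<exists>m\<in>set models. lie_isomorphic (fam_pencil D v t u) m"
proof -
  obtain s where "s \<in> {-1, 0, 1}" "lie_isomorphic (alg_pencil (D + v\<^sup>2 / 4)) (alg_pencil s)"
    using alg_pencil_sign by blast
  moreover have "alg_pencil s \<in> set models"
    using calculation(1) by (auto simp: models_def)
  ultimately show ?thesis
    using fam_pencil_reduce lie_isomorphic_trans by blast
qed

lemma fam_twist_model: "\<exists>m\<in>set models. lie_isomorphic (fam_twist D v) m"
proof -
  obtain s where "s \<in> {-1, 0, 1}" "lie_isomorphic (alg_twist (D + v\<^sup>2 / 4)) (alg_twist s)"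
    using alg_twist_sign by blast
  moreover have "alg_twist s \<in> set models"
    using calculation(1) by (auto simp: models_def)
  ultimately show ?thesis
    using fam_twist_reduce lie_isomorphic_trans by blast
qed

text \<open>\<open>p\<close>, \<open>q\<close>, \<open>r\<close> are the entries of an alternating
  form on the span of \<open>x2\<close>, \<open>x3\<close>, \<open>x4\<close>. Its radical is a
  line. If \<open>r\<close> is nonzero the line is transversal to the plane of \<open>x3\<close>,
  \<open>x4\<close> and \<open>x2\<close> can be moved into it; otherwise it lies in that plane and
  supplies the new \<open>x4\<close>.\<close>

lemma fam_12_15_model:
  assumes "p \<noteq> 0 \<or> q \<noteq> 0 \<or> r \<noteq> 0"
  shows "\<exists>m\<in>set models. lie_isomorphic (fam_12_15 p q r) m"
proof -
  consider "r \<noteq> 0" | "r = 0" "p \<noteq> 0" | "r = 0" "p = 0" "q \<noteq> 0"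
    using assms by blast
  then show ?thesis
  proof cases
    case 1
    have "lie_isomorphic (fam_12_15 p q r) alg_12_15_34"
      by (rule lie_isomorphic_coordI[where g = "\<lambda>x. vec6
          (x$1) (x$2) (x$3 / r - q / r * x$2) (x$4 + p / r * x$2) (x$5) (x$6)"])
        (use 1 in \<open>auto simp: linear_iff alg_defs fam_defs coord_simps field_simps\<close>)
    then show ?thesis
      by (auto simp: models_def)
  next
    case 2
    have "lie_isomorphic (fam_12_15 p q r) alg_12_15_23"
      by (rule lie_isomorphic_coordI[where g = "\<lambda>x. vec6
          (x$1) (x$2) (x$3 / p - q / p * x$4) (x$4) (x$5) (x$6)"])
        (use 2 in \<open>auto simp: linear_iff alg_defs fam_defs coord_simps field_simps\<close>)
    then show ?thesis
      by (auto simp: models_def)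
  next
    case 3
    have "lie_isomorphic (fam_12_15 p q r) alg_12_15_23"
      by (rule lie_isomorphic_coordI[where g = "\<lambda>x. vec6 (x$1) (x$2) (x$4) (x$3 / q) (x$5) (x$6)"])
        (use 3 in \<open>auto simp: linear_iff alg_defs fam_defs coord_simps field_simps\<close>)
    then show ?thesis
      by (auto simp: models_def)
  qed
qed

lemma fam_12_23_14_model: "\<exists>m\<in>set models. lie_isomorphic (fam_12_23_14 a b) m"
proof -
  have "lie_isomorphic (fam_12_23_14 a b) alg_12_23_14"
    by (rule lie_isomorphic_coordI[where g = "\<lambda>x. vec6
        (x$1) (x$2 - a * x$1) (x$3) (x$4 - b * x$3) (x$5) (x$6)"])
      (auto simp: linear_iff alg_defs fam_defs coord_simps field_simps)
  then show ?thesis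
    by (auto simp: models_def)
qed

lemma fam_12_13_14_23_model:
  assumes "d \<noteq> 0"
  shows "\<exists>m\<in>set models. lie_isomorphic (fam_12_13_14_23 d) m"
proof -
  have "lie_isomorphic (fam_12_13_14_23 d) alg_12_13_14_23"
    by (rule lie_isomorphic_coordI[where g = "\<lambda>x. vec6
        (x$1) (x$2) (x$3 / d) (x$4) (x$5 / d) (x$6)"])
      (use assms in \<open>auto simp: linear_iff alg_defs fam_defs coord_simps field_simps\<close>)
  then show ?thesis
    by (auto simp: models_def)
qed

lemma fam_4step_model:
  assumes "b \<noteq> 0 \<or> b' \<noteq> 0"
  shows "\<exists>m\<in>set models. lie_isomorphic (fam_4step b b' c) m"
proof -
  consider "b \<noteq> 0" | "b = 0" "b' \<noteq> 0" "c = 0" | "b = 0" "b' \<noteq> 0" "c \<noteq> 0"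
    using assms by blast
  then show ?thesis
  proof cases
    case 1
    \<comment> \<open>\<open>x1\<close> is replaced by \<open>x1 + s x3\<close> and
      \<open>x2\<close> by \<open>x2 + t x3\<close>. The second change kills \<open>c\<close> if
      \<open>t = c / b\<close>. The first adds \<open>- 2 s b x6\<close> to the new
      \<open>x5\<close>, and \<open>[x2, x3] = - x5\<close> then determines
      \<open>s\<close>.\<close>
    define s t where "s = - b' / (2 * b\<^sup>2)" and "t = c / b"
    have st: "b' = - 2 * b * b * s" "c = t * b"
      using 1 by (simp_all add: s_def t_def power2_eq_square)
    have "lie_isomorphic (fam_4step b b' c) alg_4step"
      by (rule lie_isomorphic_coordI[where g = "\<lambda>x. vec6
          (x$1) (x$2) (s * x$1 + t * x$2 - x$3 / b) (x$4) (x$5 - s * b * x$4)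
          (x$6 - s * b' * x$4 - 2 * s * b * x$5)"])
        (use 1 in \<open>auto simp: st linear_iff alg_defs fam_defs coord_simps field_simps\<close>)
    then show ?thesis
      by (auto simp: models_def)
  next
    case 2
    have "lie_isomorphic (fam_4step b b' c) (alg_4step_split 0)"
      by (rule lie_isomorphic_coordI[where g = "\<lambda>x. vec6 (x$1) (x$2) (x$3 / b') (x$4) (x$5) (x$6)"])
        (use 2 in \<open>auto simp: linear_iff alg_defs fam_defs coord_simps field_simps\<close>)
    then show ?thesis
      by (auto simp: models_def)
  next
    case 3
    have "lie_isomorphic (fam_4step b b' c) (alg_4step_split 1)"
      by (rule lie_isomorphic_coordI[where g = "\<lambda>x. vec6
          (x$1) (x$2 / c) (x$3 / b') (x$4 / c) (x$5 / c) (x$6 / c)"])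
        (use 3 in \<open>auto simp: linear_iff alg_defs fam_defs coord_simps field_simps\<close>)
    then show ?thesis
      by (auto simp: models_def)
  qed
qed

subsection \<open>Bases adapted to the bracket\<close>

text \<open>Stated through coefficients, because independence of a set would not notice repeated
  vectors.\<close>

definition independent6 :: "'a::real_vector \<Rightarrow> 'a \<Rightarrow> 'a \<Rightarrow> 'a \<Rightarrow> 'a \<Rightarrow> 'a \<Rightarrow> bool" where
  "independent6 x1 x2 x3 x4 x5 x6 \<longleftrightarrow> (\<forall>c1 c2 c3 c4 c5 c6.
     c1 *\<^sub>R x1 + c2 *\<^sub>R x2 + c3 *\<^sub>R x3 + c4 *\<^sub>R x4 + c5 *\<^sub>R x5 + c6 *\<^sub>R x6 = 0 \<longrightarrow>
     c1 = 0 \<and> c2 = 0 \<and> c3 = 0 \<and> c4 = 0 \<and> c5 = 0 \<and> c6 = 0)"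

definition combination6 :: "'a::real_vector \<Rightarrow> 'a \<Rightarrow> 'a \<Rightarrow> 'a \<Rightarrow> 'a \<Rightarrow> 'a \<Rightarrow> real^6 \<Rightarrow> 'a" where
  "combination6 x1 x2 x3 x4 x5 x6 v =
     v$1 *\<^sub>R x1 + v$2 *\<^sub>R x2 + v$3 *\<^sub>R x3 + v$4 *\<^sub>R x4 + v$5 *\<^sub>R x5 + v$6 *\<^sub>R x6"

lemma linear_combination6: "linear (combination6 x1 x2 x3 x4 x5 x6)"
  by (auto simp: combination6_def linear_iff algebra_simps)

lemma bij_combination6:
  fixes x1 :: "'a::euclidean_space"
  assumes "independent6 x1 x2 x3 x4 x5 x6" "DIM('a) = 6"
  shows "bij (combination6 x1 x2 x3 x4 x5 x6)"
proof -
  have "inj (combination6 x1 x2 x3 x4 x5 x6)"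
    unfolding linear_injective_0[OF linear_combination6]
    using assms(1) by (auto simp: independent6_def combination6_def vec6_eq_iff)
  moreover have "surj (combination6 x1 x2 x3 x4 x5 x6)"
    using linear_injective_imp_surjective[OF linear_combination6 calculation] assms(2) by simp
  ultimately show ?thesis
    by (simp add: bij_def)
qed

lemma independent6_combination:
  fixes x1 :: "'a::euclidean_space"
  assumes "independent6 x1 x2 x3 x4 x5 x6" "DIM('a) = 6"
  obtains c1 c2 c3 c4 c5 c6 where
    "y = c1 *\<^sub>R x1 + c2 *\<^sub>R x2 + c3 *\<^sub>R x3 + c4 *\<^sub>R x4 + c5 *\<^sub>R x5 + c6 *\<^sub>R x6"
proof -
  obtain v where "y = combination6 x1 x2 x3 x4 x5 x6 v"
    using bij_combination6[OF assms] by (metis bij_pointE)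
  then show ?thesis
    using that by (simp add: combination6_def)
qed

text \<open>Both brackets are bilinear and alternating, so the fifteen pairs of basis vectors with
  increasing indices decide.\<close>

lemma lie_isomorphic_basisI:
  fixes br :: "'a::euclidean_space \<Rightarrow> 'a \<Rightarrow> 'a" and x1 :: 'a
  defines "comb \<equiv> combination6"
  assumes "lie_algebra br" "lie_algebra m" "DIM('a) = 6"
    and ind: "independent6 x1 x2 x3 x4 x5 x6"
    and "br x1 x2 = comb x1 x2 x3 x4 x5 x6 (m (axis 1 1) (axis 2 1))"
    and "br x1 x3 = comb x1 x2 x3 x4 x5 x6 (m (axis 1 1) (axis 3 1))"
    and "br x1 x4 = comb x1 x2 x3 x4 x5 x6 (m (axis 1 1) (axis 4 1))"
    and "br x1 x5 = comb x1 x2 x3 x4 x5 x6 (m (axis 1 1) (axis 5 1))"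
    and "br x1 x6 = comb x1 x2 x3 x4 x5 x6 (m (axis 1 1) (axis 6 1))"
    and "br x2 x3 = comb x1 x2 x3 x4 x5 x6 (m (axis 2 1) (axis 3 1))"
    and "br x2 x4 = comb x1 x2 x3 x4 x5 x6 (m (axis 2 1) (axis 4 1))"
    and "br x2 x5 = comb x1 x2 x3 x4 x5 x6 (m (axis 2 1) (axis 5 1))"
    and "br x2 x6 = comb x1 x2 x3 x4 x5 x6 (m (axis 2 1) (axis 6 1))"
    and "br x3 x4 = comb x1 x2 x3 x4 x5 x6 (m (axis 3 1) (axis 4 1))"
    and "br x3 x5 = comb x1 x2 x3 x4 x5 x6 (m (axis 3 1) (axis 5 1))"
    and "br x3 x6 = comb x1 x2 x3 x4 x5 x6 (m (axis 3 1) (axis 6 1))"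
    and "br x4 x5 = comb x1 x2 x3 x4 x5 x6 (m (axis 4 1) (axis 5 1))"
    and "br x4 x6 = comb x1 x2 x3 x4 x5 x6 (m (axis 4 1) (axis 6 1))"
    and "br x5 x6 = comb x1 x2 x3 x4 x5 x6 (m (axis 5 1) (axis 6 1))"
  shows "lie_isomorphic br m"
proof -
  interpret lie_algebra br
    by (rule assms)
  interpret m: lie_algebra m
    by (rule assms)
  define f where "f = comb x1 x2 x3 x4 x5 x6"
  note comb = assms(6-20)[folded f_def]
  have f: "linear f" "bij f"
    using linear_combination6 bij_combination6[OF ind assms(4)] by (simp_all add: f_def comb_def)
  have ax: "f (axis 1 1) = x1" "f (axis 2 1) = x2" "f (axis 3 1) = x3" "f (axis 4 1) = x4"
    "f (axis 5 1) = x5" "f (axis 6 1) = x6"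
    by (simp_all add: f_def comb_def combination6_def axis_def)
  define ok where "ok i j \<longleftrightarrow> f (m (axis i 1) (axis j 1)) = br (f (axis i 1)) (f (axis j 1))" for i j
  have flip: "ok j i" if "ok i j" for i j
    using that br_anti[of "f (axis j 1)" "f (axis i 1)"] m.br_anti[of "axis j 1" "axis i 1"]
    by (simp add: ok_def linear_neg[OF f(1)])
  have diag: "ok i i" for i
    by (simp add: ok_def linear_0[OF f(1)])
  have upper: "ok 1 2" "ok 1 3" "ok 1 4" "ok 1 5" "ok 1 6" "ok 2 3" "ok 2 4" "ok 2 5" "ok 2 6"
    "ok 3 4" "ok 3 5" "ok 3 6" "ok 4 5" "ok 4 6" "ok 5 6"
    by (simp_all add: ok_def comb ax)
  have all: "ok i j" for i j
    using exhaust_6[of i] exhaust_6[of j] upper upper[THEN flip] diag by (elim disjE) simp_all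
  have "(\<lambda>u v. f (m u v)) = (\<lambda>u v. br (f u) (f v))"
  proof (rule bilinear_eq_stdbasis)
    show "bilinear (\<lambda>u v. f (m u v))" "bilinear (\<lambda>u v. br (f u) (f v))"
      by (auto simp: bilinear_def linear_iff linear_add[OF f(1)] linear_cmul[OF f(1)])
    show "f (m i j) = br (f i) (f j)" if "i \<in> Basis" "j \<in> Basis" for i j
      using that all by (auto simp: Basis_vec_def ok_def)
  qed
  then have "lie_isomorphic m br"
    unfolding lie_isomorphic_def using f by metis
  then show ?thesis
    by (rule lie_isomorphic_sym)
qed

section \<open>Spans, dimension counts and the choice of basis vectors\<close>

lemma coefficient_zero:
  assumes "c *\<^sub>R x + s = 0" "s \<in> S" "subspace S" "x \<notin> S"
  shows "c = 0"
proof (rule ccontr)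
  assume "c \<noteq> 0"
  have "c *\<^sub>R x = - s"
    using assms(1) by (simp add: eq_neg_iff_add_eq_0)
  then have "inverse c *\<^sub>R (c *\<^sub>R x) \<in> S"
    using assms(2,3) by (simp add: subspace_scale subspace_neg)
  then show False
    using assms(4) \<open>c \<noteq> 0\<close> by simp
qed

lemma dim_1_span:
  fixes x :: "'a::euclidean_space"
  assumes "subspace S" "dim S = 1" "x \<in> S" "x \<noteq> 0"
  shows "S = span {x}"
  by (rule subspace_dim_equal[symmetric]) (use assms in \<open>auto simp: dim_insert span_minimal\<close>)

lemma dim_2_span:
  fixes x :: "'a::euclidean_space"
  assumes "subspace S" "dim S = 2" "x \<in> S" "y \<in> S" "x \<noteq> 0" "y \<notin> span {x}"
  shows "S = span {x, y}"
proof -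
  have "dim {y, x} = 2"
    using assms by (simp add: dim_insert)
  then show ?thesis
    by (intro subspace_dim_equal[symmetric]) (use assms in \<open>auto simp: insert_commute span_minimal\<close>)
qed

lemma dim_2_basis:
  fixes S :: "'a::euclidean_space set"
  assumes "subspace S" "dim S = 2"
  obtains x y where "x \<in> S" "y \<in> S" "x \<noteq> 0" "y \<notin> span {x}" "S = span {x, y}"
proof -
  obtain x where x: "x \<in> S" "x \<noteq> 0"
    using assms by (metis dim_eq_0 subsetI singletonI zero_neq_numeral)
  have "\<not> S \<subseteq> span {x}"
  proof
    assume "S \<subseteq> span {x}"
    then have "dim S \<le> 1"
      using dim_le_card[of S "{x}"] by simp
    then show False
      using assms by simp
  qed
  then obtain y where "y \<in> S" "y \<notin> span {x}"
    by blast
  then show ?thesis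
    using that dim_2_span assms x by blast
qed

lemma independent_2:
  assumes "x \<noteq> 0" "y \<notin> span {x}" "a *\<^sub>R x + b *\<^sub>R y = 0"
  shows "a = 0 \<and> b = 0"
proof -
  have "b = 0"
    by (rule coefficient_zero[of b y "a *\<^sub>R x" "span {x}"])
      (use assms in \<open>auto simp: add.commute span_base span_scale\<close>)
  then show ?thesis
    using assms by simp
qed

text \<open>Expanding \<open>C (p + q)\<close> in the independent vectors \<open>A p\<close>,
  \<open>A q\<close> makes the three factors agree. It is used contrapositively: unless
  \<open>C\<close> is a multiple of \<open>A\<close> on the plane, one of \<open>p\<close>,
  \<open>q\<close>, \<open>p + q\<close> has \<open>C y\<close> off the line of
  \<open>A y\<close>.\<close>

lemma proportional:
  assumes "linear A" "linear C" "A p \<noteq> 0" "A q \<notin> span {A p}"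
    and "\<And>y. y \<in> {p, q, p + q} \<Longrightarrow> C y \<in> span {A y}"
  shows "\<exists>l. C p = l *\<^sub>R A p \<and> C q = l *\<^sub>R A q"
proof -
  obtain l m n where l: "C p = l *\<^sub>R A p" "C q = m *\<^sub>R A q" "C (p + q) = n *\<^sub>R A (p + q)"
    using assms(5)[of p] assms(5)[of q] assms(5)[of "p + q"] by (auto simp: span_singleton)
  then have "(n - l) *\<^sub>R A p + (n - m) *\<^sub>R A q = 0"
    using linear_add[OF assms(1), of p q] linear_add[OF assms(2), of p q] by (simp add: algebra_simps)
  then have "n - l = 0 \<and> n - m = 0"
    by (rule independent_2[OF assms(3,4)])
  then show ?thesis
    using l by auto
qed

text \<open>If \<open>N\<close> lay in \<open>span B\<close>, so would every vector, which is too
  much for so few generators. It produces a further basis vector satisfying the bracket conditions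
  collected in \<open>N\<close>.\<close>

lemma exists_outside_span:
  fixes N :: "'a::euclidean_space set"
  assumes "finite B" "card B < DIM('a)" "\<And>y. \<exists>n\<in>N. y - n \<in> span B"
  obtains n where "n \<in> N" "n \<notin> span B"
proof -
  have "\<not> N \<subseteq> span B"
  proof
    assume *: "N \<subseteq> span B"
    have "y \<in> span B" for y
    proof -
      obtain n where "n \<in> N" "y - n \<in> span B"
        using assms(3) by blast
      then have "n + (y - n) \<in> span B"
        using * by (intro span_add) auto
      then show ?thesis
        by simp
    qed
    then have "dim (UNIV :: 'a set) \<le> card B"
      using assms(1) by (intro dim_le_card) auto
    then show False
      using assms(2) by simp
  qed
  then show ?thesis
    using that by blast
qed

lemma card_list_5_less: "card {a, b, c, d, e} < 6"
  using card_length[of "[a, b, c, d, e]"] by simp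

context nilpotent_lie_algebra
begin

text \<open>Equality would place \<open>S\<close> in every lower central term.\<close>

lemma ideal_descends:
  assumes "S \<noteq> {0}" "subspace S"
  shows "bracket_span br UNIV S \<noteq> S"
proof
  assume *: "bracket_span br UNIV S = S"
  have "S \<subseteq> lower_central br n" for n
  proof (induction n)
    case (Suc n)
    have "bracket_span br UNIV S \<subseteq> bracket_span br UNIV (lower_central br n)"
      by (rule bracket_span_mono) (use Suc in auto)
    then show ?case
      using * by simp
  qed auto
  moreover obtain n where "lower_central br n = {0}"
    using nilpotent by (auto simp: nilpotent_lie_def)
  ultimately show False
    using assms subspace_0[OF assms(2)] by blast
qed

end

section \<open>First consequences of the four conditions\<close>

locale nilpotent_6 = nilpotent_lie_algebra br
  for br :: "'a::euclidean_space \<Rightarrow> 'a \<Rightarrow> 'a" +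
  assumes dim_6: "DIM('a) = 6" and four: "four_conditions br"
begin

abbreviation "D \<equiv> derived_algebra br"
abbreviation "Z \<equiv> lie_center br"

lemma dim_bracket_less:
  assumes "subspace S" "S \<noteq> {0}" "bracket_span br UNIV S \<subseteq> S"
  shows "dim (bracket_span br UNIV S) < dim S"
proof -
  have "\<not> dim S \<le> dim (bracket_span br UNIV S)"
    using subspace_dim_equal[OF subspace_bracket_span assms(1,3)] ideal_descends[OF assms(2,1)] by blast
  then show ?thesis
    by simp
qed

lemma centerI: "(\<And>y. br x y = 0) \<Longrightarrow> x \<in> Z"
  by (simp add: lie_center_def)

text \<open>Bracketing with the whole algebra strictly lowers the dimension of a nonzero ideal, so
  it sends a line to 0.\<close>

lemma central_bracket_zero:
  assumes "subspace S" "dim S = 1" "bracket_span br UNIV S \<subseteq> S"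
  shows "S \<subseteq> Z"
proof
  fix x assume x: "x \<in> S"
  have "S \<noteq> {0}"
    using assms(2) by auto
  then have "dim (bracket_span br UNIV S) = 0"
    using dim_bracket_less[OF assms(1) _ assms(3)] assms(2) by simp
  then have "br y x = 0" for y
    using bracket_spanI[of y UNIV x S br] x by (auto simp: dim_eq_0)
  then show "x \<in> Z"
    by (intro centerI) (metis br_swap_0)
qed

lemma dim_Z_le: "dim Z \<le> 2"
  using four by (simp add: four_conditions_def)

lemma dim_D_Z_le: "dim {x + z | x z. x \<in> D \<and> z \<in> Z} \<le> 3"
  using four by (simp add: four_conditions_def)

lemma dim_D_le: "dim D \<le> 3"
proof -
  have "D \<subseteq> {x + z | x z. x \<in> D \<and> z \<in> Z}"
    using subspace_0[OF subspace_lie_center] by force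
  then show ?thesis
    using dim_subset dim_D_Z_le order_trans by blast
qed

lemma bracket_D: "bracket_span br UNIV D \<subseteq> D"
  unfolding derived_algebra_def by (rule bracket_span_mono) auto

text \<open>The last nonzero term of the lower central series is central.\<close>

lemma dim_Z_pos: "dim Z \<ge> 1"
proof -
  obtain n where n: "lower_central br n = {0}"
    using nilpotent by (auto simp: nilpotent_lie_def)
  define k where "k = (LEAST n. lower_central br n = {0})"
  have k: "lower_central br k = {0}"
    unfolding k_def using n by (rule LeastI)
  have "k \<noteq> 0"
  proof
    assume "k = 0"
    then have "(UNIV :: 'a set) = {0}"
      using k by simp
    then have "dim (UNIV :: 'a set) = dim {0 :: 'a}"
      by (rule arg_cong)
    then show False
      using dim_6 by simp
  qed
  then obtain j where j: "k = Suc j"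
    using not0_implies_Suc by blast
  have "lower_central br j \<noteq> {0}"
    using not_less_Least[of j "\<lambda>n. lower_central br n = {0}"] j by (simp add: k_def)
  then obtain x where x: "x \<in> lower_central br j" "x \<noteq> 0"
    using subspace_0[OF subspace_lower_central] by blast
  have "br y x = 0" for y
    using k bracket_spanI[of y UNIV x "lower_central br j" br] x(1) by (simp add: j)
  then have "x \<in> Z"
    by (intro centerI) (metis br_swap_0)
  then have "dim Z \<noteq> 0"
    using x(2) by (auto simp: dim_eq_0)
  then show ?thesis
    by linarith
qed

text \<open>Condition (1) in the form needed for excluding parameters: the last five vectors would
  span an abelian ideal of codimension one.\<close>

lemma abelian_hyperplane:
  assumes ind: "independent6 x1 x2 x3 x4 x5 x6"
    and S: "\<And>x. x \<in> {x2, x3, x4, x5, x6} \<Longrightarrow> br x1 x \<in> span {x2, x3, x4, x5, x6}"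
    and 0: "br x2 x3 = 0" "br x2 x4 = 0" "br x2 x5 = 0" "br x2 x6 = 0" "br x3 x4 = 0"
      "br x3 x5 = 0" "br x3 x6 = 0" "br x4 x5 = 0" "br x4 x6 = 0" "br x5 x6 = 0"
  shows False
proof -
  let ?B = "{x2, x3, x4, x5, x6}"
  let ?I = "span ?B"
  note zero = 0 0[THEN br_swap_0]
  have base: "br x y = 0" if "x \<in> ?B" "y \<in> ?B" for x y
    using that zero by auto
  have "?B \<subseteq> {x. br x y = 0}" if "y \<in> ?B" for y
    using base that by blast
  then have "?I \<subseteq> {x. br x y = 0}" if "y \<in> ?B" for y
    using that by (intro span_minimal) (auto simp: subspace_def)
  then have "?B \<subseteq> {y. br x y = 0}" if "x \<in> ?I" for x
    using that by blast
  then have ab: "?I \<subseteq> {y. br x y = 0}" if "x \<in> ?I" for x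
    using that by (intro span_minimal) (auto simp: subspace_def)
  have x1: "?I \<subseteq> {y. br x1 y \<in> ?I}"
    using S by (intro span_minimal) (auto simp: subspace_def span_add span_scale span_zero)
  have decomp: "\<exists>c. y - c *\<^sub>R x1 \<in> ?I" for y
  proof -
    obtain c1 c2 c3 c4 c5 c6 where
      "y = c1 *\<^sub>R x1 + c2 *\<^sub>R x2 + c3 *\<^sub>R x3 + c4 *\<^sub>R x4 + c5 *\<^sub>R x5 + c6 *\<^sub>R x6"
      by (rule independent6_combination[OF ind dim_6])
    then have "y - c1 *\<^sub>R x1 = c2 *\<^sub>R x2 + c3 *\<^sub>R x3 + c4 *\<^sub>R x4 + c5 *\<^sub>R x5 + c6 *\<^sub>R x6"
      by simp
    also have "\<dots> \<in> ?I"
      by (intro span_add span_scale) (auto intro: span_base)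
    finally show ?thesis
      by blast
  qed
  have "bracket_span br UNIV ?I \<subseteq> ?I"
  proof (rule bracket_span_least)
    fix y x assume x: "x \<in> ?I"
    obtain c where c: "y - c *\<^sub>R x1 \<in> ?I"
      using decomp by blast
    have "br y x = br (y - c *\<^sub>R x1) x + c *\<^sub>R br x1 x"
      by simp
    also have "\<dots> = c *\<^sub>R br x1 x"
      using ab[OF c] x by auto
    also have "\<dots> \<in> ?I"
      using x1 x by (intro span_scale) auto
    finally show "br y x \<in> ?I" .
  qed auto
  then have "lie_ideal br ?I" "abelian_on br ?I"
    using ab by (auto simp: lie_ideal_def abelian_on_def)
  moreover have "dim ?I + 1 = dim (UNIV :: 'a set)"
  proof -
    have "dim ?I \<le> card ?B"
      by (rule dim_le_card) auto
    moreover have "card ?B < 6"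
      by (rule card_list_5_less)
    moreover have "y \<in> span (insert x1 ?I)" for y
      using decomp[of y] by (simp only: span_breakdown_eq[of y x1 ?I] span_span)
    then have "UNIV = span (insert x1 ?I)"
      by blast
    then have "dim (insert x1 ?I) = 6"
      using dim_6 by (metis dim_UNIV dim_span)
    then have "6 \<le> dim ?I + 1"
      by (simp add: dim_insert split: if_splits)
    ultimately show ?thesis
      using dim_6 by simp
  qed
  ultimately show False
    using four by (auto simp: four_conditions_def)
qed

subsection \<open>Derived algebra of dimension at most two\<close>

lemmas basisI = lie_isomorphic_basisI[OF lie_algebra_axioms _ dim_6]

lemmas comb_simps = combination6_def alg_defs fam_defs wedge_def axis_def

lemma derived_nonzero: "dim D \<noteq> 0"
proof
  assume "dim D = 0"
  then have "br x y = 0" for x y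
    using derived_algebra_br[of br x y] by auto
  then have "Z = UNIV"
    by (auto simp: lie_center_def)
  then show False
    using dim_Z_le dim_6 by simp
qed

text \<open>The bracket is an alternating form with values in the central line \<open>D\<close>, and
  \<open>Z\<close> is its radical. Since \<open>dim Z\<close> is 1 or 2, the rank is four: two
  hyperbolic pairs split off, and \<open>x5\<close>, \<open>x6\<close> span the radical.\<close>

lemma case_dim_1:
  assumes "dim D = 1"
  shows "lie_isomorphic br alg_heis"
proof -
  have "\<exists>x1 x2. br x1 x2 \<noteq> 0"
  proof (rule ccontr)
    assume "\<not> ?thesis"
    then have "D \<subseteq> {0}"
      unfolding derived_algebra_def by (intro bracket_span_least) auto
    then show False
      using derived_nonzero by simp
  qed
  then obtain x1 x2 where "br x1 x2 \<noteq> 0"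
    by blast
  define x6 where "x6 = br x1 x2"
  have x6: "x6 \<noteq> 0"
    using \<open>br x1 x2 \<noteq> 0\<close> by (simp add: x6_def)
  have D: "D = span {x6}"
    by (rule dim_1_span) (use assms x6 derived_algebra_br in \<open>auto simp: x6_def\<close>)
  then have \<omega>: "\<exists>w. br x y = w *\<^sub>R x6" for x y
    using derived_algebra_br[of br x y] by (auto simp: span_singleton)
  have "D \<subseteq> Z"
    by (rule central_bracket_zero) (use assms bracket_D in auto)
  then have "x6 \<in> Z"
    unfolding D by (auto intro: span_base)
  note x6Z = lie_center_br[OF this]
  have x12: "br x1 x2 = x6" "br x2 x1 = - x6"
    using br_anti[of x2 x1] by (simp_all add: x6_def)
  \<comment> \<open>The orthogonal complement of the hyperbolic pair \<open>x1\<close>,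
    \<open>x2\<close>.\<close>
  define U where "U = {u. br x1 u = 0 \<and> br x2 u = 0}"
  have U: "\<exists>a b. y - (a *\<^sub>R x1 + b *\<^sub>R x2) \<in> U" for y
  proof -
    obtain a b where "br x1 y = a *\<^sub>R x6" "br x2 y = b *\<^sub>R x6"
      using \<omega> by metis
    then have "y - ((- b) *\<^sub>R x1 + a *\<^sub>R x2) \<in> U"
      by (simp add: U_def x12)
    then show ?thesis
      by blast
  qed
  have "\<exists>x3\<in>U. \<exists>x4\<in>U. br x3 x4 \<noteq> 0"
  proof (rule ccontr)
    assume *: "\<not> ?thesis"
    \<comment> \<open>A form vanishing on \<open>U\<close> makes \<open>U\<close> central; then
      \<open>x1\<close>, \<open>x2\<close> and at most two central vectors would span all six
      dimensions.\<close>
    have UZ: "u \<in> Z" if u: "u \<in> U" for u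
    proof (rule centerI)
      fix y
      obtain a b where n: "y - (a *\<^sub>R x1 + b *\<^sub>R x2) \<in> U"
        using U by blast
      have "br u (y - (a *\<^sub>R x1 + b *\<^sub>R x2)) = 0"
        using * u n by blast
      moreover have "br u x1 = 0" "br u x2 = 0"
        using u by (auto simp: U_def intro: br_swap_0)
      ultimately show "br u y = 0"
        by simp
    qed
    obtain B where B: "B \<subseteq> Z" "independent B" "Z \<subseteq> span B" "card B = dim Z"
      using basis_exists by blast
    have "finite B"
      using B(2) by (rule independent_imp_finite)
    then have "card (insert x1 (insert x2 B)) < DIM('a)"
      using B(4) dim_Z_le dim_6 by (simp add: card_insert_if)
    then obtain n where n: "n \<in> U" "n \<notin> span (insert x1 (insert x2 B))"
    proof (rule exists_outside_span[rotated])
      fix y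
      obtain a b where "y - (a *\<^sub>R x1 + b *\<^sub>R x2) \<in> U"
        using U by blast
      moreover have "y - (y - (a *\<^sub>R x1 + b *\<^sub>R x2)) \<in> span (insert x1 (insert x2 B))"
        by (simp add: span_add span_scale span_base)
      ultimately show "\<exists>n\<in>U. y - n \<in> span (insert x1 (insert x2 B))"
        by blast
    qed (use \<open>finite B\<close> in auto)
    have "span B \<subseteq> span (insert x1 (insert x2 B))"
      by (rule span_mono) auto
    then show False
      using n UZ B(3) by blast
  qed
  then obtain y3 x4 where y3: "y3 \<in> U" "x4 \<in> U" "br y3 x4 \<noteq> 0"
    by blast
  obtain c where c: "br y3 x4 = c *\<^sub>R x6" "c \<noteq> 0"
    using \<omega> y3(3) by (metis scaleR_zero_left)
  define x3 where "x3 = (1 / c) *\<^sub>R y3"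
  have x34: "br x3 x4 = x6" "br x4 x3 = - x6"
    using br_anti[of x4 x3] c by (simp_all add: x3_def)
  have xU: "br x1 x3 = 0" "br x1 x4 = 0" "br x2 x3 = 0" "br x2 x4 = 0"
    using y3 by (simp_all add: U_def x3_def)
  define U' where "U' = {u. br x1 u = 0 \<and> br x2 u = 0 \<and> br x3 u = 0 \<and> br x4 u = 0}"
  have "card {x1, x2, x3, x4, x6} < DIM('a)"
    using card_list_5_less dim_6 by metis
  then obtain x5 where x5: "x5 \<in> U'" "x5 \<notin> span {x1, x2, x3, x4, x6}"
  proof (rule exists_outside_span[rotated])
    fix y
    obtain a b where ab: "y - (a *\<^sub>R x1 + b *\<^sub>R x2) \<in> U"
      using U by blast
    define z where "z = y - (a *\<^sub>R x1 + b *\<^sub>R x2)"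
    obtain d e where de: "br x3 z = d *\<^sub>R x6" "br x4 z = e *\<^sub>R x6"
      using \<omega> by metis
    have "z - ((- e) *\<^sub>R x3 + d *\<^sub>R x4) \<in> U'"
      using ab[folded z_def] by (simp add: U'_def U_def xU x34 de)
    moreover have "y - (z - ((- e) *\<^sub>R x3 + d *\<^sub>R x4)) =
        a *\<^sub>R x1 + b *\<^sub>R x2 + (- e) *\<^sub>R x3 + d *\<^sub>R x4"
      by (simp add: z_def)
    moreover have "\<dots> \<in> span {x1, x2, x3, x4, x6}"
      by (intro span_add span_scale) (auto intro: span_base)
    ultimately show "\<exists>n\<in>U'. y - n \<in> span {x1, x2, x3, x4, x6}"
      by metis
  qed auto
  have x5U: "br x1 x5 = 0" "br x2 x5 = 0" "br x3 x5 = 0" "br x4 x5 = 0"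
    using x5(1) by (simp_all add: U'_def)
  have ind: "independent6 x1 x2 x3 x4 x5 x6"
    unfolding independent6_def
  proof (intro allI impI)
    fix c1 c2 c3 c4 c5 c6
    assume eq: "c1 *\<^sub>R x1 + c2 *\<^sub>R x2 + c3 *\<^sub>R x3 + c4 *\<^sub>R x4 + c5 *\<^sub>R x5 + c6 *\<^sub>R x6 = 0"
    note b = arg_cong[OF eq, of "br x1"] arg_cong[OF eq, of "br x2"] arg_cong[OF eq, of "br x3"]
      arg_cong[OF eq, of "br x4"]
    have c: "c1 = 0" "c2 = 0" "c3 = 0" "c4 = 0"
      using b x6 xU[THEN br_swap_0] by (simp_all add: x12 x34 xU x5U x6Z)
    have "c5 = 0"
      by (rule coefficient_zero[of c5 x5 "c6 *\<^sub>R x6" "span {x1, x2, x3, x4, x6}"])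
        (use eq c x5 in \<open>auto intro: span_base span_scale\<close>)
    then show "c1 = 0 \<and> c2 = 0 \<and> c3 = 0 \<and> c4 = 0 \<and> c5 = 0 \<and> c6 = 0"
      using c eq x6 by simp
  qed
  show ?thesis
    by (rule basisI[OF lie_algebra_models(1) ind])
      (simp_all add: comb_simps x12 x34 xU x5U x6Z br_swap_0[OF x5U(1)] br_swap_0[OF x5U(2)])
qed

text \<open>Suppose every \<open>ad x\<close> has rank at most one and take brackets
  \<open>br a b\<close>, \<open>br c d\<close> on different lines. Then \<open>br c b\<close> and
  \<open>br a d\<close> lie on both lines, hence vanish, and \<open>ad (a + c)\<close> has rank two
  after all.\<close>

lemma two_step_rank_2:
  assumes "dim D = 2"
  obtains x y1 y2 where "br x y1 \<noteq> 0" "br x y2 \<notin> span {br x y1}"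
proof (rule ccontr)
  assume "\<not> thesis"
  then have H: "br x y2 \<in> span {br x y1}" if "br x y1 \<noteq> 0" for x y1 y2
    using that \<open>\<And>y1 x y2. br x y1 \<noteq> 0 \<Longrightarrow> br x y2 \<notin> span {br x y1} \<Longrightarrow> thesis\<close> by blast
  have notline: "\<not> D \<subseteq> span {v}" for v
  proof
    assume "D \<subseteq> span {v}"
    then have "dim D \<le> 1"
      using dim_le_card[of D "{v}"] by simp
    then show False
      using assms by simp
  qed
  have "\<exists>a b. br a b \<noteq> 0"
  proof (rule ccontr)
    assume "\<not> ?thesis"
    then have "D \<subseteq> span {0}"
      unfolding derived_algebra_def by (intro bracket_span_least) auto
    then show False
      using notline by blast
  qed
  then obtain a b where ab: "br a b \<noteq> 0"
    by blast
  have "\<exists>c d. br c d \<notin> span {br a b}"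
  proof (rule ccontr)
    assume "\<not> ?thesis"
    then have "D \<subseteq> span {br a b}"
      unfolding derived_algebra_def by (intro bracket_span_least) auto
    then show False
      using notline by blast
  qed
  then obtain c d where cd: "br c d \<notin> span {br a b}"
    by blast
  then have cd0: "br c d \<noteq> 0"
    using span_zero by metis
  have disjoint: "v = 0" if v: "v \<in> span {br a b}" "v \<in> span {br c d}" for v
  proof -
    obtain s t where st: "v = s *\<^sub>R br a b" "v = t *\<^sub>R br c d"
      using v unfolding span_singleton by blast
    then have "(- s) *\<^sub>R br a b + t *\<^sub>R br c d = 0"
      by (metis add.left_inverse scaleR_minus_left)
    then show ?thesis
      using independent_2[OF ab cd, of "- s" t] st by simp
  qed
  have flip: "br x y \<in> span {v}" if "br y x \<in> span {v}" for x y v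
    using that span_neg by (subst br_anti) blast
  have swap: "span {br y x} = span {br x y}" for x y
  proof (rule subset_antisym)
    show "span {br y x} \<subseteq> span {br x y}" for x y
    proof (rule span_minimal)
      show "{br y x} \<subseteq> span {br x y}"
        using flip[OF span_base[OF singletonI]] by simp
    qed simp
    then show "span {br x y} \<subseteq> span {br y x}" .
  qed
  have cb: "br c b = 0"
  proof (rule disjoint)
    have "br b c \<in> span {br b a}"
      using H ab br_swap_0 by blast
    then show "br c b \<in> span {br a b}"
      using flip swap[of b a] by blast
    show "br c b \<in> span {br c d}"
      using H cd0 by blast
  qed
  have ad: "br a d = 0"
  proof (rule disjoint)
    have "br d a \<in> span {br d c}"
      using H cd0 br_swap_0 by blast
    then show "br a d \<in> span {br c d}"
      using flip swap[of d c] by blast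
    show "br a d \<in> span {br a b}"
      using H ab by blast
  qed
  have "br (a + c) b = br a b" "br (a + c) d = br c d"
    using cb ad by simp_all
  then show False
    using H[of "a + c" b d] ab cd by simp
qed

text \<open>\<open>ad x1\<close> maps onto \<open>Z\<close>, \<open>x2\<close> lies in its kernel,
  and \<open>x3\<close> is cyclic for the pair \<open>ad x1\<close>, \<open>ad x2\<close>. Choosing
  \<open>x4\<close> with \<open>br x1 x4 = br x2 x3\<close> puts the pair into companion
  form.\<close>

lemma case_two_step:
  assumes "dim D = 2" "D \<subseteq> Z"
  shows "\<exists>\<Delta> v t u. lie_isomorphic br (fam_pencil \<Delta> v t u)"
proof -
  have Z2: "dim Z = 2"
    using dim_subset[OF assms(2)] assms(1) dim_Z_le by simp
  have brZ: "br x y \<in> Z" for x y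
    using assms(2) derived_algebra_br by blast
  obtain x1 y1 y2 where y: "br x1 y1 \<noteq> 0" "br x1 y2 \<notin> span {br x1 y1}"
    by (rule two_step_rank_2[OF assms(1)])
  define a b where "a = br x1 y1" and "b = br x1 y2"
  have ab: "a \<noteq> 0" "b \<notin> span {a}"
    using y by (simp_all add: a_def b_def)
  have Zab: "Z = span {a, b}"
    by (rule dim_2_span) (use Z2 ab brZ in \<open>auto simp: a_def b_def\<close>)
  have abZ: "a \<in> Z" "b \<in> Z"
    using brZ by (simp_all add: a_def b_def)
  have onto: "\<exists>s t. z = br x1 (s *\<^sub>R y1 + t *\<^sub>R y2)" if "z \<in> Z" for z
    using that unfolding Zab in_span_2 by (auto simp: a_def b_def)
  have "card {y1, y2, x1, a, b} < DIM('a)"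
    using card_list_5_less dim_6 by metis
  then obtain x2 where x2: "x2 \<in> {n. br x1 n = 0}" "x2 \<notin> span {y1, y2, x1, a, b}"
  proof (rule exists_outside_span[rotated])
    fix v
    obtain s t where st: "br x1 v = br x1 (s *\<^sub>R y1 + t *\<^sub>R y2)"
      using onto[OF brZ] by blast
    then have "v - (s *\<^sub>R y1 + t *\<^sub>R y2) \<in> {n. br x1 n = 0}"
      by simp
    moreover have "v - (v - (s *\<^sub>R y1 + t *\<^sub>R y2)) \<in> span {y1, y2, x1, a, b}"
      by (simp add: span_add span_scale span_base)
    ultimately show "\<exists>n\<in>{n. br x1 n = 0}. v - n \<in> span {y1, y2, x1, a, b}"
      by blast
  qed auto
  have x12: "br x1 x2 = 0" "br x2 x1 = 0"
    using x2(1) br_swap_0 by auto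
  have x1Z: "x1 \<notin> Z"
    using ab lie_center_br(1)[of x1 y1] by (auto simp: a_def)
  have x2_notin: "x2 \<notin> span {x1, a, b}"
    using x2(2) span_mono[of "{x1, a, b}" "{y1, y2, x1, a, b}"] by blast
  have ind: "independent6 x1 x2 w1 w2 p q"
    if w: "br x1 w1 = p" "br x1 w2 = q" and pq: "p \<noteq> 0" "q \<notin> span {p}" for w1 w2 p q
    unfolding independent6_def
  proof (intro allI impI)
    fix c1 c2 c3 c4 c5 c6
    assume eq: "c1 *\<^sub>R x1 + c2 *\<^sub>R x2 + c3 *\<^sub>R w1 + c4 *\<^sub>R w2 + c5 *\<^sub>R p + c6 *\<^sub>R q = 0"
    have pqZ: "p \<in> Z" "q \<in> Z"
      using w brZ by auto
    have "c3 *\<^sub>R p + c4 *\<^sub>R q = 0"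
      using arg_cong[OF eq, of "br x1"] lie_center_br(2)[OF pqZ(1)] lie_center_br(2)[OF pqZ(2)]
      by (simp add: w x12)
    then have c34: "c3 = 0" "c4 = 0"
      using independent_2[OF pq] by auto
    have "c5 *\<^sub>R p + c6 *\<^sub>R q \<in> Z"
      using pqZ by (simp add: subspace_add subspace_scale)
    then have pqs: "c5 *\<^sub>R p + c6 *\<^sub>R q \<in> span {a, b}"
      using Zab by simp
    then have "c5 *\<^sub>R p + c6 *\<^sub>R q \<in> span {x1, a, b}"
      using span_mono[of "{a, b}" "{x1, a, b}"] by auto
    then have "c2 = 0"
      by (intro coefficient_zero[of c2 x2 "c1 *\<^sub>R x1 + (c5 *\<^sub>R p + c6 *\<^sub>R q)" "span {x1, a, b}"])
        (use eq c34 x2_notin in \<open>auto simp: algebra_simps intro: span_add span_scale span_base\<close>)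
    moreover from this have "c1 = 0"
      by (intro coefficient_zero[of c1 x1 "c5 *\<^sub>R p + c6 *\<^sub>R q" Z])
        (use eq c34 x1Z pqs Zab in \<open>auto simp: algebra_simps\<close>)
    ultimately show "c1 = 0 \<and> c2 = 0 \<and> c3 = 0 \<and> c4 = 0 \<and> c5 = 0 \<and> c6 = 0"
      using c34 eq independent_2[OF pq, of c5 c6] by simp
  qed
  \<comment> \<open>Otherwise \<open>ad x2\<close> would be a multiple of \<open>ad x1\<close>, and
    \<open>x2\<close> would differ from a multiple of \<open>x1\<close> by a central vector.\<close>
  have "\<exists>y\<in>{y1, y2, y1 + y2}. br x2 y \<notin> span {br x1 y}"
  proof (rule ccontr)
    assume "\<not> ?thesis"
    then have "\<exists>l. br x2 y1 = l *\<^sub>R br x1 y1 \<and> br x2 y2 = l *\<^sub>R br x1 y2"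
      by (intro proportional[where A = "br x1" and C = "br x2"] linear_br_left)
        (use ab in \<open>auto simp: a_def b_def\<close>)
    then obtain l where l: "br x2 y1 = l *\<^sub>R br x1 y1" "br x2 y2 = l *\<^sub>R br x1 y2"
      by blast
    have "br (x2 - l *\<^sub>R x1) v = 0" for v
    proof -
      obtain c1 c2 c3 c4 c5 c6 where
        "v = c1 *\<^sub>R x1 + c2 *\<^sub>R x2 + c3 *\<^sub>R y1 + c4 *\<^sub>R y2 + c5 *\<^sub>R a + c6 *\<^sub>R b"
        by (rule independent6_combination[OF ind[OF _ _ ab, of y1 y2] dim_6]) (simp_all add: a_def b_def)
      then show ?thesis
        using lie_center_br(2)[OF abZ(1)] lie_center_br(2)[OF abZ(2)] by (simp add: x12 l)
    qed
    then have "x2 - l *\<^sub>R x1 \<in> span {a, b}"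
      using Zab by (metis centerI)
    then have "x2 \<in> span {x1, a, b}"
      by (auto simp: span_breakdown_eq[of x2 x1])
    then show False
      using x2_notin by blast
  qed
  then obtain x3 where x3: "x3 \<in> {y1, y2, y1 + y2}" "br x2 x3 \<notin> span {br x1 x3}"
    by blast
  define x5 x6 where "x5 = br x1 x3" and "x6 = br x2 x3"
  have x5: "x5 \<noteq> 0"
  proof
    assume "x5 = 0"
    moreover have "a + b \<noteq> 0" "b \<noteq> 0"
      using independent_2[OF ab, of 1 1] ab span_zero by (auto simp: add_eq_0_iff)
    ultimately show False
      using x3(1) ab(1) by (auto simp: x5_def a_def b_def)
  qed
  have x6: "x6 \<notin> span {x5}"
    using x3 by (simp add: x5_def x6_def)
  have Z56: "Z = span {x5, x6}"
    by (rule dim_2_span) (use Z2 x5 x6 brZ in \<open>auto simp: x5_def x6_def\<close>)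
  have "x6 \<in> Z"
    by (simp add: x6_def brZ)
  then obtain s t where x4: "x6 = br x1 (s *\<^sub>R y1 + t *\<^sub>R y2)"
    using onto by blast
  define x4 where "x4 = s *\<^sub>R y1 + t *\<^sub>R y2"
  have ind6: "independent6 x1 x2 x3 x4 x5 x6"
    by (rule ind) (use x4 x5 x6 in \<open>auto simp: x4_def x5_def\<close>)
  obtain \<Delta> v where x24: "br x2 x4 = \<Delta> *\<^sub>R x5 + v *\<^sub>R x6"
    using brZ[of x2 x4] Z56 in_span_2 by metis
  obtain t u where x34: "br x3 x4 = t *\<^sub>R x5 + u *\<^sub>R x6"
    using brZ[of x3 x4] Z56 in_span_2 by metis
  have x56: "x5 \<in> Z" "x6 \<in> Z"
    using brZ by (simp_all add: x5_def x6_def)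
  note central = lie_center_br[OF x56(1)] lie_center_br[OF x56(2)]
  have "br x1 x3 = x5" "br x2 x3 = x6" "br x1 x4 = x6"
    using x4 by (simp_all add: x4_def x5_def x6_def)
  then have "lie_isomorphic br (fam_pencil \<Delta> v t u)"
    by (intro basisI[OF lie_algebra_families(1) ind6])
      (simp_all add: comb_simps x12 x24 x34 central)
  then show ?thesis
    by blast
qed

text \<open>The centralizer \<open>K\<close> of a non-central \<open>y5\<close> in \<open>D\<close>
  is a hyperplane complementary to \<open>x1\<close>, and all brackets within it fall into one
  central line. The bracket is thus an alternating form on \<open>K\<close>, with entries
  \<open>p\<close>, \<open>q\<close>, \<open>r\<close> on \<open>x2\<close>, \<open>x3\<close>,
  \<open>x4\<close>.\<close>

lemma case_three_step:
  assumes "dim D = 2" "\<not> D \<subseteq> Z"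
  shows "\<exists>p q r. (p \<noteq> 0 \<or> q \<noteq> 0 \<or> r \<noteq> 0) \<and> lie_isomorphic br (fam_12_15 p q r)"
proof -
  obtain y5 where y5: "y5 \<in> D" "y5 \<notin> Z"
    using assms(2) by blast
  then obtain x1 where "br y5 x1 \<noteq> 0"
    using centerI by blast
  define y6 where "y6 = br x1 y5"
  have y6: "y6 \<noteq> 0"
    using \<open>br y5 x1 \<noteq> 0\<close> br_swap_0 by (auto simp: y6_def)
  define D2 where "D2 = bracket_span br UNIV D"
  have y6D2: "y6 \<in> D2"
    using y5 by (auto simp: D2_def y6_def intro: bracket_spanI)
  have "D \<noteq> {0}"
    using derived_nonzero by auto
  then have "dim D2 < 2"
    using dim_bracket_less[OF _ _ bracket_D] assms(1) by (simp add: D2_def)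
  moreover have "dim D2 \<noteq> 0"
    using y6D2 y6 by (auto simp: dim_eq_0)
  ultimately have dD2: "dim D2 = 1"
    by linarith
  have D2: "D2 = span {y6}"
    by (rule dim_1_span) (use dD2 y6 y6D2 in \<open>auto simp: D2_def\<close>)
  have "bracket_span br UNIV D2 \<subseteq> D2"
    unfolding D2_def by (rule bracket_span_mono) (use bracket_D in auto)
  then have "D2 \<subseteq> Z"
    by (intro central_bracket_zero) (use dD2 D2_def in auto)
  then have y6Z: "y6 \<in> Z"
    using y6D2 by blast
  note y6c = lie_center_br[OF y6Z]
  have y56: "y5 \<notin> span {y6}"
    using y5(2) y6Z span_minimal[of "{y6}" Z] by auto
  have D56: "D = span {y6, y5}"
  proof (rule dim_2_span)
    show "y6 \<in> D"
      by (simp add: y6_def derived_algebra_br)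
  qed (use assms y5 y6 y56 in auto)
  have brD: "\<exists>w v. br x y = w *\<^sub>R y6 + v *\<^sub>R y5" for x y
    using derived_algebra_br[of br x y] unfolding D56 in_span_2 .
  have \<phi>: "\<exists>c. br x y5 = c *\<^sub>R y6" for x
  proof -
    have "br x y5 \<in> D2"
      using y5 by (auto simp: D2_def intro: bracket_spanI)
    then show ?thesis
      by (auto simp: D2 span_singleton)
  qed
  define K where "K = {y. br y y5 = 0}"
  \<comment> \<open>Brackets lie in \<open>span {y6, y5}\<close> and hence commute with
    \<open>K\<close>. Jacobi gives \<open>br x1 (br y z) = 0\<close>, and \<open>ad x1\<close>
    detects the \<open>y5\<close>-component.\<close>
  have K6: "\<exists>w. br y z = w *\<^sub>R y6" if y: "y \<in> K" and z: "z \<in> K" for y z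
  proof -
    obtain w v where wv: "br y z = w *\<^sub>R y6 + v *\<^sub>R y5"
      using brD by blast
    obtain w1 v1 where 1: "br x1 y = w1 *\<^sub>R y6 + v1 *\<^sub>R y5"
      using brD by blast
    obtain w2 v2 where 2: "br x1 z = w2 *\<^sub>R y6 + v2 *\<^sub>R y5"
      using brD by blast
    have "br x1 (br y z) = br (br x1 y) z + br y (br x1 z)"
      using br_br_left[of x1 y z] by simp
    also have "\<dots> = 0"
      using y z br_swap_0 by (simp add: 1 2 K_def y6c)
    finally have "v *\<^sub>R y6 = 0"
      by (simp add: wv y6c y6_def[symmetric])
    then show ?thesis
      using wv y6 by auto
  qed
  have toK: "\<exists>c. y - c *\<^sub>R x1 \<in> K" for y
  proof -
    obtain c where "br y y5 = c *\<^sub>R y6"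
      using \<phi> by blast
    then have "y - c *\<^sub>R x1 \<in> K"
      by (simp add: K_def y6_def[symmetric])
    then show ?thesis
      by blast
  qed
  \<comment> \<open>Otherwise every bracket falls into the line of \<open>y6\<close>, since
    \<open>x1\<close> and \<open>K\<close> span the algebra.\<close>
  have "\<exists>x2\<in>K. br x1 x2 \<notin> span {y6}"
  proof (rule ccontr)
    assume *: "\<not> ?thesis"
    have "br x y \<in> span {y6}" for x y
    proof -
      obtain c where c: "x - c *\<^sub>R x1 \<in> K"
        using toK by blast
      obtain d where d: "y - d *\<^sub>R x1 \<in> K"
        using toK by blast
      have "br x y = br (x - c *\<^sub>R x1) (y - d *\<^sub>R x1) + c *\<^sub>R br x1 (y - d *\<^sub>R x1)
          - d *\<^sub>R br x1 (x - c *\<^sub>R x1)"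
        using br_anti[of x x1] by (simp add: algebra_simps)
      also have "\<dots> \<in> span {y6}"
        using K6[OF c d] * c d by (intro span_add span_diff span_scale) (auto simp: span_base span_scale)
      finally show ?thesis .
    qed
    then have "D \<subseteq> span {y6}"
      unfolding derived_algebra_def by (intro bracket_span_least) auto
    then show False
      using y5(1) y56 by blast
  qed
  then obtain x2 where x2: "x2 \<in> K" "br x1 x2 \<notin> span {y6}"
    by blast
  define x5 where "x5 = br x1 x2"
  obtain d c where x5: "x5 = d *\<^sub>R y6 + c *\<^sub>R y5"
    using brD x5_def by metis
  have c: "c \<noteq> 0"
    using x2(2) x5 by (auto simp: x5_def[symmetric] span_base span_scale)
  define x6 where "x6 = br x1 x5"
  have x6: "x6 = c *\<^sub>R y6"
    by (simp add: x6_def x5 y6c y6_def[symmetric])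
  have x6Z: "x6 \<in> Z"
    using y6Z by (simp add: x6 subspace_scale)
  note x6c = lie_center_br[OF x6Z]
  have Kx5: "br y x5 = 0" if "y \<in> K" for y
    using that by (simp add: x5 y6c K_def)
  have in6: "\<exists>w. v = w *\<^sub>R x6" if "\<exists>w. v = w *\<^sub>R y6" for v
    using that c by (auto simp: x6) (metis divide_self_if mult.commute mult_1 scaleR_scaleR
        times_divide_eq_left times_divide_eq_right)
  have x6K: "x6 \<in> K"
    by (simp add: K_def x6c)
  have span56: "span {y6, y5} = span {x6, x5}"
  proof (rule dim_2_span)
    show "dim (span {y6, y5}) = 2" "subspace (span {y6, y5})"
      using assms D56 by auto
    show "x6 \<noteq> 0"
      using c y6 by (simp add: x6)
    show "x6 \<in> span {y6, y5}" "x5 \<in> span {y6, y5}"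
      using D56 derived_algebra_br by (auto simp: x6_def x5_def)
    have "span {x6} \<subseteq> span {y6}"
      by (intro span_minimal) (auto simp: x6 span_base span_scale)
    then show "x5 \<notin> span {x6}"
      using x2(2) by (auto simp: x5_def)
  qed
  have brx: "\<exists>w v. br x y = w *\<^sub>R x6 + v *\<^sub>R x5" for x y
    using derived_algebra_br[of br x y] unfolding D56 span56 in_span_2 .
  define K' where "K' = {y \<in> K. br x1 y = 0}"
  have x5K: "x5 \<in> K"
    by (simp add: K_def x5 y6c)
  have toK': "\<exists>a b c. y - (a *\<^sub>R x1 + b *\<^sub>R x2 + c *\<^sub>R x5) \<in> K'" for y
  proof -
    obtain a where a: "y - a *\<^sub>R x1 \<in> K"
      using toK by blast
    obtain w v where wv: "br x1 (y - a *\<^sub>R x1) = w *\<^sub>R x6 + v *\<^sub>R x5"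
      using brx by blast
    have "y - (a *\<^sub>R x1 + v *\<^sub>R x2 + w *\<^sub>R x5) \<in> K"
      using a x2(1) x5K by (simp add: K_def)
    moreover have "br x1 (y - (a *\<^sub>R x1 + v *\<^sub>R x2 + w *\<^sub>R x5)) = 0"
      using wv by (simp add: x5_def[symmetric] x6_def[symmetric])
    ultimately show ?thesis
      unfolding K'_def by blast
  qed
  have out: "\<exists>n\<in>K'. n \<notin> span {x1, x2, x5, x6, e}" for e
  proof -
    have "card {x1, x2, x5, x6, e} < DIM('a)"
      using card_list_5_less dim_6 by metis
    then show ?thesis
    proof (rule exists_outside_span[rotated])
      fix y
      obtain a b c where abc: "y - (a *\<^sub>R x1 + b *\<^sub>R x2 + c *\<^sub>R x5) \<in> K'"
        using toK' by blast
      moreover have "y - (y - (a *\<^sub>R x1 + b *\<^sub>R x2 + c *\<^sub>R x5)) = a *\<^sub>R x1 + b *\<^sub>R x2 + c *\<^sub>R x5"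
        by simp
      moreover have "\<dots> \<in> span {x1, x2, x5, x6, e}"
        by (intro span_add span_scale) (auto intro: span_base)
      ultimately show "\<exists>n\<in>K'. y - n \<in> span {x1, x2, x5, x6, e}"
        by metis
    qed auto
  qed
  \<comment> \<open>The fifth generator is a placeholder, \<open>0\<close> for the choice of
    \<open>x3\<close> and \<open>x3\<close> for the choice of \<open>x4\<close>.\<close>
  obtain x3 where x3: "x3 \<in> K'" "x3 \<notin> span {x1, x2, x5, x6, 0}"
    using out by blast
  obtain x4 where x4: "x4 \<in> K'" "x4 \<notin> span {x1, x2, x5, x6, x3}"
    using out by blast
  have K5: "br x2 x5 = 0" "br x3 x5 = 0" "br x4 x5 = 0" "br x1 x3 = 0" "br x1 x4 = 0"
    using Kx5 x2(1) x3(1) x4(1) by (auto simp: K'_def)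
  obtain p where p: "br x2 x3 = p *\<^sub>R x6"
    using in6[OF K6] x2(1) x3(1) by (auto simp: K'_def)
  obtain q where q: "br x2 x4 = q *\<^sub>R x6"
    using in6[OF K6] x2(1) x4(1) by (auto simp: K'_def)
  obtain r where r: "br x3 x4 = r *\<^sub>R x6"
    using in6[OF K6] x3(1) x4(1) by (auto simp: K'_def)
  have x60: "x6 \<noteq> 0"
    using c y6 by (simp add: x6)
  have x5n: "x5 \<notin> span {x6}"
  proof -
    have "span {x6} \<subseteq> span {y6}"
      by (intro span_minimal) (auto simp: x6 span_base span_scale)
    then show ?thesis
      using x2(2) by (auto simp: x5_def)
  qed
  have ind: "independent6 x1 x2 x3 x4 x5 x6"
    unfolding independent6_def
  proof (intro allI impI)
    fix c1 c2 c3 c4 c5 c6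
    assume eq: "c1 *\<^sub>R x1 + c2 *\<^sub>R x2 + c3 *\<^sub>R x3 + c4 *\<^sub>R x4 + c5 *\<^sub>R x5 + c6 *\<^sub>R x6 = 0"
    have "c4 = 0"
      by (rule coefficient_zero[of c4 x4 "c1 *\<^sub>R x1 + c2 *\<^sub>R x2 + c3 *\<^sub>R x3 + c5 *\<^sub>R x5 + c6 *\<^sub>R x6"
            "span {x1, x2, x5, x6, x3}"])
        (use eq x4(2) in \<open>auto simp: algebra_simps intro!: span_add span_scale intro: span_base\<close>)
    moreover have "c3 = 0"
      by (rule coefficient_zero[of c3 x3 "c1 *\<^sub>R x1 + c2 *\<^sub>R x2 + c5 *\<^sub>R x5 + c6 *\<^sub>R x6"
            "span {x1, x2, x5, x6, 0}"])
        (use eq x3(2) \<open>c4 = 0\<close> in \<open>auto simp: algebra_simps intro!: span_add span_scale intro: span_base\<close>)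
    moreover have "c5 *\<^sub>R x6 + c2 *\<^sub>R x5 = 0"
      using arg_cong[OF eq, of "br x1"] calculation
      by (simp add: x5_def[symmetric] x6_def[symmetric] x6c add.commute)
    then have "c5 = 0 \<and> c2 = 0"
      by (rule independent_2[OF x60 x5n])
    moreover have "br x1 x5 = x6"
      by (simp add: x6_def)
    then have "c1 *\<^sub>R x6 = 0"
      using arg_cong[OF eq, of "\<lambda>x. br x x5"] calculation by (simp add: x6c)
    then have "c1 = 0"
      using x60 by simp
    ultimately show "c1 = 0 \<and> c2 = 0 \<and> c3 = 0 \<and> c4 = 0 \<and> c5 = 0 \<and> c6 = 0"
      using eq x60 by simp
  qed
  have x15: "br x1 x2 = x5" "br x1 x5 = x6"
    by (simp_all add: x5_def x6_def)
  have "p \<noteq> 0 \<or> q \<noteq> 0 \<or> r \<noteq> 0"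
  proof (rule ccontr)
    assume "\<not> ?thesis"
    then have zero: "br x2 x3 = 0" "br x2 x4 = 0" "br x3 x4 = 0"
      using p q r by simp_all
    show False
      by (rule abelian_hyperplane[OF ind])
        (use zero in \<open>auto simp: K5 x15 x6c br_swap_0[OF K5(3)] intro: span_base span_zero\<close>)
  qed
  moreover have "lie_isomorphic br (fam_12_15 p q r)"
    by (intro basisI[OF lie_algebra_families(2) ind])
      (simp_all add: comb_simps K5 x15 x6c p q r)
  ultimately show ?thesis
    by blast
qed

end

subsection \<open>Derived algebra of dimension three\<close>

lemma line_swap:
  assumes "y \<notin> span {x}" "x \<noteq> 0"
  shows "y \<noteq> 0 \<and> x \<notin> span {y}"
proof
  show "y \<noteq> 0"
    using assms(1) span_zero by metis
  show "x \<notin> span {y}"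
  proof
    assume "x \<in> span {y}"
    then obtain c where c: "x = c *\<^sub>R y"
      unfolding span_singleton by blast
    then have "y = inverse c *\<^sub>R x"
      using assms(2) by auto
    then show False
      using assms(1) unfolding span_singleton by blast
  qed
qed

context nilpotent_6
begin

lemma derived_subset6:
  assumes ind: "independent6 x1 x2 x3 x4 x5 x6" and S: "subspace S"
    and in_S: "br x1 x2 \<in> S" "br x1 x3 \<in> S" "br x1 x4 \<in> S" "br x1 x5 \<in> S" "br x1 x6 \<in> S"
      "br x2 x3 \<in> S" "br x2 x4 \<in> S" "br x2 x5 \<in> S" "br x2 x6 \<in> S" "br x3 x4 \<in> S"
      "br x3 x5 \<in> S" "br x3 x6 \<in> S" "br x4 x5 \<in> S" "br x4 x6 \<in> S" "br x5 x6 \<in> S"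
  shows "D \<subseteq> S"
  unfolding derived_algebra_def
proof (rule bracket_span_least[OF S])
  fix x y
  have flip: "br b a \<in> S" if "br a b \<in> S" for a b
    using that S by (subst br_anti) (simp add: subspace_neg)
  obtain c1 c2 c3 c4 c5 c6 where
    x: "x = c1 *\<^sub>R x1 + c2 *\<^sub>R x2 + c3 *\<^sub>R x3 + c4 *\<^sub>R x4 + c5 *\<^sub>R x5 + c6 *\<^sub>R x6"
    by (rule independent6_combination[OF ind dim_6])
  obtain d1 d2 d3 d4 d5 d6 where
    y: "y = d1 *\<^sub>R x1 + d2 *\<^sub>R x2 + d3 *\<^sub>R x3 + d4 *\<^sub>R x4 + d5 *\<^sub>R x5 + d6 *\<^sub>R x6"
    by (rule independent6_combination[OF ind dim_6])
  show "br x y \<in> S"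
    unfolding x y
    by (auto intro!: subspace_add[OF S] subspace_scale[OF S] simp: in_S in_S[THEN flip] subspace_0[OF S])
qed

text \<open>Condition (3) leaves no room for \<open>D\<close> plus \<open>Z\<close> to exceed
  \<open>D\<close>.\<close>

lemma center_subset_derived:
  assumes "dim D = 3"
  shows "Z \<subseteq> D"
proof -
  let ?S = "{x + z | x z. x \<in> D \<and> z \<in> Z}"
  have "D \<subseteq> ?S"
    using subspace_0[OF subspace_lie_center] by force
  then have "D = ?S"
    by (intro subspace_dim_equal subspace_sums) (use dim_D_Z_le assms in auto)
  moreover have "Z \<subseteq> ?S"
    using subspace_0[OF subspace_derived_algebra[of br]] by force
  ultimately show ?thesis
    by simp
qed

text \<open>Modulo \<open>W\<close> the bracket is an alternating form with values in the line
  \<open>D\<close>/\<open>W\<close>. Here \<open>p\<close>, \<open>q\<close> are not orthogonal for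
  it, and \<open>r\<close> is orthogonal to both and chosen outside \<open>D\<close>.\<close>

lemma frame:
  assumes d: "dim D = 3" and W: "subspace W" "W \<subseteq> D" "dim W = 2" and DW: "bracket_span br UNIV D \<subseteq> W"
  obtains p q r where "br p q \<notin> W" "br p r \<in> W" "br q r \<in> W" "r \<notin> D"
proof -
  have "\<not> D \<subseteq> W"
    using dim_subset[of D W] d W(3) by auto
  then have "\<exists>p q. br p q \<notin> W"
    unfolding derived_algebra_def using bracket_span_least[OF W(1)] by blast
  then obtain p q where pq: "br p q \<notin> W"
    by blast
  define x4 where "x4 = br p q"
  have x4: "x4 \<notin> W" "x4 \<in> D"
    using pq by (simp_all add: x4_def derived_algebra_br)
  obtain w1 w2 where w: "w1 \<in> W" "w2 \<in> W" "w1 \<noteq> 0" "w2 \<notin> span {w1}" "W = span {w1, w2}"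
    using dim_2_basis[OF W(1,3)] by blast
  have Dspan: "span {x4, w1, w2} = D"
  proof (rule dim_3_combination)
    fix a b c assume eq: "a *\<^sub>R x4 + b *\<^sub>R w1 + c *\<^sub>R w2 = 0"
    have "a = 0"
      by (rule coefficient_zero[of a x4 "b *\<^sub>R w1 + c *\<^sub>R w2" W])
        (use eq x4 W(1) w(1,2) in \<open>auto simp: add.assoc subspace_add subspace_scale\<close>)
    then show "a = 0 \<and> b = 0 \<and> c = 0"
      using eq independent_2[OF w(3,4)] by simp
  qed (use d x4 w W(2) in auto)
  have brD: "\<exists>a w. w \<in> W \<and> br x y = a *\<^sub>R x4 + w" for x y
  proof -
    have "br x y \<in> span {x4, w1, w2}"
      using Dspan derived_algebra_br by blast
    then obtain a b c where "br x y = a *\<^sub>R x4 + (b *\<^sub>R w1 + c *\<^sub>R w2)"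
      by (auto simp: in_span_3 add.assoc)
    then show ?thesis
      using W(1) w(1,2) by (metis subspace_add subspace_scale)
  qed
  have "card {p, q, x4, w1, w2} < DIM('a)"
    using card_list_5_less dim_6 by metis
  then obtain r where r: "r \<in> {n. br p n \<in> W \<and> br q n \<in> W}" "r \<notin> span {p, q, x4, w1, w2}"
  proof (rule exists_outside_span[rotated])
    fix y
    obtain a w where 1: "w \<in> W" "br p y = a *\<^sub>R x4 + w"
      using brD by blast
    obtain b v where 2: "v \<in> W" "br q y = b *\<^sub>R x4 + v"
      using brD by blast
    have eqs: "br p (y - (a *\<^sub>R q - b *\<^sub>R p)) = w" "br q (y - (a *\<^sub>R q - b *\<^sub>R p)) = v"
      using 1 2 br_anti[of q p] by (simp_all add: x4_def[symmetric])
    have "y - (a *\<^sub>R q - b *\<^sub>R p) \<in> {n. br p n \<in> W \<and> br q n \<in> W}"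
      by (simp only: mem_Collect_eq eqs 1 2 simp_thms)
    moreover have "y - (y - (a *\<^sub>R q - b *\<^sub>R p)) \<in> span {p, q, x4, w1, w2}"
      by (simp add: span_diff span_scale span_base)
    ultimately show "\<exists>n\<in>{n. br p n \<in> W \<and> br q n \<in> W}. y - n \<in> span {p, q, x4, w1, w2}"
      by blast
  qed auto
  have "D \<subseteq> span {p, q, x4, w1, w2}"
    unfolding Dspan[symmetric] by (rule span_mono) auto
  then show ?thesis
    using that pq r by blast
qed

text \<open>Modulo \<open>W\<close>, \<open>ad p\<close> sees only \<open>c2\<close> and
  \<open>ad q\<close> only \<open>c1\<close>; then \<open>c3\<close> is read off modulo
  \<open>D\<close> and \<open>c4\<close> modulo \<open>W\<close>.\<close>

lemma frame_independent:
  assumes W: "subspace W" "W \<subseteq> D" and DW: "bracket_span br UNIV D \<subseteq> W"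
    and f: "br p q \<notin> W" "br p r \<in> W" "br q r \<in> W" "r \<notin> D"
    and w: "w1 \<in> W" "w2 \<in> W" "w1 \<noteq> 0" "w2 \<notin> span {w1}"
  shows "independent6 p q r (br p q) w1 w2"
  unfolding independent6_def
proof (intro allI impI)
  fix c1 c2 c3 c4 c5 c6
  assume eq: "c1 *\<^sub>R p + c2 *\<^sub>R q + c3 *\<^sub>R r + c4 *\<^sub>R br p q + c5 *\<^sub>R w1 + c6 *\<^sub>R w2 = 0"
  have inW: "br x d \<in> W" if "d \<in> D" for x d
    using DW bracket_spanI[of x UNIV d D br] that by blast
  have wD: "w1 \<in> D" "w2 \<in> D" "br p q \<in> D"
    using w W(2) by (auto simp: derived_algebra_br)
  note closed = subspace_add[OF W(1)] subspace_scale[OF W(1)]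
  have "c2 *\<^sub>R br p q + (c3 *\<^sub>R br p r + c4 *\<^sub>R br p (br p q) + c5 *\<^sub>R br p w1 + c6 *\<^sub>R br p w2) = 0"
    using arg_cong[OF eq, of "br p"] by (simp add: add.assoc)
  then have "c2 = 0"
    by (rule coefficient_zero[OF _ _ W(1) f(1)]) (intro closed f inW wD)
  moreover have "(- c1) *\<^sub>R br p q
      + (c3 *\<^sub>R br q r + c4 *\<^sub>R br q (br p q) + c5 *\<^sub>R br q w1 + c6 *\<^sub>R br q w2) = 0"
    using arg_cong[OF eq, of "br q"] br_anti[of q p] by (simp add: add.assoc)
  then have "- c1 = 0"
    by (rule coefficient_zero[OF _ _ W(1) f(1)]) (intro closed f inW wD)
  ultimately have c12: "c1 = 0" "c2 = 0"
    by simp_all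
  have c3: "c3 = 0"
    by (rule coefficient_zero[of c3 r "c4 *\<^sub>R br p q + c5 *\<^sub>R w1 + c6 *\<^sub>R w2" D])
      (use eq c12 f(4) wD in \<open>auto simp: add.assoc intro!: subspace_add subspace_scale\<close>)
  have "c4 = 0"
    by (rule coefficient_zero[of c4 "br p q" "c5 *\<^sub>R w1 + c6 *\<^sub>R w2" W])
      (use eq c12 c3 f(1) w W(1) in \<open>auto simp: add.assoc intro!: closed\<close>)
  then show "c1 = 0 \<and> c2 = 0 \<and> c3 = 0 \<and> c4 = 0 \<and> c5 = 0 \<and> c6 = 0"
    using c12 c3 eq independent_2[OF w(3,4)] by simp
qed

text \<open>The frame is taken with \<open>Z\<close> as \<open>W\<close>. Since
  \<open>x4 = br p q\<close> commutes with \<open>r\<close> and with \<open>D\<close>, the image of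
  \<open>ad x4\<close> is spanned by \<open>a\<close> and \<open>b\<close>; the cases are its rank,
  which is not zero as \<open>x4\<close> is not central.\<close>

lemma case_dim_3_center_2:
  assumes d: "dim D = 3" and z: "dim Z = 2"
  shows "\<exists>m\<in>set models. lie_isomorphic br m"
proof -
  have ZD: "Z \<subseteq> D"
    by (rule center_subset_derived[OF d])
  obtain z1 z2 where zz: "z1 \<in> Z" "z2 \<in> Z" "z1 \<noteq> 0" "z2 \<notin> span {z1}" "Z = span {z1, z2}"
    using dim_2_basis[OF _ z] by auto
  \<comment> \<open>\<open>D\<close> is a line modulo \<open>Z\<close>, so \<open>ad x\<close> acts
    on it there by an eigenvalue, which is 0.\<close>
  have DZ: "bracket_span br UNIV D \<subseteq> Z"
  proof (rule bracket_span_least)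
    fix x y assume y: "y \<in> D"
    show "br x y \<in> Z"
    proof (cases "y \<in> Z")
      case True
      then show ?thesis
        using lie_center_br subspace_0[OF subspace_lie_center] by simp
    next
      case False
      have "span {y, z1, z2} = D"
      proof (rule dim_3_combination)
        fix a b c assume eq: "a *\<^sub>R y + b *\<^sub>R z1 + c *\<^sub>R z2 = 0"
        have "a = 0"
          by (rule coefficient_zero[of a y "b *\<^sub>R z1 + c *\<^sub>R z2" Z])
            (use eq False zz(1,2) in \<open>auto simp: add.assoc intro!: subspace_add subspace_scale\<close>)
        then show "a = 0 \<and> b = 0 \<and> c = 0"
          using eq independent_2[OF zz(3,4)] by simp
      qed (use d y zz ZD in auto)
      then obtain a b c where abc: "br x y = a *\<^sub>R y + b *\<^sub>R z1 + c *\<^sub>R z2"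
        using derived_algebra_br[of br x y] in_span_3 by metis
      have "br x y - a *\<^sub>R y \<in> Z"
        using zz(1,2) by (simp add: abc subspace_add subspace_scale)
      moreover from this have "a = 0"
        by (rule eigenvalue_mod[OF subspace_lie_center _ _ False])
          (auto simp: lie_center_br subspace_0)
      ultimately show ?thesis
        by simp
    qed
  qed auto
  have brDZ: "br x y \<in> Z" if "y \<in> D" for x y
    using DZ bracket_spanI[of x UNIV y D br] that by blast
  define good where "good p q r \<longleftrightarrow> br p q \<notin> Z \<and> br p r \<in> Z \<and> br q r \<in> Z \<and> r \<notin> D" for p q r
  have ind: "independent6 p q r (br p q) w1 w2"
    if "good p q r" "w1 \<in> Z" "w2 \<in> Z" "w1 \<noteq> 0" "w2 \<notin> span {w1}" for p q r w1 w2
    by (rule frame_independent[OF subspace_lie_center ZD DZ]) (use that in \<open>auto simp: good_def\<close>)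
  have comm: "br r (br p q) = 0" if "good p q r" for p q r
  proof -
    have "br p r \<in> Z" "br q r \<in> Z"
      using that by (simp_all add: good_def)
    then have "br r p \<in> Z" "br r q \<in> Z"
      using br_anti[of r p] br_anti[of r q] by (simp_all add: subspace_neg)
    then show ?thesis
      using br_br_left[of r p q] by (simp add: lie_center_br)
  qed
  have Zspan: "Z = span {w1, w2}" if "w1 \<in> Z" "w2 \<in> Z" "w1 \<noteq> 0" "w2 \<notin> span {w1}" for w1 w2
    by (rule dim_2_span[OF subspace_lie_center z that])
  \<comment> \<open>The rank one case, normalised so that \<open>q\<close> commutes with
    \<open>br p q\<close>. The position of \<open>br q r\<close> relative to the image line
    separates two families.\<close>
  have rank_1: ?thesis
    if g: "good p q r" and b: "br q (br p q) = 0" and a: "br p (br p q) \<noteq> 0" for p q r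
  proof -
    define x4 x6 where "x4 = br p q" and "x6 = br p x4"
    have x6: "x6 \<in> Z" "x6 \<noteq> 0"
      using a brDZ[OF derived_algebra_br] by (simp_all add: x6_def x4_def)
    have pqr: "br p r \<in> Z" "br q r \<in> Z" "br p x4 = x6" "br q x4 = 0" "br r x4 = 0"
      using g b comm[OF g] by (simp_all add: good_def x4_def x6_def)
    note x6c = lie_center_br[OF x6(1)]
    show ?thesis
    proof (cases "br q r \<in> span {x6}")
      case False
      define x5 where "x5 = br q r"
      have x5: "x5 \<in> Z" "x5 \<notin> span {x6}"
        using False pqr by (simp_all add: x5_def)
      note x5c = lie_center_br[OF x5(1)]
      have n: "x6 \<notin> span {x5}" "x5 \<noteq> 0"
        using line_swap[OF x5(2) x6(2)] by simp_all
      have i: "independent6 p q r x4 x5 x6"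
        unfolding x4_def by (rule ind[OF g]) (use x5 x6 n in auto)
      obtain s t where st: "br p r = s *\<^sub>R x5 + t *\<^sub>R x6"
        using pqr(1) Zspan[OF x5(1) x6(1) n(2,1)] in_span_2 by metis
      have "br p q = x4" "br q r = x5"
        by (simp_all add: x4_def x5_def)
      then have "lie_isomorphic br (fam_12_23_14 s t)"
        by (intro basisI[OF lie_algebra_families(4) i]) (simp_all add: comb_simps pqr st x5c x6c)
      then show ?thesis
        using fam_12_23_14_model lie_isomorphic_trans by blast
    next
      case True
      then obtain \<delta> where \<delta>: "br q r = \<delta> *\<^sub>R x6"
        by (auto simp: span_singleton)
      define x5 where "x5 = br p r"
      have x5Z: "x5 \<in> Z"
        using pqr by (simp add: x5_def)
      note x5c = lie_center_br[OF x5Z]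
      \<comment> \<open>Otherwise all brackets lie in \<open>span {x4, x6}\<close>, against
        \<open>dim D = 3\<close>.\<close>
      have "x5 \<notin> span {x6}"
      proof
        assume s5: "x5 \<in> span {x6}"
        have "\<not> Z \<subseteq> span {x6}"
        proof
          assume "Z \<subseteq> span {x6}"
          then have "dim Z \<le> 1"
            using dim_le_card[of Z "{x6}"] by simp
          then show False
            using z by simp
        qed
        then obtain w where w: "w \<in> Z" "w \<notin> span {x6}"
          by blast
        have "independent6 p q r x4 x6 w"
          unfolding x4_def by (rule ind[OF g]) (use w x6 in auto)
        then have "D \<subseteq> span {x4, x6}"
        proof (rule derived_subset6)
          have "x5 \<in> span {x4, x6}"
            using s5 span_mono[of "{x6}" "{x4, x6}"] by blast
          then show "br p r \<in> span {x4, x6}"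
            by (simp add: x5_def)
          show "br p q \<in> span {x4, x6}"
            by (simp add: x4_def span_base)
        qed (auto simp: pqr \<delta> x6c lie_center_br[OF w(1)] span_base span_scale span_zero)
        then have "dim D \<le> 2"
          using dim_subset dim_span_2_le order_trans by blast
        then show False
          using d by simp
      qed
      then have n: "x6 \<notin> span {x5}" "x5 \<noteq> 0"
        using line_swap[OF _ x6(2)] by simp_all
      have i: "independent6 p q r x4 x5 x6"
        unfolding x4_def by (rule ind[OF g]) (use x5Z x6 n in auto)
      have x45: "br p q = x4" "br p r = x5"
        by (simp_all add: x4_def x5_def)
      have "\<delta> \<noteq> 0"
      proof
        assume "\<delta> = 0"
        show False
          by (rule abelian_hyperplane[OF i])
            (auto simp: \<delta> \<open>\<delta> = 0\<close> pqr x45 x5c x6c span_base span_zero)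
      qed
      moreover have "lie_isomorphic br (fam_12_13_14_23 \<delta>)"
        by (intro basisI[OF lie_algebra_families(5) i]) (simp_all add: comb_simps pqr x45 \<delta> x5c x6c)
      ultimately show ?thesis
        using fam_12_13_14_23_model lie_isomorphic_trans by blast
    qed
  qed
  obtain p q r where g: "good p q r"
    by (rule frame[OF d subspace_lie_center ZD z DZ]) (simp add: good_def)
  define x4 a b where "x4 = br p q" and "a = br p x4" and "b = br q x4"
  have ab: "a \<in> Z" "b \<in> Z" and pqr: "br p r \<in> Z" "br q r \<in> Z"
    using g brDZ[OF derived_algebra_br] by (simp_all add: a_def b_def x4_def good_def)
  have rx4: "br r x4 = 0"
    using comm[OF g] by (simp add: x4_def)
  have central: "l *\<^sub>R x4 + m *\<^sub>R r \<in> Z"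
    if "br p (l *\<^sub>R x4 + m *\<^sub>R r) = 0" "br q (l *\<^sub>R x4 + m *\<^sub>R r) = 0" for l m
  proof (rule centerI, rule br_swap_0)
    fix y
    obtain c1 c2 c3 c4 c5 c6 where
      y: "y = c1 *\<^sub>R p + c2 *\<^sub>R q + c3 *\<^sub>R r + c4 *\<^sub>R br p q + c5 *\<^sub>R z1 + c6 *\<^sub>R z2"
      by (rule independent6_combination[OF ind[OF g zz(1-4)] dim_6])
    have "br y (l *\<^sub>R x4 + m *\<^sub>R r) =
        c1 *\<^sub>R br p (l *\<^sub>R x4 + m *\<^sub>R r) + c2 *\<^sub>R br q (l *\<^sub>R x4 + m *\<^sub>R r)"
      using lie_center_br[OF zz(1)] lie_center_br[OF zz(2)] rx4 br_swap_0[OF rx4]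
      by (simp add: y x4_def[symmetric] algebra_simps)
    then show "br y (l *\<^sub>R x4 + m *\<^sub>R r) = 0"
      using that by simp
  qed
  consider "a = 0" | "a \<noteq> 0" "b \<in> span {a}" | "a \<noteq> 0" "b \<notin> span {a}"
    by blast
  then show ?thesis
  proof cases
    case 1
    have "b \<noteq> 0"
    proof
      assume "b = 0"
      then have "1 *\<^sub>R x4 + 0 *\<^sub>R r \<in> Z"
        using 1 by (intro central) (simp_all add: a_def b_def)
      then show False
        using g by (simp add: good_def x4_def)
    qed
    moreover have qp: "br q (- p) = x4"
      using br_anti[of q p] by (simp add: x4_def)
    moreover have "good q (- p) r"
      using g qp by (simp add: good_def x4_def subspace_neg)
    ultimately show ?thesis
      using 1 by (intro rank_1[of q "- p" r]) (simp_all add: a_def b_def)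
  next
    case 2
    then obtain l where l: "b = l *\<^sub>R a"
      by (auto simp: span_singleton)
    have pq: "br p (q - l *\<^sub>R p) = x4"
      by (simp add: x4_def)
    have "good p (q - l *\<^sub>R p) r"
      using g pq by (simp add: good_def x4_def subspace_diff subspace_scale)
    then show ?thesis
      using 2 l by (intro rank_1[of p "q - l *\<^sub>R p" r]) (simp_all add: a_def b_def x4_def)
  next
    case 3
    have Zab: "Z = span {a, b}"
      by (rule Zspan[OF ab 3])
    \<comment> \<open>If bracketing with \<open>r\<close> were proportional to bracketing with
      \<open>x4\<close>, some \<open>r - l *\<^sub>R x4\<close> would be central, and
      \<open>r\<close> would lie in \<open>D\<close>.\<close>
    have "\<exists>y\<in>{p, q, p + q}. br y r \<notin> span {br y x4}"
    proof (rule ccontr)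
      assume *: "\<not> ?thesis"
      have "\<exists>l. br p r = l *\<^sub>R br p x4 \<and> br q r = l *\<^sub>R br q x4"
        by (rule proportional[where A = "\<lambda>y. br y x4" and C = "\<lambda>y. br y r", OF linear_br_right linear_br_right])
          (use 3 * in \<open>auto simp: a_def b_def\<close>)
      then obtain l where "br p r = l *\<^sub>R br p x4" "br q r = l *\<^sub>R br q x4"
        by blast
      then have rZ: "(- l) *\<^sub>R x4 + 1 *\<^sub>R r \<in> Z"
        by (intro central) simp_all
      have "l *\<^sub>R x4 \<in> D"
        by (simp add: x4_def derived_algebra_br subspace_scale)
      then have "((- l) *\<^sub>R x4 + 1 *\<^sub>R r) + l *\<^sub>R x4 \<in> D"
        by (rule subspace_add[OF subspace_derived_algebra subsetD[OF ZD rZ]])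
      then show False
        using g by (simp add: good_def)
    qed
    then obtain y where y: "y \<in> {p, q, p + q}" "br y r \<notin> span {br y x4}"
      by blast
    obtain y1 y2 where y12: "y = y1 *\<^sub>R p + y2 *\<^sub>R q" "y1 \<noteq> 0 \<or> y2 \<noteq> 0"
    proof -
      have "p = 1 *\<^sub>R p + 0 *\<^sub>R q" "q = 0 *\<^sub>R p + 1 *\<^sub>R q" "p + q = 1 *\<^sub>R p + 1 *\<^sub>R q"
        by simp_all
      then show ?thesis
        using y(1) that by (metis insertE singletonD zero_neq_one)
    qed
    have yr: "br y r \<in> Z"
      using pqr by (simp add: y12 subspace_add subspace_scale)
    then obtain s t where st: "br y r = s *\<^sub>R a + t *\<^sub>R b"
      unfolding Zab in_span_2 by blast
    \<comment> \<open>As \<open>a\<close>, \<open>b\<close> is a basis of \<open>Z\<close>,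
      bracketing with \<open>x4\<close> maps the plane of \<open>p\<close>, \<open>q\<close> onto
      \<open>Z\<close>; \<open>x2\<close> is the preimage of \<open>br y r\<close>.\<close>
    define x2 where "x2 = s *\<^sub>R p + t *\<^sub>R q"
    have x2x4: "br x2 x4 = br y r"
      by (simp add: x2_def st a_def b_def)
    have yx4: "br y x4 = y1 *\<^sub>R a + y2 *\<^sub>R b"
      by (simp add: y12 a_def b_def)
    \<comment> \<open>The determinant of \<open>y\<close>, \<open>x2\<close> relative to
      \<open>p\<close>, \<open>q\<close>. Were it zero, \<open>x2\<close> would be a multiple of
      \<open>y\<close>, and \<open>br y r\<close> one of \<open>br y x4\<close>.\<close>
    define \<kappa> where "\<kappa> = y1 * t - y2 * s"
    have yx2: "br y x2 = \<kappa> *\<^sub>R x4"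
      using br_anti[of q p] by (simp add: y12 x2_def \<kappa>_def x4_def[symmetric] algebra_simps)
    have \<kappa>: "\<kappa> \<noteq> 0"
    proof
      assume "\<kappa> = 0"
      then have k: "y1 * t = y2 * s"
        by (simp add: \<kappa>_def)
      have "\<exists>c. s = c * y1 \<and> t = c * y2"
      proof (cases "y1 = 0")
        case True
        then show ?thesis
          using y12(2) k by (intro exI[of _ "t / y2"]) simp
      next
        case False
        then show ?thesis
          using k by (intro exI[of _ "s / y1"]) (simp add: field_simps)
      qed
      then obtain c where "s = c * y1" "t = c * y2"
        by blast
      then have "br y r = c *\<^sub>R br y x4"
        by (simp add: st yx4 algebra_simps)
      then show False
        using y(2) by (auto simp: span_singleton)
    qed
    \<comment> \<open>The factor compensates \<open>br y x2 = \<kappa> *\<^sub>R x4\<close>, so that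
      \<open>br y r' = br x2 (br y x2)\<close>.\<close>
    define r' where "r' = \<kappa> *\<^sub>R r"
    have x4Z: "br y x2 \<notin> Z"
    proof
      assume "br y x2 \<in> Z"
      then have "inverse \<kappa> *\<^sub>R br y x2 \<in> Z"
        by (simp add: subspace_scale)
      then show False
        using \<kappa> g by (simp add: yx2 good_def x4_def)
    qed
    have g': "good y x2 r'"
    proof -
      have "br x2 r \<in> Z"
        using pqr by (simp add: x2_def subspace_add subspace_scale)
      moreover have "r' \<notin> D"
      proof
        assume "r' \<in> D"
        then have "inverse \<kappa> *\<^sub>R r' \<in> D"
          by (simp add: subspace_scale)
        then show False
          using \<kappa> g by (simp add: r'_def good_def)
      qed
      ultimately show ?thesis
        using yr x4Z by (simp add: good_def r'_def subspace_scale)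
    qed
    define x5 x6 where "x5 = br y (br y x2)" and "x6 = br x2 (br y x2)"
    have x56: "x5 \<in> Z" "x6 \<in> Z"
      using brDZ[OF derived_algebra_br] by (simp_all add: x5_def x6_def)
    note c56 = lie_center_br[OF x56(1)] lie_center_br[OF x56(2)]
    have x5: "x5 = \<kappa> *\<^sub>R br y x4" and x6: "x6 = \<kappa> *\<^sub>R br y r"
      by (simp_all add: x5_def x6_def yx2 x2x4)
    have n5: "x5 \<noteq> 0"
      using \<kappa> y12(2) independent_2[OF 3, of y1 y2] by (auto simp: x5 yx4)
    have n6: "x6 \<notin> span {x5}"
    proof
      assume "x6 \<in> span {x5}"
      then obtain e where "x6 = e *\<^sub>R x5"
        unfolding span_singleton by blast
      then have "\<kappa> *\<^sub>R br y r = \<kappa> *\<^sub>R (e *\<^sub>R br y x4)"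
        by (simp add: x5 x6 mult.commute)
      then have "br y r = e *\<^sub>R br y x4"
        using \<kappa> by (simp del: scaleR_scaleR)
      then show False
        using y(2) by (simp add: span_base span_scale)
    qed
    have i: "independent6 y x2 r' (br y x2) x5 x6"
      by (rule ind[OF g' x56 n5 n6])
    obtain \<Delta> v where \<Delta>: "br x2 r' = \<Delta> *\<^sub>R x5 + v *\<^sub>R x6"
      using g' Zspan[OF x56 n5 n6] in_span_2 unfolding good_def by metis
    have yr': "br y r' = x6"
      by (simp add: r'_def x6)
    have "lie_isomorphic br (fam_twist \<Delta> v)"
      by (intro basisI[OF lie_algebra_families(3) i])
        (simp_all add: comb_simps c56 \<Delta> yr' comm[OF g'] x5_def[symmetric] x6_def[symmetric])
    then show ?thesis
      using fam_twist_model lie_isomorphic_trans by blast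
  qed
qed

text \<open>Condition (4) keeps \<open>D3\<close> nonzero, so \<open>D\<close>, \<open>D2\<close>,
  \<open>D3\<close> have dimensions 3, 2, 1 and \<open>D2\<close> serves as \<open>W\<close> in the
  frame. The basis is a chain \<open>x2\<close>, \<open>x4\<close>, \<open>x5\<close>,
  \<open>x6\<close> under \<open>ad x1\<close>, completed by an \<open>x3\<close> commuting with
  \<open>x1\<close>.\<close>

lemma case_dim_3_center_1:
  assumes d: "dim D = 3" and z: "dim Z = 1"
  shows "\<exists>m\<in>set models. lie_isomorphic br m"
proof -
  define D2 D3 where "D2 = bracket_span br UNIV D" and "D3 = bracket_span br UNIV D2"
  have sub: "subspace D2" "subspace D3"
    by (simp_all add: D2_def D3_def)
  have D2D: "D2 \<subseteq> D"
    using bracket_D by (simp add: D2_def)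
  have D32: "D3 \<subseteq> D2"
    unfolding D3_def by (subst (2) D2_def) (rule bracket_span_mono, use D2D in auto)
  have D3: "D3 \<noteq> {0}"
    using four d z by (simp add: four_conditions_def D2_def D3_def)
  have "dim D3 \<noteq> 0"
    using D3 sub by (auto simp: subspace_0)
  moreover have "dim D2 < dim D"
    unfolding D2_def by (rule dim_bracket_less) (use d bracket_D in auto)
  moreover have "D2 \<noteq> {0}"
    using D3 D32 subspace_0[OF sub(2)] by auto
  then have "dim D3 < dim D2"
    unfolding D3_def by (rule dim_bracket_less[OF sub(1)]) (use D32 D3_def in auto)
  ultimately have dims: "dim D2 = 2" "dim D3 = 1"
    using d by linarith+
  have D3Z: "D3 \<subseteq> Z"
  proof (rule central_bracket_zero[OF sub(2) dims(2)])
    show "bracket_span br UNIV D3 \<subseteq> D3"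
      by (subst (2) D3_def) (rule bracket_span_mono, use D32 in auto)
  qed
  have brD: "br x y \<in> D2" if "y \<in> D" for x y
    using that by (simp add: D2_def bracket_spanI)
  have brD2: "br x y \<in> D3" if "y \<in> D2" for x y
    using that by (simp add: D3_def bracket_spanI)
  have flip2: "br y x \<in> D2" if "br x y \<in> D2" for x y
    using that sub by (subst br_anti) (simp add: subspace_neg)
  have brD2': "br y x \<in> Z" if "y \<in> D2" for x y
    using brD2[OF that, of x] D3Z by (subst br_anti) (auto intro: subspace_neg)
  \<comment> \<open>\<open>br w x\<close> is central for \<open>w\<close> in \<open>D2\<close>, so
    by Jacobi \<open>w\<close> commutes with all brackets.\<close>
  have abel: "br w e = 0" if w: "w \<in> D2" and e: "e \<in> D" for w e
  proof -
    have "D \<subseteq> {e. br w e = 0}"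
      unfolding derived_algebra_def
    proof (rule bracket_span_least)
      fix x y
      have "br (br w x) y = 0" "br x (br w y) = 0"
        using brD2'[OF w] by (simp_all add: lie_center_br)
      then show "br x y \<in> {e. br w e = 0}"
        using br_br_left[of w x y] by simp
    qed (auto simp: subspace_def)
    then show ?thesis
      using e by blast
  qed
  obtain w1 w2 where w: "w1 \<in> D2" "w2 \<in> D2" "w1 \<noteq> 0" "w2 \<notin> span {w1}"
    using dim_2_basis[OF sub(1) dims(1)] by metis
  define good where "good p q r \<longleftrightarrow> br p q \<notin> D2 \<and> br p r \<in> D2 \<and> br q r \<in> D2 \<and> r \<notin> D" for p q r
  have ind: "independent6 p q r (br p q) w1 w2"
    if "good p q r" "w1 \<in> D2" "w2 \<in> D2" "w1 \<noteq> 0" "w2 \<notin> span {w1}" for p q r w1 w2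
    by (rule frame_independent[OF sub(1) D2D])
      (use that D2_def in \<open>auto simp: good_def\<close>)
  have r4: "br r (br p q) \<in> D3" if g: "good p q r" for p q r
  proof -
    have "br r p \<in> D2" "br r q \<in> D2"
      using g flip2 by (simp_all add: good_def)
    then have "br q (br r p) \<in> D3" "br p (br r q) \<in> D3"
      using brD2 by simp_all
    moreover have "br r (br p q) = br p (br r q) - br q (br r p)"
      using br_br_left[of r p q] br_anti[of "br r p" q] by (simp add: algebra_simps)
    ultimately show ?thesis
      using sub by (simp add: subspace_diff)
  qed
  obtain p q r where g: "good p q r"
  proof (rule frame[OF d sub(1) D2D dims(1)])
    show "bracket_span br UNIV D \<subseteq> D2"
      by (simp add: D2_def)
  qed (simp add: good_def)
  define x4 where "x4 = br p q"
  have x4D: "x4 \<in> D"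
    by (simp add: x4_def derived_algebra_br)
  \<comment> \<open>Otherwise every bracket with \<open>x4\<close>, and hence with any element of
    \<open>D\<close>, lies in \<open>D3\<close>, and \<open>D2\<close> collapses into
    \<open>D3\<close>.\<close>
  have "\<not> (br p x4 \<in> D3 \<and> br q x4 \<in> D3)"
  proof
    assume *: "br p x4 \<in> D3 \<and> br q x4 \<in> D3"
    have x4y: "br x4 y \<in> D3" for y
    proof -
      obtain c1 c2 c3 c4 c5 c6 where
        y: "y = c1 *\<^sub>R p + c2 *\<^sub>R q + c3 *\<^sub>R r + c4 *\<^sub>R br p q + c5 *\<^sub>R w1 + c6 *\<^sub>R w2"
        by (rule independent6_combination[OF ind[OF g w] dim_6])
      have "br y x4 = c1 *\<^sub>R br p x4 + c2 *\<^sub>R br q x4 + c3 *\<^sub>R br r x4"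
        using abel[OF w(1) x4D] abel[OF w(2) x4D] by (simp add: y x4_def[symmetric])
      also have "\<dots> \<in> D3"
        using * r4[OF g] sub by (simp add: x4_def[symmetric] subspace_add subspace_scale)
      finally show ?thesis
        using sub by (subst br_anti) (simp add: subspace_neg)
    qed
    have "D2 \<subseteq> D3"
      unfolding D2_def
    proof (rule bracket_span_least[OF sub(2)])
      fix y e assume e: "e \<in> D"
      have "D \<subseteq> {e. br y e \<in> D3}"
      proof -
        have "span {x4, w1, w2} = D"
        proof (rule dim_3_combination)
          fix a b c assume eq: "a *\<^sub>R x4 + b *\<^sub>R w1 + c *\<^sub>R w2 = 0"
          have "a = 0"
            by (rule coefficient_zero[of a x4 "b *\<^sub>R w1 + c *\<^sub>R w2" D2])
              (use eq g sub(1) w(1,2) in \<open>auto simp: add.assoc good_def x4_def subspace_add subspace_scale\<close>)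
          then show "a = 0 \<and> b = 0 \<and> c = 0"
            using eq independent_2[OF w(3,4)] by simp
        qed (use d x4D w D2D in auto)
        moreover have "span {x4, w1, w2} \<subseteq> {e. br y e \<in> D3}"
        proof (rule span_minimal)
          have "br y x4 \<in> D3"
            using x4y sub by (subst br_anti) (simp add: subspace_neg)
          then show "{x4, w1, w2} \<subseteq> {e. br y e \<in> D3}"
            using brD2 w by auto
          show "subspace {e. br y e \<in> D3}"
            using sub(2) by (auto simp: subspace_def)
        qed
        ultimately show ?thesis
          by simp
      qed
      then show "br y e \<in> D3"
        using e by blast
    qed
    then show False
      using dim_subset[of D2 D3] dims by simp
  qed
  \<comment> \<open>A change of \<open>p\<close>, \<open>q\<close> of determinant one keeps
    \<open>x4\<close> and moves \<open>br x2 x4\<close> into the line \<open>D3\<close>.\<close>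
  then have "\<exists>x1 x2. br x1 x2 = x4 \<and> good x1 x2 r \<and> br x1 x4 \<notin> D3 \<and> br x2 x4 \<in> D3"
  proof (cases "br p x4 \<in> D3")
    case True
    have "br q (- p) = x4"
      using br_anti[of q p] by (simp add: x4_def)
    then show ?thesis
      using True g sub \<open>\<not> (br p x4 \<in> D3 \<and> br q x4 \<in> D3)\<close>
      by (intro exI[of _ q] exI[of _ "- p"]) (simp add: good_def x4_def subspace_neg)
  next
    case False
    obtain e where e: "e \<in> D3" "e \<noteq> 0"
      using D3 subspace_0[OF sub(2)] by blast
    have "D3 = span {e}"
      by (rule dim_1_span[OF sub(2) dims(2) e])
    then have "D2 = span {e, br p x4}"
      using False e D32 brD[OF x4D] by (intro dim_2_span[OF sub(1) dims(1)]) auto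
    then obtain l m where "br q x4 = m *\<^sub>R e + l *\<^sub>R br p x4"
      using brD[OF x4D, of q] in_span_2 by metis
    then have "br (q - l *\<^sub>R p) x4 \<in> D3"
      using e sub by (simp add: subspace_scale)
    moreover have "br p (q - l *\<^sub>R p) = x4"
      by (simp add: x4_def)
    moreover have "good p (q - l *\<^sub>R p) r"
      using g sub \<open>br p (q - l *\<^sub>R p) = x4\<close>
      by (simp add: good_def x4_def subspace_diff subspace_scale)
    ultimately show ?thesis
      using False by blast
  qed
  then obtain x1 x2 where x12: "br x1 x2 = x4" and g1: "good x1 x2 r"
    and x14: "br x1 x4 \<notin> D3" and x24: "br x2 x4 \<in> D3"
    by blast
  define x5 x6 where "x5 = br x1 x4" and "x6 = br x1 x5"
  have x5D2: "x5 \<in> D2"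
    by (simp add: x5_def brD x4D)
  then have x5D: "x5 \<in> D"
    using D2D by blast
  have x6D3: "x6 \<in> D3"
    by (simp add: x6_def brD2 x5D2)
  have x45: "br x4 x5 = 0" "br x5 x4 = 0"
    using abel[OF x5D2 x4D] br_swap_0 by auto
  \<comment> \<open>Jacobi for \<open>x2\<close>, \<open>x1\<close>, \<open>x4\<close>, where
    \<open>br x2 x1 = - x4\<close> commutes with \<open>x4\<close> and \<open>br x2 x4\<close> is
    central.\<close>
  have x25: "br x2 x5 = 0"
  proof -
    have "br x2 x4 \<in> Z"
      using x24 D3Z by blast
    then have "br x1 (br x2 x4) = 0"
      by (rule lie_center_br(2))
    then show ?thesis
      using br_br_left[of x2 x1 x4] br_anti[of x2 x1] by (simp add: x5_def x12)
  qed
  have rx4: "br r x4 \<in> D3"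
    using r4[OF g1] x12 by simp
  have rx5: "br r x5 = 0"
  proof -
    have "br r x4 \<in> Z"
      using rx4 D3Z by blast
    moreover have "br r x1 \<in> D2"
      using g1 flip2 by (simp add: good_def)
    then have "br (br r x1) x4 = 0"
      by (rule abel) (rule x4D)
    ultimately show ?thesis
      using br_br_left[of r x1 x4] by (simp add: x5_def lie_center_br)
  qed
  \<comment> \<open>Otherwise \<open>x5\<close> is central and independent of \<open>D3\<close>,
    against \<open>dim Z = 1\<close>.\<close>
  have x6: "x6 \<noteq> 0"
  proof
    assume "x6 = 0"
    have "x5 \<in> Z"
    proof (rule centerI, rule br_swap_0)
      fix y
      obtain c1 c2 c3 c4 c5 c6 where
        y: "y = c1 *\<^sub>R x1 + c2 *\<^sub>R x2 + c3 *\<^sub>R r + c4 *\<^sub>R br x1 x2 + c5 *\<^sub>R w1 + c6 *\<^sub>R w2"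
        by (rule independent6_combination[OF ind[OF g1 w] dim_6])
      have "br x1 x5 = 0"
        using \<open>x6 = 0\<close> by (simp add: x6_def)
      then show "br y x5 = 0"
        using abel[OF w(1) x5D] abel[OF w(2) x5D] by (simp add: y x12 x25 rx5 x45)
    qed
    obtain e where e: "e \<in> D3" "e \<noteq> 0"
      using D3 subspace_0[OF sub(2)] by blast
    have "{e, x5} \<subseteq> Z"
      using e D3Z \<open>x5 \<in> Z\<close> by auto
    moreover have "x5 \<notin> span {e}"
      using x14 dim_1_span[OF sub(2) dims(2) e] by (simp add: x5_def)
    then have "dim {x5, e} = 2"
      using e by (simp add: dim_insert)
    ultimately show False
      using z dim_subset[of "{x5, e}" Z] by auto
  qed
  have D3s: "D3 = span {x6}"
    by (rule dim_1_span[OF sub(2) dims(2) x6D3 x6])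
  have x5n: "x5 \<notin> span {x6}"
    using x14 D3s by (simp add: x5_def)
  have n: "x5 \<noteq> 0" "x6 \<notin> span {x5}"
    using line_swap[OF x5n x6] by simp_all
  have x6D2: "x6 \<in> D2"
    using x6D3 D32 by blast
  have D2s: "D2 = span {x5, x6}"
    by (rule dim_2_span[OF sub(1) dims(1) x5D2 x6D2 n])
  have "br x1 r \<in> D2"
    using g1 by (simp add: good_def)
  then obtain \<alpha> \<alpha>' where \<alpha>: "br x1 r = \<alpha> *\<^sub>R x5 + \<alpha>' *\<^sub>R x6"
    unfolding D2s in_span_2 by blast
  \<comment> \<open>\<open>ad x1\<close> sends \<open>x4\<close>, \<open>x5\<close> to the basis
    \<open>x5\<close>, \<open>x6\<close> of \<open>D2\<close>, so this correction makes
    \<open>x3\<close> commute with \<open>x1\<close>.\<close>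
  define x3 where "x3 = r - \<alpha> *\<^sub>R x4 - \<alpha>' *\<^sub>R x5"
  have x13: "br x1 x3 = 0"
    by (simp add: x3_def \<alpha> x5_def[symmetric] x6_def[symmetric])
  have g3: "good x1 x2 x3"
  proof -
    have "br x2 x3 \<in> D2"
      using g1 sub brD[OF x4D, of x2] brD[OF x5D, of x2]
      by (simp add: good_def x3_def subspace_diff subspace_scale)
    moreover have "x3 \<notin> D"
    proof
      assume "x3 \<in> D"
      then have "x3 + (\<alpha> *\<^sub>R x4 + \<alpha>' *\<^sub>R x5) \<in> D"
        using x4D x5D by (intro subspace_add subspace_scale) auto
      then show False
        using g1 by (simp add: good_def x3_def)
    qed
    ultimately show ?thesis
      using g1 x13 sub by (simp add: good_def subspace_0)
  qed
  have i: "independent6 x1 x2 x3 x4 x5 x6"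
    using ind[OF g3 x5D2 x6D2 n] by (simp add: x12)
  obtain \<beta> \<beta>' where \<beta>: "br x2 x3 = \<beta> *\<^sub>R x5 + \<beta>' *\<^sub>R x6"
    using g3 in_span_2 unfolding good_def D2s by metis
  obtain \<gamma> where \<gamma>: "br x2 x4 = \<gamma> *\<^sub>R x6"
    using x24 unfolding D3s by (auto simp: span_singleton)
  obtain \<delta> where \<delta>: "br x3 x4 = \<delta> *\<^sub>R x6"
    using r4[OF g3] unfolding D3s x12 by (auto simp: span_singleton)
  have x6Z: "x6 \<in> Z"
    using x6D3 D3Z by blast
  note x6c = lie_center_br[OF x6Z]
  have x15: "br x1 x4 = x5" "br x1 x5 = x6"
    by (simp_all add: x5_def x6_def)
  have x35: "br x3 x5 = 0"
    by (simp add: x3_def rx5 x45)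
  have "\<delta> = - \<beta>"
  proof -
    have "br x4 x3 = br x1 (br x2 x3) - br x2 (br x1 x3)"
      using br_br_left[of x1 x2 x3] by (simp add: x12)
    then have "(- \<delta>) *\<^sub>R x6 = \<beta> *\<^sub>R x6"
      using br_anti[of x4 x3] by (simp add: x13 \<beta> \<delta> x15 x6c)
    then have "- \<delta> = \<beta>"
      using x6 scaleR_right_imp_eq by blast
    then show ?thesis
      by simp
  qed
  \<comment> \<open>Otherwise \<open>x3\<close> is central and so lies in \<open>D\<close>, contrary
    to its choice.\<close>
  have "\<beta> \<noteq> 0 \<or> \<beta>' \<noteq> 0"
  proof (rule ccontr)
    assume "\<not> ?thesis"
    then have zero: "br x2 x3 = 0" "br x3 x4 = 0"
      using \<beta> \<delta> \<open>\<delta> = - \<beta>\<close> by simp_all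
    have "x3 \<in> Z"
    proof (rule centerI)
      fix y
      obtain c1 c2 c3 c4 c5 c6 where
        y: "y = c1 *\<^sub>R x1 + c2 *\<^sub>R x2 + c3 *\<^sub>R x3 + c4 *\<^sub>R x4 + c5 *\<^sub>R x5 + c6 *\<^sub>R x6"
        by (rule independent6_combination[OF i dim_6])
      show "br x3 y = 0"
        by (simp add: y zero br_swap_0[OF zero(1)] br_swap_0[OF x13] x35 x6c)
    qed
    then show False
      using g3 center_subset_derived[OF d] by (auto simp: good_def)
  qed
  moreover have "lie_isomorphic br (fam_4step \<beta> \<beta>' \<gamma>)"
    by (intro basisI[OF lie_algebra_families(6) i])
      (simp_all add: comb_simps x12 x13 x15 \<beta> \<gamma> \<delta> \<open>\<delta> = - \<beta>\<close> x25 x35 x45 x6c)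
  ultimately show ?thesis
    using fam_4step_model lie_isomorphic_trans by blast
qed

lemma classification: "\<exists>m\<in>set models. lie_isomorphic br m"
proof -
  consider "dim D = 1" | "dim D = 2" "D \<subseteq> Z" | "dim D = 2" "\<not> D \<subseteq> Z"
    | "dim D = 3" "dim Z = 2" | "dim D = 3" "dim Z = 1"
    using derived_nonzero dim_D_le dim_Z_pos dim_Z_le by linarith
  then show ?thesis
  proof cases
    case 1
    then show ?thesis
      using case_dim_1 by (auto simp: models_def)
  next
    case 2
    then show ?thesis
      using case_two_step fam_pencil_model lie_isomorphic_trans by blast
  next
    case 3
    then show ?thesis
      using case_three_step fam_12_15_model lie_isomorphic_trans by blast
  qed (use case_dim_3_center_2 case_dim_3_center_1 in auto)
qed

end

section \<open>Transfer between arbitrary real vector spaces and \<open>real^6\<close>\<close>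

lemma nilpotent_lie_algebraI:
  assumes "nilpotent_lie_algebra_6 br"
  shows "nilpotent_lie_algebra br"
  using assms
  by (simp add: nilpotent_lie_algebra_6_def nilpotent_lie_algebra_def nilpotent_lie_algebra_axioms_def)

lemma open_decomposition_four_conditions:
  fixes br :: "real^6 \<Rightarrow> real^6 \<Rightarrow> real^6"
  assumes "nilpotent_lie_algebra_6 br" "open_respectful_decomposition br H V" "dim H = 3"
  shows "four_conditions br"
proof -
  interpret nilpotent_lie_algebra br
    using assms(1) by (rule nilpotent_lie_algebraI)
  interpret open_decomposition br H V
    by unfold_locales (use assms in auto)
  show ?thesis
    by (rule four_conditions)
qed

lemma models_properties:
  assumes "m \<in> set models"
  shows "nilpotent_lie_algebra_6 m" "\<exists>H V. open_respectful_decomposition m H V \<and> dim H = 3"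
  using assms lie_algebra_models nilpotent_models decomposition_models
  by (auto simp: models_def intro!: nilpotent_lie_algebra_6I)

theorem theorem3:
  shows "(\<forall>br :: 'a::real_vector \<Rightarrow> 'a \<Rightarrow> 'a.
           nilpotent_lie_algebra_6 br \<and>
           (\<exists>H V. open_respectful_decomposition br H V \<and> dim H = 3) \<longrightarrow>
           four_conditions br) \<and>
         (\<exists>L :: (real^6 \<Rightarrow> real^6 \<Rightarrow> real^6) set.
           card L = 14 \<and>
           (\<forall>br\<in>L. nilpotent_lie_algebra_6 br \<and> four_conditions br) \<and>
           (\<forall>br\<in>L. \<forall>br'\<in>L. br \<noteq> br' \<longrightarrow> \<not> lie_isomorphic br br') \<and>
           (\<forall>br :: 'a \<Rightarrow> 'a \<Rightarrow> 'a. nilpotent_lie_algebra_6 br \<and> four_conditions br \<longrightarrow>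
              (\<exists>br'\<in>L. lie_isomorphic br br')) \<and>
           (\<forall>br\<in>L. \<exists>H V. open_respectful_decomposition br H V \<and> dim H = 3))"
proof (intro conjI allI impI exI[of _ "set models"] ballI)
  fix br :: "'a \<Rightarrow> 'a \<Rightarrow> 'a"
  assume *: "nilpotent_lie_algebra_6 br \<and>
    (\<exists>H V. open_respectful_decomposition br H V \<and> dim H = 3)"
  then obtain H V where HV: "open_respectful_decomposition br H V" "dim H = 3"
    by blast
  obtain br' :: "real^6 \<Rightarrow> real^6 \<Rightarrow> real^6" and f where "lie_isomorphism br br' f"
    using * lie_isomorphic_real6 lie_isomorphic_iff nilpotent_lie_algebra_6_def by metis
  then interpret f: lie_isomorphism br br' f .
  show "four_conditions br"
  proof (rule f.four_conditions_image, rule open_decomposition_four_conditions)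
    show "nilpotent_lie_algebra_6 br'"
      using * f.nilpotent_lie_algebra_6_image by blast
    show "open_respectful_decomposition br' (f ` H) (f ` V)"
      by (rule f.open_respectful_decomposition_image) (rule HV)
    show "dim (f ` H) = 3"
      by (simp add: f.dim_image HV)
  qed
next
  show "card (set models) = 14"
  proof -
    have "distinct models"
      using distinct_invariants unfolding distinct_map by blast
    moreover have "length models = 14"
      by (simp add: models_def)
    ultimately show ?thesis
      by (metis distinct_card)
  qed
next
  fix m assume m: "m \<in> set models"
  show "nilpotent_lie_algebra_6 m" "\<exists>H V. open_respectful_decomposition m H V \<and> dim H = 3"
    by (rule models_properties[OF m])+
  then show "four_conditions m"
    using open_decomposition_four_conditions by blast
next
  fix m m' assume "m \<in> set models" "m' \<in> set models" "m \<noteq> m'"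
  then have "lie_invariants m \<noteq> lie_invariants m'"
    using distinct_invariants by (auto simp: distinct_map dest: inj_onD)
  then show "\<not> lie_isomorphic m m'"
    using lie_isomorphic_invariants by blast
next
  fix br :: "'a \<Rightarrow> 'a \<Rightarrow> 'a"
  assume *: "nilpotent_lie_algebra_6 br \<and> four_conditions br"
  obtain br' :: "real^6 \<Rightarrow> real^6 \<Rightarrow> real^6" where iso: "lie_isomorphic br br'"
    using * lie_isomorphic_real6 nilpotent_lie_algebra_6_def by metis
  then obtain f where f: "lie_isomorphism br br' f"
    using lie_isomorphic_iff by blast
  have nil: "nilpotent_lie_algebra_6 br'"
    using * lie_isomorphism.nilpotent_lie_algebra_6_image[OF f] by blast
  interpret nilpotent_lie_algebra br'
    using nil by (rule nilpotent_lie_algebraI)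
  interpret nilpotent_6 br'
  proof
    \<comment> \<open>\<open>four_conditions_image\<close> pulls conditions back, so they reach
      \<open>br'\<close> along the inverse isomorphism.\<close>
    show "four_conditions br'"
      using * lie_isomorphism.four_conditions_image[OF lie_isomorphism_inv[OF f]] by blast
  qed simp
  show "\<exists>m\<in>set models. lie_isomorphic br m"
    using classification iso lie_isomorphic_trans by blast
qed

end
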